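(* Let $\mathbb K$ be a local field, $\Gamma$ a finitely generated word-hyperbolic group, $z\in\partial\Gamma$ and $r\in\{2,\dots,d-1\}$. If there is no continuous injective map $\partial\Gamma\setminus\{z\}\to\mathbb P(\mathbb K^r)$, then there is no $(1,1,r)$-hyperconvex representation $\rho:\Gamma\to\mathrm{PGL}_d(\mathbb K)$.
   Context: $\mathbb K$ is a commutative local field ($\mathbb R$, $\mathbb C$ or non-Archimedean). $\mathbb K^d$ carries a good norm (inner/Hermitian product norm if Archimedean; $\|\sum a_ie_i\|=\max|a_i|$ otherwise). Every $g\in\mathrm{GL}_d(\mathbb K)$ has a Cartan decomposition $g=k_ga_gl_g$, $k_g,l_g$ in the maximal compact group preserving the norm ($\mathrm{GL}_d(\mathcal O)$, $\mathcal O$ the valuation ring, in the non-Archimedean case), $a_g$ diagonal in an orthonormal basis $(e_i)$ with entries of absolute values $\sigma_1(g)\ge\dots\ge\sigma_d(g)$ (the singular values); ratios $\sigma_i/\sigma_j$ are well defined on $\mathrm{PGL}_d(\mathbb K)$. $U_p(g)=k_g\langle e_1,\dots,e_p\rangle$ for a chosen decomposition. $|\gamma|$ is word length for a fixed finite symmetric generating set; $\partial\Gamma$ is the Gromov boundary. $\rho:\Gamma\to\mathrm{PGL}_d(\mathbb K)$ is $\{\mathsf a_p\}$-Anosov if there are $c,\mu>0$ with $\frac{\sigma_{p+1}}{\sigma_p}(\rho(\gamma))\le ce^{-\mu|\gamma|}$ for all $\gamma$; with several indices listed, this is required for each. Then $\xi^k(x)=\lim_nU_k(\rho(\gamma_n))$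 ($k\in\{p,d-p\}$, $(\gamma_n)$ any geodesic ray converging to $x\in\partial\Gamma$) defines continuous $\rho$-equivariant maps $\xi^k:\partial\Gamma\to\mathcal G_k(\mathbb K^d)$ into Grassmannians with $\xi^p(x)\oplus\xi^{d-p}(y)=\mathbb K^d$ for $x\ne y$. $\rho$ is $(1,1,r)$-hyperconvex if it is $\{\mathsf a_1,\mathsf a_r\}$-Anosov and $(\xi^1(x)\oplus\xi^1(y))\cap\xi^{d-r}(z)=\{0\}$ for all pairwise distinct $x,y,z\in\partial\Gamma$. *)

theory Defs
  imports
    "HOL-Analysis.Abstract_Metric_Spaces"
    "HOL-Analysis.Function_Topology"
    "HOL-Algebra.Generated_Groups"
    "Jordan_Normal_Form.DL_Rank"
begin

unbundle no vec_syntax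

definition absolute_value :: "('k::field \<Rightarrow> real) \<Rightarrow> bool" where
  "absolute_value v \<longleftrightarrow>
     (\<forall>x. 0 \<le> v x) \<and> (\<forall>x. v x = 0 \<longleftrightarrow> x = 0) \<and>
     (\<forall>x y. v (x * y) = v x * v y) \<and> (\<forall>x y. v (x + y) \<le> v x + v y)"

definition ultrametric :: "('k::field \<Rightarrow> real) \<Rightarrow> bool" where
  "ultrametric v \<longleftrightarrow> (\<forall>x y. v (x + y) \<le> max (v x) (v y))"

definition field_topology :: "('k::field \<Rightarrow> real) \<Rightarrow> 'k topology" where
  "field_topology v = Metric_space.mtopology UNIV (\<lambda>x y. v (x - y))"

definition nonarch_local_field :: "('k::field \<Rightarrow> real) \<Rightarrow> bool" where
  "nonarch_local_field v \<longleftrightarrow>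
     absolute_value v \<and> ultrametric v \<and> (\<exists>x. x \<noteq> 0 \<and> v x \<noteq> 1) \<and>
     locally_compact_space (field_topology v)"

text \<open>In the Archimedean case the absolute value is the usual one, not a power of it, so that
  the norm \<open>good_norm\<close> below is the one of an inner or Hermitian product.\<close>

definition local_field :: "('k::field \<Rightarrow> real) \<Rightarrow> bool" where
  "local_field v \<longleftrightarrow>
     (\<exists>\<phi> :: 'k \<Rightarrow> real. field_hom \<phi> \<and> bij \<phi> \<and> (\<forall>x. v x = \<bar>\<phi> x\<bar>)) \<or>
     (\<exists>\<phi> :: 'k \<Rightarrow> complex. field_hom \<phi> \<and> bij \<phi> \<and> (\<forall>x. v x = cmod (\<phi> x))) \<or>
     nonarch_local_field v"

definition quotient_topology :: "'a topology \<Rightarrow> ('a \<Rightarrow> 'b) \<Rightarrow> 'b set \<Rightarrow> 'b topology" where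
  "quotient_topology X f Y =
     topology (\<lambda>U. U \<subseteq> Y \<and> openin X {x \<in> topspace X. f x \<in> U})"

lemma openin_quotient_topology:
  "openin (quotient_topology X f Y) U \<longleftrightarrow> U \<subseteq> Y \<and> openin X {x \<in> topspace X. f x \<in> U}"
proof -
  have "istopology (\<lambda>U. U \<subseteq> Y \<and> openin X {x \<in> topspace X. f x \<in> U})"
    unfolding istopology_def
  proof (intro conjI allI impI)
    fix S T
    assume "S \<subseteq> Y \<and> openin X {x \<in> topspace X. f x \<in> S}"
      and "T \<subseteq> Y \<and> openin X {x \<in> topspace X. f x \<in> T}"
    moreover have "{x \<in> topspace X. f x \<in> S \<inter> T} =
        {x \<in> topspace X. f x \<in> S} \<inter> {x \<in> topspace X. f x \<in> T}" by auto
    ultimately show "S \<inter> T \<subseteq> Y" "openin X {x \<in> topspace X. f x \<in> S \<inter> T}" by auto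
  next
    fix \<K>
    assume *: "\<forall>K\<in>\<K>. K \<subseteq> Y \<and> openin X {x \<in> topspace X. f x \<in> K}"
    have "{x \<in> topspace X. f x \<in> \<Union>\<K>} = (\<Union>K\<in>\<K>. {x \<in> topspace X. f x \<in> K})" by auto
    then show "\<Union>\<K> \<subseteq> Y" "openin X {x \<in> topspace X. f x \<in> \<Union>\<K>}" using * by auto
  qed
  then show ?thesis by (simp add: quotient_topology_def)
qed

definition mat_topology :: "('k::field \<Rightarrow> real) \<Rightarrow> nat \<Rightarrow> nat \<Rightarrow> 'k mat topology" where
  "mat_topology v n k = Metric_space.mtopology (carrier_mat n k)
     (\<lambda>A B. \<Sum>i<n. \<Sum>j<k. v (A $$ (i,j) - B $$ (i,j)))"

definition Grass :: "nat \<Rightarrow> nat \<Rightarrow> 'k::field vec set set" where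
  "Grass n k = {W. VectorSpace.subspace class_ring W (module_vec TYPE('k) n) \<and>
     vectorspace.dim class_ring ((module_vec TYPE('k) n)\<lparr>carrier := W\<rparr>) = k}"

text \<open>A \<open>k\<close>-frame is an \<open>n\<close> by \<open>k\<close> matrix with linearly independent columns; the
  Grassmannian carries the quotient topology from the space of frames.\<close>

definition grass_topology :: "('k::field \<Rightarrow> real) \<Rightarrow> nat \<Rightarrow> nat \<Rightarrow> 'k vec set topology" where
  "grass_topology v n k = quotient_topology
     (subtopology (mat_topology v n k) {A \<in> carrier_mat n k. vec_space.rank n A = k})
     (vec_space.col_space n) (Grass n k)"

definition proj_space_topology :: "('k::field \<Rightarrow> real) \<Rightarrow> nat \<Rightarrow> 'k vec set topology" where
  "proj_space_topology v n = grass_topology v n 1"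

definition GL :: "nat \<Rightarrow> 'k::field mat monoid" where
  "GL d = \<lparr>carrier = {A \<in> carrier_mat d d. invertible_mat A}, mult = (*), one = 1\<^sub>m d\<rparr>"

definition scalar_mats :: "nat \<Rightarrow> 'k::field mat set" where
  "scalar_mats d = {c \<cdot>\<^sub>m 1\<^sub>m d | c. c \<noteq> 0}"

definition PGL :: "nat \<Rightarrow> 'k::field mat set monoid" where
  "PGL d = GL d Mod scalar_mats d"

text \<open>The norm for which the standard basis is orthonormal.\<close>

definition good_norm :: "('k::field \<Rightarrow> real) \<Rightarrow> 'k vec \<Rightarrow> real" where
  "good_norm v w =
     (if ultrametric v then (MAX i\<in>{..<dim_vec w}. v (w $ i))
      else sqrt (\<Sum>i<dim_vec w. (v (w $ i))\<^sup>2))"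

definition norm_stabilizer :: "('k::field \<Rightarrow> real) \<Rightarrow> nat \<Rightarrow> 'k mat set" where
  "norm_stabilizer v d = {k \<in> carrier (GL d).
     \<forall>w \<in> carrier_vec d. good_norm v (k *\<^sub>v w) = good_norm v w}"

definition cartan_decomposition ::
  "('k::field \<Rightarrow> real) \<Rightarrow> nat \<Rightarrow> 'k mat \<Rightarrow> 'k mat \<times> 'k mat \<times> 'k mat \<Rightarrow> bool" where
  "cartan_decomposition v d g = (\<lambda>(k, a, l).
     k \<in> norm_stabilizer v d \<and> l \<in> norm_stabilizer v d \<and>
     a \<in> carrier (GL d) \<and> diagonal_mat a \<and>
     (\<forall>i j. i \<le> j \<longrightarrow> j < d \<longrightarrow> v (a $$ (j,j)) \<le> v (a $$ (i,i))) \<and>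
     g = k * a * l)"

definition chosen_cartan ::
  "('k::field \<Rightarrow> real) \<Rightarrow> nat \<Rightarrow> 'k mat \<Rightarrow> 'k mat \<times> 'k mat \<times> 'k mat" where
  "chosen_cartan v d g = (SOME kal. cartan_decomposition v d g kal)"

text \<open>Indices of singular values start at \<open>1\<close>, those of matrix entries at \<open>0\<close>.\<close>

definition singular_value :: "('k::field \<Rightarrow> real) \<Rightarrow> nat \<Rightarrow> nat \<Rightarrow> 'k mat \<Rightarrow> real" where
  "singular_value v d i g = (case chosen_cartan v d g of (k, a, l) \<Rightarrow> v (a $$ (i - 1, i - 1)))"

definition cartan_subspace :: "('k::field \<Rightarrow> real) \<Rightarrow> nat \<Rightarrow> nat \<Rightarrow> 'k mat \<Rightarrow> 'k vec set" where
  "cartan_subspace v d p g = (case chosen_cartan v d g of (k, a, l) \<Rightarrow>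
     (\<lambda>w. k *\<^sub>v w) `
       LinearCombinations.module.span class_ring (module_vec TYPE('k) d) (unit_vec d ` {..<p}))"

text \<open>Elements of \<open>PGL d\<close> are cosets; ratios of singular values do not depend on the
  representative.\<close>

definition pgl_rep :: "'k mat set \<Rightarrow> 'k mat" where
  "pgl_rep X = (SOME g. g \<in> X)"

definition pgl_sv_ratio :: "('k::field \<Rightarrow> real) \<Rightarrow> nat \<Rightarrow> nat \<Rightarrow> nat \<Rightarrow> 'k mat set \<Rightarrow> real" where
  "pgl_sv_ratio v d i j X =
     singular_value v d i (pgl_rep X) / singular_value v d j (pgl_rep X)"

definition pgl_U :: "('k::field \<Rightarrow> real) \<Rightarrow> nat \<Rightarrow> nat \<Rightarrow> 'k mat set \<Rightarrow> 'k vec set" where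
  "pgl_U v d p X = cartan_subspace v d p (pgl_rep X)"

definition word_length :: "('g, 'm) monoid_scheme \<Rightarrow> 'g set \<Rightarrow> 'g \<Rightarrow> nat" where
  "word_length G S g =
     (LEAST n. \<exists>ws. length ws = n \<and> set ws \<subseteq> S \<and> foldr (\<lambda>x y. x \<otimes>\<^bsub>G\<^esub> y) ws \<one>\<^bsub>G\<^esub> = g)"

definition word_dist :: "('g, 'm) monoid_scheme \<Rightarrow> 'g set \<Rightarrow> 'g \<Rightarrow> 'g \<Rightarrow> nat" where
  "word_dist G S g h = word_length G S (inv\<^bsub>G\<^esub> g \<otimes>\<^bsub>G\<^esub> h)"

definition symmetric_generating_set :: "('g, 'm) monoid_scheme \<Rightarrow> 'g set \<Rightarrow> bool" where
  "symmetric_generating_set G S \<longleftrightarrow>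
     S \<subseteq> carrier G \<and> (\<forall>s\<in>S. inv\<^bsub>G\<^esub> s \<in> S) \<and> generate G S = carrier G"

definition gromov_product :: "('g, 'm) monoid_scheme \<Rightarrow> 'g set \<Rightarrow> 'g \<Rightarrow> 'g \<Rightarrow> 'g \<Rightarrow> real" where
  "gromov_product G S w x y =
     (real (word_dist G S x w) + real (word_dist G S y w) - real (word_dist G S x y)) / 2"

text \<open>\<open>G\<close> is a word-hyperbolic group with fixed finite symmetric generating set \<open>S\<close>;
  hyperbolicity is Gromov's four-point condition.\<close>

definition word_hyperbolic :: "('g, 'm) monoid_scheme \<Rightarrow> 'g set \<Rightarrow> bool" where
  "word_hyperbolic G S \<longleftrightarrow>
     group G \<and> finite S \<and> symmetric_generating_set G S \<and>
     (\<exists>\<delta>. \<forall>w\<in>carrier G. \<forall>x\<in>carrier G. \<forall>y\<in>carrier G. \<forall>z\<in>carrier G.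
        gromov_product G S w x z \<ge>
          min (gromov_product G S w x y) (gromov_product G S w y z) - \<delta>)"

definition geodesic_rays :: "('g, 'm) monoid_scheme \<Rightarrow> 'g set \<Rightarrow> (nat \<Rightarrow> 'g) set" where
  "geodesic_rays G S = {\<gamma>. range \<gamma> \<subseteq> carrier G \<and>
     (\<forall>m n. m \<le> n \<longrightarrow> word_dist G S (\<gamma> m) (\<gamma> n) = n - m)}"

definition asymptotic :: "('g, 'm) monoid_scheme \<Rightarrow> 'g set \<Rightarrow> ((nat \<Rightarrow> 'g) \<times> (nat \<Rightarrow> 'g)) set" where
  "asymptotic G S = {(\<alpha>, \<beta>). \<alpha> \<in> geodesic_rays G S \<and> \<beta> \<in> geodesic_rays G S \<and>
     (\<exists>C. \<forall>n. word_dist G S (\<alpha> n) (\<beta> n) \<le> C)}"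

text \<open>A boundary point is a class of asymptotic geodesic rays, that is, the set of all geodesic
  rays converging to it.\<close>

definition gromov_boundary :: "('g, 'm) monoid_scheme \<Rightarrow> 'g set \<Rightarrow> (nat \<Rightarrow> 'g) set set" where
  "gromov_boundary G S = geodesic_rays G S // asymptotic G S"

text \<open>The boundary is topologized as a quotient of the space of geodesic rays issued from the
  identity, with the topology of pointwise (equivalently, locally uniform) convergence.\<close>

definition boundary_topology ::
  "('g, 'm) monoid_scheme \<Rightarrow> 'g set \<Rightarrow> (nat \<Rightarrow> 'g) set topology" where
  "boundary_topology G S = quotient_topology
     (subtopology (product_topology (\<lambda>_. discrete_topology (carrier G)) UNIV)
        {\<gamma> \<in> geodesic_rays G S. \<gamma> 0 = \<one>\<^bsub>G\<^esub>})
     (\<lambda>\<gamma>. asymptotic G S `` {\<gamma>}) (gromov_boundary G S)"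

lemma topspace_boundary_topology [simp]:
  "topspace (boundary_topology G S) = gromov_boundary G S"
proof -
  let ?R = "subtopology (product_topology (\<lambda>_. discrete_topology (carrier G)) UNIV)
        {\<gamma> \<in> geodesic_rays G S. \<gamma> 0 = \<one>\<^bsub>G\<^esub>}"
  have "{\<gamma> \<in> topspace ?R. asymptotic G S `` {\<gamma>} \<in> gromov_boundary G S} = topspace ?R"
    by (auto simp: gromov_boundary_def quotient_def)
  then have "openin (boundary_topology G S) (gromov_boundary G S)"
    unfolding boundary_topology_def openin_quotient_topology by (metis openin_topspace subset_refl)
  moreover have "topspace (boundary_topology G S) \<subseteq> gromov_boundary G S"
    using openin_topspace[of "boundary_topology G S"]
    unfolding boundary_topology_def openin_quotient_topology by blast
  ultimately show ?thesis by (simp add: openin_subset subset_antisym)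
qed

definition anosov ::
  "('k::field \<Rightarrow> real) \<Rightarrow> nat \<Rightarrow> ('g, 'm) monoid_scheme \<Rightarrow> 'g set \<Rightarrow> nat \<Rightarrow> ('g \<Rightarrow> 'k mat set) \<Rightarrow> bool"
where
  "anosov v d G S p \<rho> \<longleftrightarrow>
     (\<exists>c>0. \<exists>\<mu>>0. \<forall>\<gamma>\<in>carrier G.
        pgl_sv_ratio v d (p + 1) p (\<rho> \<gamma>) \<le> c * exp (- \<mu> * real (word_length G S \<gamma>)))"

definition limit_map ::
  "('k::field \<Rightarrow> real) \<Rightarrow> nat \<Rightarrow> nat \<Rightarrow> ('g \<Rightarrow> 'k mat set) \<Rightarrow> (nat \<Rightarrow> 'g) set \<Rightarrow> 'k vec set"
where
  "limit_map v d k \<rho> x =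
     (THE W. \<forall>\<gamma>\<in>x. limitin (grass_topology v d k) (\<lambda>n. pgl_U v d k (\<rho> (\<gamma> n))) W sequentially)"

definition hyperconvex_1_1 ::
  "('k::field \<Rightarrow> real) \<Rightarrow> nat \<Rightarrow> ('g, 'm) monoid_scheme \<Rightarrow> 'g set \<Rightarrow> nat \<Rightarrow> ('g \<Rightarrow> 'k mat set) \<Rightarrow> bool"
where
  "hyperconvex_1_1 v d G S r \<rho> \<longleftrightarrow>
     anosov v d G S 1 \<rho> \<and> anosov v d G S r \<rho> \<and>
     (\<forall>x\<in>gromov_boundary G S. \<forall>y\<in>gromov_boundary G S. \<forall>z\<in>gromov_boundary G S.
        x \<noteq> y \<longrightarrow> y \<noteq> z \<longrightarrow> x \<noteq> z \<longrightarrow>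
        {u + w | u w. u \<in> limit_map v d 1 \<rho> x \<and> w \<in> limit_map v d 1 \<rho> y}
          \<inter> limit_map v d (d - r) \<rho> z = {0\<^sub>v d})"

end

theory Submission
  imports Defs
begin

text \<open>Let \<open>W = \<xi>\<^sup>d\<^sup>-\<^sup>r(z)\<close>. The projection of \<open>K\<^sup>d\<close> onto \<open>K\<^sup>d / W\<close>, which has dimension \<open>r\<close>, sends the lines
  \<open>\<xi>\<^sup>1(x)\<close> with \<open>x \<noteq> z\<close> to points of a projective space, continuously in \<open>x\<close>. Hyperconvexity says that
  none of these lines lies in \<open>W\<close> and that the images of \<open>\<xi>\<^sup>1(x) \<noteq> \<xi>\<^sup>1(y)\<close> differ. It also replaces the
  usual transversality argument in the proof that \<open>\<xi>\<^sup>1\<close> is injective: \<open>\<xi>\<^sup>d\<^sup>-\<^sup>r(y)\<close> contains \<open>\<xi>\<^sup>1(y)\<close> but meets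
  \<open>\<xi>\<^sup>1(x)\<close> trivially as soon as the boundary has a third point. If it has none, a constant map
  is continuous and injective.

  The limit maps exist because \<open>U\<^sub>p(g h)\<close> is at distance at most \<open>C(h) \<sigma>\<^sub>p\<^sub>+\<^sub>1(g) / \<sigma>\<^sub>p(g)\<close> from \<open>U\<^sub>p(g)\<close>, so that
  \<open>U\<^sub>p\<close> is a Cauchy sequence along every geodesic ray, with a geometric rate depending only on the
  starting point of the ray. Compactness of the group of isometries turns this into convergence in
  the Grassmannian, and uniformity of the rate into continuity of the limit.\<close>

section \<open>Norms over local fields\<close>

text \<open>Two objects of the statement are picked by choice operators:
  \<open>chosen_cartan\<close> is a \<open>SOME\<close>, \<open>limit_map\<close> a
  \<open>THE\<close>. So Cartan decompositions have to be constructed, by induction on the dimension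
  from a vector of maximal stretch, and limits have to be shown unique in the quotient topology of
  the Grassmannian. The factor k of a decomposition is far from unique, hence the chosen k need not
  converge along a ray; only the spans of their first p columns do. This is why convergence is
  tested on cluster points of the isometries.

  The constant C(h) is a product of bounds for h and for its inverse; the second one enters through
  the comparison of the singular values of g h with those of g.

  The Anosov condition provides a gap at r, while hyperconvexity involves the index d - r. Inversion
  exchanges the two: it turns singular values into their reciprocals in reverse order and preserves
  word length.

  The inclusion of \<xi>^1(z) in W has a topological use as well: among all boundary points, those
  whose line is not contained in W are exactly the points other than z, so preimages of open sets
  need no separate treatment near z.\<close>

locale local_field_abs =
  fixes v :: "'k::field \<Rightarrow> real"
  assumes local_field: "local_field v"
begin

text \<open>Merges the real and the complex case: the field becomes a subfield of the complex
  numbers. Later arguments use only that the image is closed, stable under conjugation and contains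
  the reals.\<close>

lemma arch_embedding:
  assumes "\<not> nonarch_local_field v"
  obtains \<phi> :: "'k \<Rightarrow> complex" where "field_hom \<phi>" "inj \<phi>" "\<And>x. v x = cmod (\<phi> x)"
    "range \<phi> = UNIV \<or> range \<phi> = \<real>"
proof -
  consider (r) \<phi> :: "'k \<Rightarrow> real" where "field_hom \<phi>" "bij \<phi>" "\<forall>x. v x = \<bar>\<phi> x\<bar>"
    | (c) \<phi> :: "'k \<Rightarrow> complex" where "field_hom \<phi>" "bij \<phi>" "\<forall>x. v x = cmod (\<phi> x)"
    using local_field assms unfolding local_field_def by blast
  then show thesis
  proof cases
    case r
    interpret field_hom \<phi> by fact
    have "field_hom (\<lambda>x. complex_of_real (\<phi> x))"
      by unfold_locales (auto simp: hom_distribs)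
    moreover have "inj (\<lambda>x. complex_of_real (\<phi> x))"
      using r(2) by (auto simp: inj_def bij_def)
    moreover have "range (\<lambda>x. complex_of_real (\<phi> x)) = \<real>"
      using r(2) unfolding bij_def by (metis Reals_def image_image)
    ultimately show ?thesis using that r(3) by auto
  next
    case c
    then show ?thesis using that by (auto simp: bij_def)
  qed
qed

lemma not_nonarch_imp:
  assumes "\<not> nonarch_local_field v"
  shows "\<not> ultrametric v \<and> absolute_value v"
proof -
  obtain \<phi> :: "'k \<Rightarrow> complex" where \<phi>: "field_hom \<phi>" "\<And>x. v x = cmod (\<phi> x)"
    using arch_embedding[OF assms] by blast
  interpret field_hom \<phi> by fact
  \<comment> \<open>The element 2 violates the ultrametric inequality.\<close>
  have "v (1 + 1) = 2" "v 1 = 1" using \<phi>(2) by (auto simp: hom_distribs)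
  then have "\<not> ultrametric v"
    unfolding ultrametric_def by (metis max.idem not_less one_less_numeral_iff semiring_norm(76))
  moreover have "absolute_value v"
    unfolding absolute_value_def using \<phi>(2) by (auto simp: hom_distribs norm_mult norm_triangle_ineq)
  ultimately show ?thesis by auto
qed

text \<open>\<open>local_field\<close> distinguishes cases by \<open>nonarch_local_field\<close>,
  \<open>good_norm\<close> by \<open>ultrametric\<close>; from here on a single case distinction
  serves both.\<close>

lemma nonarch_iff: "nonarch_local_field v \<longleftrightarrow> ultrametric v"
  using not_nonarch_imp nonarch_local_field_def by blast

lemma absolute_value: "absolute_value v"
  using not_nonarch_imp nonarch_local_field_def by blast

lemma v_nonneg [simp]: "0 \<le> v x"
  and v_eq_0 [simp]: "v x = 0 \<longleftrightarrow> x = 0"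
  and v_mult: "v (x * y) = v x * v y"
  and v_triangle: "v (x + y) \<le> v x + v y"
  using absolute_value unfolding absolute_value_def by auto

lemma v_0 [simp]: "v 0 = 0" by simp

lemma v_pos [simp]: "0 < v x \<longleftrightarrow> x \<noteq> 0"
  by (metis less_eq_real_def v_eq_0 v_nonneg order_less_irrefl)

lemma v_1 [simp]: "v 1 = 1"
  by (metis mult_cancel_left2 v_eq_0 v_mult zero_neq_one mult_1)

lemma v_minus [simp]: "v (- x) = v x"
proof -
  have "v (-1) * v (-1) = 1" by (metis minus_mult_minus mult_1 v_1 v_mult)
  then have "v (-1) = 1" by (metis abs_of_nonneg real_sqrt_abs2 real_sqrt_one v_nonneg)
  then show ?thesis by (metis mult_1 mult_minus1 v_mult)
qed

lemma v_diff_commute: "v (x - y) = v (y - x)"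
  by (metis minus_diff_eq v_minus)

lemma v_inverse: "v (inverse x) = inverse (v x)"
  by (metis inverse_unique inverse_zero right_inverse v_0 v_1 v_mult)

lemma v_divide: "v (x / y) = v x / v y"
  by (simp add: divide_inverse v_inverse v_mult)

lemma v_power: "v (x ^ n) = v x ^ n"
  by (induction n) (auto simp: v_mult)

lemma v_sum: "v (sum f A) \<le> (\<Sum>i\<in>A. v (f i))"
  by (induction A rule: infinite_finite_induct) (auto intro: order_trans[OF v_triangle])

lemma v_add_ultra: "ultrametric v \<Longrightarrow> v (x + y) \<le> max (v x) (v y)"
  unfolding ultrametric_def by auto

lemma v_sum_ultra:
  assumes "ultrametric v" "\<And>i. i \<in> A \<Longrightarrow> v (f i) \<le> C" "0 \<le> C"
  shows "v (sum f A) \<le> C"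
  using assms(2)
proof (induction A rule: infinite_finite_induct)
  case (insert x F)
  have "v (f x) \<le> C" "v (sum f F) \<le> C" using insert by auto
  then show ?case using v_add_ultra[OF assms(1), of "f x" "sum f F"] insert.hyps by auto
qed (use assms in auto)

sublocale v_metric: Metric_space UNIV "\<lambda>x y. v (x - y)"
proof
  show "v (x - z) \<le> v (x - y) + v (y - z)" for x y z
    using v_triangle[of "x - y" "y - z"] by simp
qed (auto simp: v_diff_commute)

text \<open>Local compactness only gives a compact neighbourhood of 0. Multiplication by a high
  power of an element of absolute value below 1 moves a bounded sequence into it, and dividing the
  limit by that power undoes the scaling.\<close>

lemma bounded_seq_nonarch:
  assumes "ultrametric v" and bd: "\<And>n. v (x n) \<le> C"
  obtains l s where "strict_mono (s::nat \<Rightarrow> nat)" "(\<lambda>n. v (x (s n) - l)) \<longlonglongrightarrow> 0"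
proof -
  have na: "nonarch_local_field v" using assms(1) nonarch_iff by auto
  then obtain t where t: "t \<noteq> 0" "v t \<noteq> 1" unfolding nonarch_local_field_def by auto
  obtain p where p: "p \<noteq> 0" "v p < 1"
  proof (cases "v t < 1")
    case False
    then have "v (inverse t) < 1" using t by (simp add: v_inverse inverse_less_1_iff)
    then show ?thesis using that[of "inverse t"] t by auto
  qed (use that t in auto)
  have "locally_compact_space v_metric.mtopology"
    using na unfolding nonarch_local_field_def field_topology_def by auto
  then obtain U K where UK: "openin v_metric.mtopology U" "compactin v_metric.mtopology K" "0 \<in> U" "U \<subseteq> K"
    unfolding locally_compact_space_def by force
  then obtain r where r: "r > 0" "v_metric.mball 0 r \<subseteq> K"
    unfolding v_metric.openin_mtopology by blast
  obtain n where n: "v p ^ n < r / (\<bar>C\<bar> + 1)"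
    using real_arch_pow_inv[of "r / (\<bar>C\<bar> + 1)" "v p"] r p by auto
  have "v (p ^ n * x m) < r" for m
  proof -
    have "v (p ^ n * x m) \<le> v p ^ n * (\<bar>C\<bar> + 1)"
      using bd[of m] by (auto simp: v_mult v_power intro!: mult_left_mono)
    also have "\<dots> < r" using n by (simp add: pos_less_divide_eq add_pos_nonneg)
    finally show ?thesis .
  qed
  then have "p ^ n * x m \<in> K" for m using r(2) by (auto simp: v_metric.in_mball subset_iff)
  then have "range (\<lambda>m. p ^ n * x m) \<subseteq> K" by auto
  then obtain l s where s: "strict_mono (s :: nat \<Rightarrow> nat)"
    "limitin v_metric.mtopology ((\<lambda>m. p ^ n * x m) \<circ> s) l sequentially"
    using UK(2) unfolding v_metric.compactin_sequentially by meson
  have "(\<lambda>m. v (p ^ n * x (s m) - l)) \<longlonglongrightarrow> 0"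
    using s(2) unfolding v_metric.limitin_metric by (auto intro!: tendstoI)
  then have "(\<lambda>m. v (p ^ n * x (s m) - l) / v (p ^ n)) \<longlonglongrightarrow> 0"
    by (auto intro!: tendsto_eq_intros simp: p)
  moreover have "v (p ^ n * x (s m) - l) / v (p ^ n) = v (x (s m) - l / p ^ n)" for m
    unfolding v_divide[symmetric] using p by (simp add: field_simps)
  ultimately show ?thesis using that s by simp
qed

lemma bounded_seq_arch:
  assumes "\<not> ultrametric v" and bd: "\<And>n. v (x n) \<le> C"
  obtains l s where "strict_mono (s::nat \<Rightarrow> nat)" "(\<lambda>n. v (x (s n) - l)) \<longlonglongrightarrow> 0"
proof -
  obtain \<phi> :: "'k \<Rightarrow> complex" where \<phi>: "field_hom \<phi>" "inj \<phi>" "\<And>x. v x = cmod (\<phi> x)"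
    "range \<phi> = UNIV \<or> range \<phi> = \<real>" using arch_embedding[unfolded nonarch_iff, OF assms(1)] by metis
  interpret field_hom \<phi> by fact
  have "closed (range \<phi>)" 
  proof -
    have "closed {z::complex. Im z = 0}" by (intro closed_Collect_eq continuous_intros)
    moreover have "{z::complex. Im z = 0} = \<real>" by (auto simp: complex_is_Real_iff)
    ultimately show ?thesis using \<phi>(4) by auto
  qed
  then have "compact (range \<phi> \<inter> cball 0 C)" by (simp add: closed_Int_compact)
  moreover have "\<forall>n. \<phi> (x n) \<in> range \<phi> \<inter> cball 0 C" using bd \<phi>(3) by auto
  ultimately obtain y s where y: "y \<in> range \<phi> \<inter> cball 0 C" "strict_mono (s::nat\<Rightarrow>nat)"
    "((\<lambda>n. \<phi> (x n)) \<circ> s) \<longlonglongrightarrow> y" unfolding compact_def by (metis (no_types))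
  then obtain l where l: "y = \<phi> l" by auto
  have "(\<lambda>n. cmod (\<phi> (x (s n)) - y)) \<longlonglongrightarrow> 0"
    using y(3) by (simp add: LIM_zero_iff tendsto_norm_zero_iff comp_def)
  then have "(\<lambda>n. v (x (s n) - l)) \<longlonglongrightarrow> 0" unfolding l \<phi>(3) by (simp add: hom_distribs)
  then show ?thesis using that y(2) by auto
qed

text \<open>The index set is arbitrary so that the same extraction serves vectors (coordinates) and
  matrices (pairs of indices).\<close>

lemma bounded_family_convergent_subseq:
  fixes x :: "nat \<Rightarrow> 'i \<Rightarrow> 'k"
  assumes "finite I" and "\<And>n i. i \<in> I \<Longrightarrow> v (x n i) \<le> C"
  shows "\<exists>l s. strict_mono (s::nat \<Rightarrow> nat) \<and> (\<forall>i\<in>I. (\<lambda>n. v (x (s n) i - l i)) \<longlonglongrightarrow> 0)"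
  using assms
proof (induction I)
  case empty
  then show ?case using strict_mono_id by auto
next
  case (insert j I)
  then obtain l s where s: "strict_mono (s::nat \<Rightarrow> nat)" "\<forall>i\<in>I. (\<lambda>n. v (x (s n) i - l i)) \<longlonglongrightarrow> 0"
    by auto
  have "v (x (s n) j) \<le> C" for n using insert by auto
  then obtain l' s' where s': "strict_mono (s'::nat \<Rightarrow> nat)" "(\<lambda>n. v (x (s (s' n)) j - l')) \<longlonglongrightarrow> 0"
    using bounded_seq_nonarch[of "\<lambda>n. x (s n) j" C] bounded_seq_arch[of "\<lambda>n. x (s n) j" C] by metis
  have "\<forall>i\<in>insert j I. (\<lambda>n. v (x ((s \<circ> s') n) i - (l(j := l')) i)) \<longlonglongrightarrow> 0"
    using s(2) s' insert.hyps(2) LIMSEQ_subseq_LIMSEQ[OF _ s'(1)] by (fastforce simp: comp_def)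
  moreover have "strict_mono (s \<circ> s')" using s s' strict_mono_o by auto
  ultimately show ?case by blast
qed

section \<open>The good norm\<close>

abbreviation "N \<equiv> good_norm v"

lemma N_arch: "\<not> ultrametric v \<Longrightarrow> w \<in> carrier_vec d \<Longrightarrow> N w = L2_set (\<lambda>i. v (w $ i)) {..<d}"
  by (auto simp: good_norm_def L2_set_def)

text \<open>The maximum over an empty set of coordinates is unspecified; this is the origin of the
  assumption \<open>0 < d\<close> in the norm lemmas.\<close>

lemma N_nonarch_le_iff:
  assumes "ultrametric v" "w \<in> carrier_vec d" "0 < d"
  shows "N w \<le> C \<longleftrightarrow> (\<forall>i<d. v (w $ i) \<le> C)"
proof -
  have "N w = Max ((\<lambda>i. v (w $ i)) ` {..<d})" using assms by (auto simp: good_norm_def)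
  moreover have "{..<d} \<noteq> {}" using assms by auto
  ultimately show ?thesis using Max_le_iff[of "(\<lambda>i. v (w $ i)) ` {..<d}" C] by auto
qed

lemma N_nonarch_in:
  assumes "ultrametric v" "w \<in> carrier_vec d" "0 < d"
  obtains i where "i < d" "N w = v (w $ i)"
proof -
  have "N w \<in> (\<lambda>i. v (w $ i)) ` {..<d}"
  proof -
    have "N w = Max ((\<lambda>i. v (w $ i)) ` {..<d})" using assms by (auto simp: good_norm_def)
    moreover have "{..<d} \<noteq> {}" using assms by auto
    ultimately show ?thesis using Max_in[of "(\<lambda>i. v (w $ i)) ` {..<d}"] by auto
  qed
  then show ?thesis using that by auto
qed

lemma N_coord_le: "w \<in> carrier_vec d \<Longrightarrow> i < d \<Longrightarrow> v (w $ i) \<le> N w"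
  by (cases "ultrametric v")
     (use N_nonarch_le_iff[of w d "N w"] member_le_L2_set[of "{..<d}" i "\<lambda>i. v (w $ i)"] in \<open>auto simp: N_arch\<close>)

lemma N_nonneg: "w \<in> carrier_vec d \<Longrightarrow> 0 < d \<Longrightarrow> 0 \<le> N w"
  using N_coord_le[of w d 0] v_nonneg order_trans by blast

lemma N_le_sum: "w \<in> carrier_vec d \<Longrightarrow> 0 < d \<Longrightarrow> N w \<le> (\<Sum>i<d. v (w $ i))"
  by (cases "ultrametric v")
     (auto simp: N_arch L2_set_le_sum N_nonarch_le_iff intro!: member_le_sum)

lemma N_mono:
  assumes "x \<in> carrier_vec d" "y \<in> carrier_vec d" "0 < d" "\<And>i. i < d \<Longrightarrow> v (x $ i) \<le> v (y $ i)"
  shows "N x \<le> N y"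
proof (cases "ultrametric v")
  case True
  then show ?thesis using assms N_coord_le[OF assms(2)]
    by (auto simp: N_nonarch_le_iff intro: order_trans)
qed (use assms in \<open>auto simp: N_arch intro!: L2_set_mono\<close>)

lemma N_triangle:
  assumes "x \<in> carrier_vec d" "y \<in> carrier_vec d" "0 < d"
  shows "N (x + y) \<le> N x + N y"
proof (cases "ultrametric v")
  case True
  have "v (x $ i + y $ i) \<le> N x + N y" if "i < d" for i
    using that v_triangle[of "x$i" "y$i"] N_coord_le[OF assms(1) that] N_coord_le[OF assms(2) that] by linarith
  then show ?thesis using assms True by (auto simp: N_nonarch_le_iff[of _ d])
next
  case False
  have "L2_set (\<lambda>i. v ((x+y) $ i)) {..<d} \<le> L2_set (\<lambda>i. v (x $ i) + v (y $ i)) {..<d}"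
    by (rule L2_set_mono) (use assms v_triangle in auto)
  also have "\<dots> \<le> L2_set (\<lambda>i. v (x $ i)) {..<d} + L2_set (\<lambda>i. v (y $ i)) {..<d}"
    by (rule L2_set_triangle_ineq)
  finally show ?thesis using False assms by (simp add: N_arch[of _ d])
qed

lemma N_smult:
  assumes "x \<in> carrier_vec d" "0 < d"
  shows "N (c \<cdot>\<^sub>v x) = v c * N x"
proof (cases "ultrametric v")
  case True
  obtain i where i: "i < d" "N x = v (x $ i)" using N_nonarch_in[OF True assms] .
  have "N (c \<cdot>\<^sub>v x) \<le> v c * N x"
    using assms True N_coord_le[OF assms(1)] by (auto simp: N_nonarch_le_iff[of _ d] v_mult mult_left_mono)
  moreover have "v c * N x \<le> N (c \<cdot>\<^sub>v x)"
    using N_coord_le[of "c \<cdot>\<^sub>v x" d i] i assms by (auto simp: v_mult)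
  ultimately show ?thesis by simp
next
  case False
  then show ?thesis using assms
    by (auto simp: N_arch[of _ d] v_mult L2_set_right_distrib intro!: L2_set_cong)
qed

lemma N_zero [simp]: "0 < d \<Longrightarrow> N (0\<^sub>v d) = 0"
proof -
  assume "0 < d"
  moreover have "(0::'k) \<cdot>\<^sub>v 0\<^sub>v d = 0\<^sub>v d" by (intro eq_vecI) auto
  ultimately show ?thesis using N_smult[of "0\<^sub>v d" d 0] by simp
qed

lemma N_eq_0: "x \<in> carrier_vec d \<Longrightarrow> 0 < d \<Longrightarrow> N x = 0 \<longleftrightarrow> x = 0\<^sub>v d"
proof
  assume x: "x \<in> carrier_vec d" "0 < d" "N x = 0"
  have "v (x $ i) = 0" if "i < d" for i
    using N_coord_le[OF x(1) that] x(3) v_nonneg[of "x $ i"] by linarith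
  then show "x = 0\<^sub>v d" using x by (intro eq_vecI) auto
qed auto

lemma N_pos: "x \<in> carrier_vec d \<Longrightarrow> 0 < d \<Longrightarrow> x \<noteq> 0\<^sub>v d \<Longrightarrow> 0 < N x"
  using N_eq_0 N_nonneg by (metis less_eq_real_def)

lemma N_minus: "x \<in> carrier_vec d \<Longrightarrow> 0 < d \<Longrightarrow> N (- x) = N x"
proof -
  assume x: "x \<in> carrier_vec d" "0 < d"
  have "- x = (-1) \<cdot>\<^sub>v x" by (intro eq_vecI) auto
  then show "N (- x) = N x" using N_smult[OF x, of "-1"] by simp
qed

lemma N_diff_commute:
  assumes "x \<in> carrier_vec d" "y \<in> carrier_vec d" "0 < d"
  shows "N (x - y) = N (y - x)"
proof -
  have "y - x = - (x - y)" using assms by (intro eq_vecI) auto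
  then show ?thesis using N_minus[of "x - y" d] assms by simp
qed

lemma N_diff_triangle:
  assumes "x \<in> carrier_vec d" "y \<in> carrier_vec d" "z \<in> carrier_vec d" "0 < d"
  shows "N (x - z) \<le> N (x - y) + N (y - z)"
proof -
  have "x - z = (x - y) + (y - z)" using assms by (intro eq_vecI) auto
  then show ?thesis using N_triangle[of "x - y" d "y - z"] assms by simp
qed

lemma N_diff_le:
  assumes "x \<in> carrier_vec d" "y \<in> carrier_vec d" "0 < d"
  shows "N x \<le> N y + N (x - y)"
  using N_diff_triangle[of x d y "0\<^sub>v d"] assms by auto

text \<open>Norms are absolute values of scalars: the maximum is attained at a coordinate in the
  ultrametric case, and otherwise the field contains the reals. Hence nonzero vectors can be scaled
  to norm exactly 1.\<close>

lemma N_value: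
  assumes "x \<in> carrier_vec d" "0 < d"
  obtains c where "N x = v c"
proof (cases "ultrametric v")
  case True
  then show ?thesis using N_nonarch_in assms that by metis
next
  case False
  obtain \<phi> :: "'k \<Rightarrow> complex" where \<phi>: "\<And>x. v x = cmod (\<phi> x)"
    "range \<phi> = UNIV \<or> range \<phi> = \<real>" using arch_embedding[unfolded nonarch_iff, OF False] by metis
  have "complex_of_real (N x) \<in> range \<phi>" using \<phi>(2) by auto
  then obtain c where "complex_of_real (N x) = \<phi> c" by auto
  then have "N x = v c" using \<phi>(1) N_nonneg[OF assms] by (metis norm_of_real abs_of_nonneg)
  then show ?thesis by (rule that)
qed

lemma N_normalize:
  assumes "x \<in> carrier_vec d" "0 < d" "x \<noteq> 0\<^sub>v d"
  obtains c y where "c \<noteq> 0" "y \<in> carrier_vec d" "N y = 1" "x = c \<cdot>\<^sub>v y" "N x = v c"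
proof -
  obtain c where c: "N x = v c" using N_value assms by metis
  then have "c \<noteq> 0" using N_eq_0 assms by force
  then show ?thesis
    using that[of c "inverse c \<cdot>\<^sub>v x"] assms c
    by (simp add: N_smult[of _ d] v_inverse smult_smult_assoc)
qed

lemma N_unit_vec: "i < d \<Longrightarrow> N (unit_vec d i) = 1"
proof (cases "ultrametric v")
  case True
  assume i: "i < d"
  then have "N (unit_vec d i) \<le> 1" using True by (auto simp: N_nonarch_le_iff[of _ d] unit_vec_def)
  moreover have "1 \<le> N (unit_vec d i)" using N_coord_le[of "unit_vec d i" d i] i by auto
  ultimately show ?thesis by simp
next
  case False
  assume i: "i < d"
  have "(\<Sum>j<d. (v (unit_vec d i $ j))\<^sup>2) = (\<Sum>j<d. if j = i then 1 else 0)"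
    by (rule sum.cong) (auto simp: unit_vec_def)
  then show ?thesis using i False by (simp add: N_arch[of _ d] L2_set_def)
qed

end

section \<open>Linear isometries\<close>

lemma carrier_GL [simp]: "A \<in> carrier (GL d) \<longleftrightarrow> A \<in> carrier_mat d d \<and> invertible_mat A"
  by (auto simp: GL_def)

lemma GL_inverse:
  assumes "A \<in> carrier (GL d)"
  obtains B where "B \<in> carrier (GL d)" "A * B = 1\<^sub>m d" "B * A = 1\<^sub>m d"
proof -
  have A: "A \<in> carrier_mat d d" using assms by simp
  obtain B where B: "A * B = 1\<^sub>m (dim_row A)" "B * A = 1\<^sub>m (dim_row B)"
    using assms unfolding carrier_GL invertible_mat_def inverts_mat_def by blast
  have "dim_col B = d" using arg_cong[OF B(1), of dim_col] A by auto
  moreover have "dim_row B = d" using arg_cong[OF B(2), of dim_col] A by auto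
  ultimately have "B \<in> carrier_mat d d" by auto
  then show ?thesis using that[of B] A B by (auto simp: invertible_mat_def inverts_mat_def)
qed

lemma GL_I:
  assumes "A \<in> carrier_mat d d" "B \<in> carrier_mat d d" "A * B = 1\<^sub>m d" "B * A = 1\<^sub>m d"
  shows "A \<in> carrier (GL d)"
  using assms by (auto simp: invertible_mat_def inverts_mat_def)

lemma GL_mult:
  assumes "A \<in> carrier (GL d)" "B \<in> carrier (GL d)"
  shows "A * B \<in> carrier (GL d)"
proof -
  obtain A' B' where *: "A' \<in> carrier (GL d)" "A * A' = 1\<^sub>m d" "A' * A = 1\<^sub>m d"
    "B' \<in> carrier (GL d)" "B * B' = 1\<^sub>m d" "B' * B = 1\<^sub>m d"
    using GL_inverse assms by metis
  have c: "A \<in> carrier_mat d d" "A' \<in> carrier_mat d d" "B \<in> carrier_mat d d" "B' \<in> carrier_mat d d"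
    using * assms by auto
  have "A * B * (B' * A') = A * (B * B') * A'" using c by (simp add: assoc_mult_mat[of _ d d _ d _ d])
  moreover have "B' * A' * (A * B) = B' * (A' * A) * B" using c by (simp add: assoc_mult_mat[of _ d d _ d _ d])
  ultimately show ?thesis using * c by (intro GL_I[of _ _ "B' * A'"]) auto
qed

lemma inverse_mult_vec:
  assumes "A * B = 1\<^sub>m d" "(A :: 'k::comm_ring_1 mat) \<in> carrier_mat d d" "B \<in> carrier_mat d d" "x \<in> carrier_vec d"
  shows "A *\<^sub>v (B *\<^sub>v x) = x"
  using assms assoc_mult_mat_vec[of A d d B d x] one_mult_mat_vec[of x d] by metis

lemma inj_imp_GL:
  assumes A: "(A :: 'k::field mat) \<in> carrier_mat d d"
    and "\<And>x. x \<in> carrier_vec d \<Longrightarrow> A *\<^sub>v x = 0\<^sub>v d \<Longrightarrow> x = 0\<^sub>v d"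
  shows "A \<in> carrier (GL d)"
proof -
  have "det A \<noteq> 0" using assms det_0_iff_vec_prod_zero_field[OF A] by auto
  from det_non_zero_imp_unit[OF A this, of "()"]
  obtain B where "B \<in> carrier_mat d d" "B * A = 1\<^sub>m d" "A * B = 1\<^sub>m d"
    unfolding Units_def by (auto simp: ring_mat_def)
  then show ?thesis using A GL_I by blast
qed

lemma GL_inj:
  assumes "A \<in> carrier (GL d)" "x \<in> carrier_vec d" "A *\<^sub>v x = 0\<^sub>v d"
  shows "x = 0\<^sub>v d"
proof -
  obtain B where B: "B \<in> carrier (GL d)" "A * B = 1\<^sub>m d" "B * A = 1\<^sub>m d" using GL_inverse assms by metis
  have "B *\<^sub>v 0\<^sub>v d = 0\<^sub>v d" using B by auto
  then show ?thesis using inverse_mult_vec[of B A d x] B assms by auto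
qed

lemma one_GL: "1\<^sub>m d \<in> carrier (GL d)"
  by (rule GL_I[of _ _ "1\<^sub>m d"]) auto

context local_field_abs begin

abbreviation "isoms \<equiv> norm_stabilizer v"

lemma isom_norm: "k \<in> isoms d \<Longrightarrow> w \<in> carrier_vec d \<Longrightarrow> N (k *\<^sub>v w) = N w"
  by (auto simp: norm_stabilizer_def)

lemma isom_GL: "k \<in> isoms d \<Longrightarrow> k \<in> carrier (GL d)"
  by (auto simp: norm_stabilizer_def)

lemma isom_carrier: "k \<in> isoms d \<Longrightarrow> k \<in> carrier_mat d d"
  by (auto simp: norm_stabilizer_def)

text \<open>A norm-preserving square matrix has trivial kernel, so membership in \<open>GL d\<close>
  comes for free.\<close>

lemma isom_I:
  assumes "0 < d" "k \<in> carrier_mat d d" "\<And>w. w \<in> carrier_vec d \<Longrightarrow> N (k *\<^sub>v w) = N w"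
  shows "k \<in> isoms d"
proof -
  have "k \<in> carrier (GL d)"
    by (rule inj_imp_GL[OF assms(2)]) (use assms N_eq_0 in \<open>metis N_zero\<close>)
  then show ?thesis using assms by (auto simp: norm_stabilizer_def)
qed

lemma one_isom: "1\<^sub>m d \<in> isoms d"
  using one_GL[of d] by (auto simp: norm_stabilizer_def)

lemma isom_mult: "k \<in> isoms d \<Longrightarrow> l \<in> isoms d \<Longrightarrow> k * l \<in> isoms d"
  using GL_mult[of k d l] by (auto simp: norm_stabilizer_def assoc_mult_mat_vec[of _ d d _ d])

lemma isom_inverse:
  assumes "k \<in> isoms d"
  obtains k' where "k' \<in> isoms d" "k * k' = 1\<^sub>m d" "k' * k = 1\<^sub>m d"
proof -
  obtain B where B: "B \<in> carrier (GL d)" "k * B = 1\<^sub>m d" "B * k = 1\<^sub>m d"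
    using GL_inverse isom_GL assms by metis
  have "N (B *\<^sub>v w) = N w" if "w \<in> carrier_vec d" for w
    using isom_norm[OF assms, of "B *\<^sub>v w"] inverse_mult_vec[OF B(2) isom_carrier[OF assms], of w] B(1) that
    by auto
  then have "B \<in> isoms d" using B by (auto simp: norm_stabilizer_def)
  then show ?thesis using B that by auto
qed

section \<open>The entrywise norm and compactness of the isometry group\<close>

definition mnorm :: "nat \<Rightarrow> nat \<Rightarrow> 'k mat \<Rightarrow> real" where
  "mnorm n m A = (\<Sum>i<n. \<Sum>j<m. v (A $$ (i,j)))"

lemma mnorm_nonneg: "0 \<le> mnorm n m A"
  by (auto simp: mnorm_def intro!: sum_nonneg)

text \<open>The entry sum is the distance to 0 in the metric of \<open>mat_topology\<close>. Since
  \<open>N\<close> lies between each coordinate and the sum of all coordinates, it also bounds the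
  operator norm, so topology and estimates share one quantity.\<close>

lemma N_mult_le:
  assumes "A \<in> carrier_mat n m" "x \<in> carrier_vec m" "0 < n" "0 < m"
  shows "N (A *\<^sub>v x) \<le> mnorm n m A * N x"
proof -
  have "N (A *\<^sub>v x) \<le> (\<Sum>i<n. v ((A *\<^sub>v x) $ i))" using assms by (intro N_le_sum) auto
  also have "\<dots> \<le> (\<Sum>i<n. \<Sum>j<m. v (A $$ (i,j)) * N x)"
  proof (rule sum_mono)
    fix i assume "i \<in> {..<n}"
    then have "(A *\<^sub>v x) $ i = (\<Sum>j<m. A $$ (i,j) * x $ j)"
      using assms by (auto simp: scalar_prod_def atLeast0LessThan intro!: sum.cong)
    also have "v \<dots> \<le> (\<Sum>j<m. v (A $$ (i,j) * x $ j))" by (rule v_sum)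
    also have "\<dots> \<le> (\<Sum>j<m. v (A $$ (i,j)) * N x)"
      using N_coord_le[OF assms(2)] by (auto simp: v_mult intro!: sum_mono mult_left_mono)
    finally show "v ((A *\<^sub>v x) $ i) \<le> (\<Sum>j<m. v (A $$ (i,j)) * N x)" .
  qed
  finally show ?thesis by (simp add: mnorm_def sum_distrib_right)
qed

lemma op_bound:
  assumes "A \<in> carrier_mat d d" "0 < d"
  obtains C where "C > 0" "\<And>x. x \<in> carrier_vec d \<Longrightarrow> N (A *\<^sub>v x) \<le> C * N x"
proof (rule that[of "mnorm d d A + 1"])
  show "0 < mnorm d d A + 1" using mnorm_nonneg[of d d A] by linarith
  show "N (A *\<^sub>v x) \<le> (mnorm d d A + 1) * N x" if "x \<in> carrier_vec d" for x
    using N_mult_le[OF assms(1) that assms(2,2)] N_nonneg[OF that assms(2)] by (simp add: algebra_simps)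
qed

lemma mnorm_tendsto_0I:
  assumes "\<And>i j. i < n \<Longrightarrow> j < m \<Longrightarrow> (\<lambda>t. v (A t $$ (i,j))) \<longlonglongrightarrow> 0"
  shows "(\<lambda>t. mnorm n m (A t)) \<longlonglongrightarrow> 0"
  unfolding mnorm_def by (rule tendsto_null_sum)+ (use assms in auto)

lemma N_tendsto_0I:
  assumes "\<And>t. x t \<in> carrier_vec d" "0 < d" "\<And>i. i < d \<Longrightarrow> (\<lambda>t. v (x t $ i)) \<longlonglongrightarrow> 0"
  shows "(\<lambda>t. N (x t)) \<longlonglongrightarrow> 0"
proof (rule tendsto_sandwich[of "\<lambda>_. 0" _ _ "\<lambda>t. \<Sum>i<d. v (x t $ i)"])
  show "(\<lambda>t. \<Sum>i<d. v (x t $ i)) \<longlonglongrightarrow> 0" by (rule tendsto_null_sum) (use assms in auto)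
qed (use N_nonneg[OF assms(1,2)] N_le_sum[OF assms(1,2)] in auto)

lemma bounded_vec_convergent_subseq:
  assumes "\<And>t. x t \<in> carrier_vec d" "0 < d" "\<And>t. N (x t) \<le> C"
  obtains l s where "l \<in> carrier_vec d" "strict_mono (s :: nat \<Rightarrow> nat)" "(\<lambda>t. N (x (s t) - l)) \<longlonglongrightarrow> 0"
proof -
  have "v (x t $ i) \<le> C" if "i \<in> {..<d}" for i t
    using N_coord_le[OF assms(1), of i t] assms(3)[of t] that by auto
  then obtain l s where s: "strict_mono (s::nat\<Rightarrow>nat)" "\<forall>i\<in>{..<d}. (\<lambda>t. v (x (s t) $ i - l i)) \<longlonglongrightarrow> 0"
    using bounded_family_convergent_subseq[of "{..<d}" "\<lambda>t i. x t $ i" C] by blast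
  have "(\<lambda>t. N (x (s t) - vec d l)) \<longlonglongrightarrow> 0"
    by (rule N_tendsto_0I[of _ d]) (use assms s carrier_vecD[OF assms(1)] in auto)
  then show ?thesis using that[of "vec d l" s] s by auto
qed

lemma N_limit_unique:
  assumes "x \<in> carrier_vec d" "0 < d" "\<And>t. y t \<in> carrier_vec d"
    and "(\<lambda>t. N (y t - x)) \<longlonglongrightarrow> 0"
  shows "(\<lambda>t. N (y t)) \<longlonglongrightarrow> N x"
proof -
  have "\<bar>N (y t) - N x\<bar> \<le> N (y t - x)" for t
    using N_diff_le[of "y t" d x] N_diff_le[of x d "y t"] N_diff_commute[of "y t" d x] assms by auto
  then have "(\<lambda>t. N (y t) - N x) \<longlonglongrightarrow> 0"
    by (intro tendsto_0_le[OF assms(4), of _ 1]) (auto intro!: always_eventually intro: order_trans[OF _ abs_ge_self])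
  then show ?thesis by (simp add: LIM_zero_iff)
qed

lemma isom_entry_le: 
  assumes "k \<in> isoms d" "i < d" "j < d"
  shows "v (k $$ (i,j)) \<le> 1"
proof -
  have "(k *\<^sub>v unit_vec d j) $ i = k $$ (i,j)" using assms isom_carrier[OF assms(1)] by auto
  then have "v (k $$ (i,j)) \<le> N (k *\<^sub>v unit_vec d j)"
    using N_coord_le[of "k *\<^sub>v unit_vec d j" d i] assms isom_carrier[OF assms(1)] by auto
  then show ?thesis using isom_norm[OF assms(1), of "unit_vec d j"] N_unit_vec[OF assms(3)] by auto
qed

lemma mult_vec_diff:
  assumes "A \<in> carrier_mat n m" "B \<in> carrier_mat n m" "x \<in> carrier_vec m" "0 < n" "0 < m"
  shows "N (A *\<^sub>v x - B *\<^sub>v x) \<le> mnorm n m (A - B) * N x"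
proof -
  have "(A - B) *\<^sub>v x = A *\<^sub>v x - B *\<^sub>v x" using assms minus_mult_distrib_mat_vec[of A n m B x] by auto
  then show ?thesis using N_mult_le[of "A - B" n m x] minus_carrier_mat[OF assms(2), of A] assms by metis
qed

lemma isom_limit:
  assumes "\<And>t. k t \<in> isoms d" "l \<in> carrier_mat d d" "0 < d" "(\<lambda>t. mnorm d d (k t - l)) \<longlonglongrightarrow> 0"
  shows "l \<in> isoms d"
proof (rule isom_I)
  fix w :: "'k vec" assume w: "w \<in> carrier_vec d"
  have "(\<lambda>t. N (k t *\<^sub>v w - l *\<^sub>v w)) \<longlonglongrightarrow> 0"
  proof (rule tendsto_sandwich[of "\<lambda>_. 0" _ _ "\<lambda>t. mnorm d d (k t - l) * N w"])
    show "(\<lambda>t. mnorm d d (k t - l) * N w) \<longlonglongrightarrow> 0"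
      using tendsto_mult_right[OF assms(4), of "N w"] by simp
    have "k t *\<^sub>v w - l *\<^sub>v w \<in> carrier_vec d" for t
      using mult_mat_vec_carrier[OF isom_carrier[OF assms(1)] w] mult_mat_vec_carrier[OF assms(2) w] by auto
    then show "\<forall>\<^sub>F t in sequentially. 0 \<le> N (k t *\<^sub>v w - l *\<^sub>v w)"
      using N_nonneg[OF _ assms(3)] by (intro always_eventually) blast
  qed (use mult_vec_diff[OF isom_carrier[OF assms(1)] assms(2) w] assms(3) in auto)
  then have "(\<lambda>t. N (k t *\<^sub>v w)) \<longlonglongrightarrow> N (l *\<^sub>v w)"
    using N_limit_unique[of "l *\<^sub>v w" d "\<lambda>t. k t *\<^sub>v w"] assms(3)
      mult_mat_vec_carrier[OF isom_carrier[OF assms(1)] w] mult_mat_vec_carrier[OF assms(2) w] by blast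
  moreover have "(\<lambda>t. N (k t *\<^sub>v w)) = (\<lambda>t. N w)" using isom_norm[OF assms(1) w] by auto
  ultimately show "N (l *\<^sub>v w) = N w" by (simp add: LIMSEQ_const_iff)
qed (use assms in auto)

text \<open>Entries of isometries are bounded by 1, because columns are images of unit vectors, and
  isometries form a closed set. This sequential compactness is used in place of compactness of the
  Grassmannian.\<close>

lemma isom_compact:
  assumes "\<And>t. k t \<in> isoms d" "0 < d"
  obtains l s where "l \<in> isoms d" "strict_mono (s :: nat \<Rightarrow> nat)" "(\<lambda>t. mnorm d d (k (s t) - l)) \<longlonglongrightarrow> 0"
proof -
  obtain l s where s: "strict_mono (s::nat\<Rightarrow>nat)"
    "\<forall>i\<in>{..<d}\<times>{..<d}. (\<lambda>t. v (k (s t) $$ i - l i)) \<longlonglongrightarrow> 0"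
    using bounded_family_convergent_subseq[of "{..<d}\<times>{..<d}" "\<lambda>t i. k t $$ i" 1] isom_entry_le[OF assms(1)] by auto
  have *: "(\<lambda>t. mnorm d d (k (s t) - mat d d l)) \<longlonglongrightarrow> 0"
    by (rule mnorm_tendsto_0I) (use assms s isom_carrier[OF assms(1)] in auto)
  moreover have "mat d d l \<in> isoms d"
    by (rule isom_limit[of "\<lambda>t. k (s t)"]) (use * assms in auto)
  ultimately show ?thesis using that s by auto
qed

end

section \<open>Cartan decompositions\<close>

text \<open>Reflection of \<open>Y\<close> along \<open>W\<close>: here \<open>S\<close> is the
  Hermitian square of \<open>W\<close> and \<open>P\<close> the product of \<open>Y\<close> with
  \<open>W\<close>. It is stated for complex families so that it applies after embedding the
  field.\<close>

lemma householder_norm: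
  fixes W Y :: "'i \<Rightarrow> complex"
  assumes S: "S = (\<Sum>i\<in>I. W i * cnj (W i))" "S \<noteq> 0" 
    and P: "P = (\<Sum>i\<in>I. cnj (W i) * Y i)" and C: "C = 2 * P / S"
  shows "(\<Sum>i\<in>I. (cmod (Y i - C * W i))\<^sup>2) = (\<Sum>i\<in>I. (cmod (Y i))\<^sup>2)"
proof -
  have cP: "cnj P = (\<Sum>i\<in>I. W i * cnj (Y i))" unfolding P by simp
  have cS: "cnj S = S" unfolding S by (simp add: mult.commute)
  have "complex_of_real (\<Sum>i\<in>I. (cmod (Y i - C * W i))\<^sup>2) =
      (\<Sum>i\<in>I. (Y i - C * W i) * cnj (Y i - C * W i))"
    by (simp only: of_real_sum complex_norm_square)
  also have "\<dots> = (\<Sum>i\<in>I. Y i * cnj (Y i) - C * (W i * cnj (Y i)) - cnj C * (cnj (W i) * Y i)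
      + C * cnj C * (W i * cnj (W i)))"
    by (rule sum.cong) (auto simp: algebra_simps)
  also have "\<dots> = (\<Sum>i\<in>I. Y i * cnj (Y i)) - C * cnj P - cnj C * P + C * cnj C * S"
    unfolding cP P S by (simp add: sum.distrib sum_subtractf sum_distrib_left)
  also have "\<dots> = (\<Sum>i\<in>I. Y i * cnj (Y i))"
  proof -
    have cC: "cnj C = 2 * cnj P / S" unfolding C by (simp add: cS)
    have "cnj C * S = 2 * cnj P" using S(2) by (simp add: cC)
    then have "C * cnj C * S = 2 * (C * cnj P)" by (simp add: mult.assoc)
    moreover have "cnj C * P = C * cnj P" by (simp add: C cC cS)
    ultimately show ?thesis by simp
  qed
  also have "\<dots> = complex_of_real (\<Sum>i\<in>I. (cmod (Y i))\<^sup>2)"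
    by (simp only: of_real_sum complex_norm_square)
  finally show ?thesis using of_real_eq_iff by blast
qed

context local_field_abs begin

lemma mult_vec_coord:
  assumes "A \<in> carrier_mat n m" "x \<in> carrier_vec m" "i < n"
  shows "(A *\<^sub>v x) $ i = (\<Sum>j<m. A $$ (i,j) * x $ j)"
  using assms by (auto simp: scalar_prod_def atLeast0LessThan intro!: sum.cong)

lemma arch_conj:
  assumes "\<not> ultrametric v"
  obtains \<phi> :: "'k \<Rightarrow> complex" and cj where "field_hom \<phi>" "inj \<phi>" "\<And>x. v x = cmod (\<phi> x)"
    "\<And>x. \<phi> (cj x) = cnj (\<phi> x)" "range \<phi> = UNIV \<or> range \<phi> = \<real>"
proof -
  obtain \<phi> :: "'k \<Rightarrow> complex" where \<phi>: "field_hom \<phi>" "inj \<phi>" "\<And>x. v x = cmod (\<phi> x)"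
    "range \<phi> = UNIV \<or> range \<phi> = \<real>" using arch_embedding[unfolded nonarch_iff, OF assms] by metis
  have "\<exists>y. \<phi> y = cnj (\<phi> x)" for x
  proof -
    have "cnj (\<phi> x) \<in> range \<phi>"
      using \<phi>(4) rangeI[of \<phi> x] by (metis Reals_cnj_iff UNIV_I)
    then show ?thesis by force
  qed
  then obtain cj where "\<And>x. \<phi> (cj x) = cnj (\<phi> x)" by metis
  then show ?thesis using that \<phi> by blast
qed

text \<open>Some coordinate \<open>x $ j\<close> has absolute value 1. Replacing the j-th standard
  basis vector by \<open>x\<close> gives an integral matrix with integral inverse; the columns are
  then permuted so that \<open>x\<close> comes first and the displaced vector of index 0 goes to
  position j. The map \<open>\<sigma>\<close> encodes this permutation.\<close>

lemma isom_first_col_nonarch: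
  assumes u: "ultrametric v" and x: "x \<in> carrier_vec d" "0 < d" "N x = 1"
  shows "\<exists>k\<in>isoms d. k *\<^sub>v unit_vec d 0 = x"
proof -
  obtain j where j: "j < d" "v (x $ j) = 1" using N_nonarch_in[OF u x(1,2)] x(3) by metis
  define \<sigma> where "\<sigma> i = (if i = 0 then j else i)" for i :: nat
  define k where "k = mat d d (\<lambda>(i,m). (if m = 0 then x $ i else 0) + (if i \<noteq> j \<and> m = \<sigma> i then 1 else 0))"
  have k: "k \<in> carrier_mat d d" by (simp add: k_def)
  have \<sigma>: "\<sigma> i < d" if "i < d" for i using that j by (auto simp: \<sigma>_def)
  have kw: "(k *\<^sub>v w) $ i = x $ i * w $ 0 + (if i \<noteq> j then w $ \<sigma> i else 0)"
    if "w \<in> carrier_vec d" "i < d" for w i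
  proof -
    have "(k *\<^sub>v w) $ i = (\<Sum>m<d. (if m = 0 then x $ i * w $ m else 0) + (if m = \<sigma> i then (if i \<noteq> j then w $ m else 0) else 0))"
      unfolding mult_vec_coord[OF k that] using that by (intro sum.cong) (auto simp: k_def distrib_right)
    also have "\<dots> = x $ i * w $ 0 + (if i \<noteq> j then w $ \<sigma> i else 0)"
      using x(2) \<sigma>[OF that(2)] by (simp add: sum.distrib)
    finally show ?thesis .
  qed
  have x1: "v (x $ i) \<le> 1" if "i < d" for i using N_coord_le[OF x(1) that] x(3) by simp
  have iso: "N (k *\<^sub>v w) = N w" if w: "w \<in> carrier_vec d" for w
  proof (rule antisym)
    have kwc: "k *\<^sub>v w \<in> carrier_vec d" using k w by auto
    have xw: "v (x $ i * w $ 0) \<le> v (w $ 0)" if "i < d" for i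
      using x1[OF that] by (auto simp: v_mult mult_left_le_one_le)
    show "N (k *\<^sub>v w) \<le> N w" unfolding N_nonarch_le_iff[OF u kwc x(2)]
    proof (intro allI impI)
      fix i assume i: "i < d"
      have "v (x $ i * w $ 0) \<le> N w" using xw[OF i] N_coord_le[OF w x(2)] by linarith
      moreover have "v (if i \<noteq> j then w $ \<sigma> i else 0) \<le> N w"
        using N_coord_le[OF w \<sigma>[OF i]] N_nonneg[OF w x(2)] by auto
      ultimately show "v ((k *\<^sub>v w) $ i) \<le> N w" unfolding kw[OF w i] using v_add_ultra[OF u] by (meson max.boundedI order_trans)
    qed
    \<comment> \<open>Row j of \<open>k\<close> reads off \<open>x $ j * w $ 0\<close>, and
      \<open>x $ j\<close> has absolute value 1. Each other coordinate of \<open>w\<close> then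
      follows by subtracting a multiple of \<open>w $ 0\<close> with coefficient of absolute value
      at most 1.\<close>
    have w0: "v (w $ 0) \<le> N (k *\<^sub>v w)"
      using N_coord_le[OF kwc j(1)] j(2) by (simp add: kw[OF w j(1)] v_mult)
    show "N w \<le> N (k *\<^sub>v w)" unfolding N_nonarch_le_iff[OF u w x(2)]
    proof (intro allI impI)
      fix m assume m: "m < d"
      show "v (w $ m) \<le> N (k *\<^sub>v w)"
      proof (cases "m = 0")
        case False
        define i where "i = (if m = j then 0 else m)"
        have i: "i < d" "i \<noteq> j" "\<sigma> i = m" using m False x(2) by (auto simp: i_def \<sigma>_def)
        have "w $ m = (k *\<^sub>v w) $ i + - (x $ i * w $ 0)" using kw[OF w i(1)] i by auto
        then have "v (w $ m) \<le> max (v ((k *\<^sub>v w) $ i)) (v (x $ i * w $ 0))"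
          using v_add_ultra[OF u, of "(k *\<^sub>v w) $ i" "- (x $ i * w $ 0)"] by simp
        then show ?thesis using N_coord_le[OF kwc i(1)] xw[OF i(1)] w0 by linarith
      qed (use w0 in auto)
    qed
  qed
  have "k \<in> isoms d" using isom_I[OF x(2) k iso] .
  moreover have "k *\<^sub>v unit_vec d 0 = x"
  proof (rule eq_vecI)
    fix i assume "i < dim_vec x"
    then have i: "i < d" using x by auto
    have "\<sigma> i \<noteq> 0" if "i \<noteq> j" using that by (auto simp: \<sigma>_def)
    then have "(if i \<noteq> j then unit_vec d 0 $ \<sigma> i else 0) = (0 :: 'k)" using \<sigma>[OF i] by (cases "i = j") auto
    then show "(k *\<^sub>v unit_vec d 0) $ i = x $ i" using kw[of "unit_vec d 0" i] i x(2) by (simp del: index_mult_mat_vec)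
  qed (use k x in auto)
  ultimately show ?thesis by auto
qed

lemma isom_first_col_arch_real:
  assumes a: "\<not> ultrametric v" and \<phi>: "field_hom \<phi>" "inj \<phi>" "\<And>x. v x = cmod (\<phi> x)"
    "\<And>x. \<phi> (cj x) = cnj (\<phi> x)"
    and x: "x \<in> carrier_vec d" "0 < d" "N x = 1" and re: "\<phi> (x $ 0) \<in> \<real>"
  shows "\<exists>k\<in>isoms d. k *\<^sub>v unit_vec d 0 = x"
proof (cases "x = unit_vec d 0")
  case True
  then have "1\<^sub>m d *\<^sub>v unit_vec d 0 = x" by simp
  then show ?thesis using one_isom[of d] by blast
next
  case False
  interpret field_hom \<phi> by fact
  \<comment> \<open>The reflection along \<open>e\<^sub>0 - x\<close> maps \<open>e\<^sub>0\<close> to \<open>x\<close>, since \<open>x $ 0\<close> is real.\<close>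
  define w where "w = unit_vec d 0 - x"
  have w: "w \<in> carrier_vec d" using x by (auto simp: w_def)
  define s where "s = (\<Sum>i<d. w $ i * cj (w $ i))"
  have N2: "complex_of_real ((N y)\<^sup>2) = (\<Sum>i<d. \<phi> (y $ i) * cnj (\<phi> (y $ i)))" if "y \<in> carrier_vec d" for y
  proof -
    have "(N y)\<^sup>2 = (\<Sum>i<d. (cmod (\<phi> (y $ i)))\<^sup>2)"
      using that a by (simp add: N_arch[of _ d] L2_set_def sum_nonneg \<phi>(3))
    then show ?thesis by (simp only: of_real_sum complex_norm_square)
  qed
  have \<phi>s: "\<phi> s = (\<Sum>i<d. \<phi> (w $ i) * cnj (\<phi> (w $ i)))" by (simp add: s_def hom_distribs \<phi>(4))
  have "w \<noteq> 0\<^sub>v d"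
  proof
    assume "w = 0\<^sub>v d"
    then have "unit_vec d 0 $ i - x $ i = 0" if "i < d" for i
    proof -
      have "(unit_vec d 0 - x) $ i = 0" using \<open>w = 0\<^sub>v d\<close> that by (simp flip: w_def)
      then show ?thesis using that x by simp
    qed
    then have "x = unit_vec d 0" using x by (intro eq_vecI) auto
    then show False using False by simp
  qed
  then have "\<phi> s \<noteq> 0" unfolding \<phi>s N2[OF w, symmetric] using N_eq_0[OF w x(2)] by simp
  then have s0: "s \<noteq> 0" by auto
  have two: "\<phi> 2 = 2" using hom_add[of 1 1] by (simp del: hom_add)
  define c where "c j = 2 / s * cj (w $ j)" for j
  define k where "k = mat d d (\<lambda>(i,j). (if j = i then 1 else 0) - c j * w $ i)"
  have k: "k \<in> carrier_mat d d" by (simp add: k_def)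
  have ky: "(k *\<^sub>v y) $ i = y $ i - (\<Sum>j<d. c j * y $ j) * w $ i" if "y \<in> carrier_vec d" "i < d" for y i
  proof -
    have "(k *\<^sub>v y) $ i = (\<Sum>j<d. (if j = i then y $ j else 0) - c j * y $ j * w $ i)"
      unfolding mult_vec_coord[OF k that] using that by (intro sum.cong) (auto simp: k_def algebra_simps)
    also have "\<dots> = y $ i - (\<Sum>j<d. c j * y $ j) * w $ i"
      using that by (simp add: sum_subtractf sum_distrib_right)
    finally show ?thesis .
  qed
  have "N (k *\<^sub>v y) = N y" if y: "y \<in> carrier_vec d" for y
  proof -
    define P where "P = (\<Sum>i<d. cnj (\<phi> (w $ i)) * \<phi> (y $ i))"
    have "\<phi> (\<Sum>j<d. c j * y $ j) = 2 * P / \<phi> s"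
      by (simp add: c_def divide_inverse hom_sum hom_mult hom_inverse two \<phi>(4) P_def sum_distrib_left
          sum_distrib_right mult_ac)
    then have e: "\<phi> ((k *\<^sub>v y) $ i) = \<phi> (y $ i) - (2 * P / \<phi> s) * \<phi> (w $ i)" if "i < d" for i
      by (simp add: ky[OF y that] hom_distribs)
    have "(\<Sum>i<d. (cmod (\<phi> ((k *\<^sub>v y) $ i)))\<^sup>2) = (\<Sum>i<d. (cmod (\<phi> (y $ i) - (2 * P / \<phi> s) * \<phi> (w $ i)))\<^sup>2)"
      using e by (intro sum.cong) auto
    also have "\<dots> = (\<Sum>i<d. (cmod (\<phi> (y $ i)))\<^sup>2)"
      using householder_norm[OF \<phi>s \<open>\<phi> s \<noteq> 0\<close> P_def refl] .
    finally show ?thesis using y k a mult_mat_vec_carrier[OF k y] by (simp add: N_arch[of _ d] L2_set_def \<phi>(3))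
  qed
  then have "k \<in> isoms d" using isom_I[OF x(2) k] by auto
  moreover have "k *\<^sub>v unit_vec d 0 = x"
  proof -
    obtain r where r: "\<phi> (x $ 0) = complex_of_real r" using re by (auto elim: Reals_cases)
    \<comment> \<open>As \<open>x\<close> has norm 1 and real first coordinate, the square of
      \<open>w\<close> is 2 - 2 x_0, twice the first coordinate of \<open>w\<close>. Hence the
      reflection subtracts exactly \<open>w\<close> from the first unit vector.\<close>
    have "\<phi> s = 2 * cnj (\<phi> (w $ 0))"
    proof -
      have "\<phi> s = (\<Sum>i<d. (if i = 0 then 1 - 2 * \<phi> (x $ 0) else 0) + \<phi> (x $ i) * cnj (\<phi> (x $ i)))"
        unfolding \<phi>s using x by (intro sum.cong) (auto simp: w_def hom_distribs r algebra_simps)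
      also have "\<dots> = 2 - 2 * \<phi> (x $ 0)" using N2[OF x(1)] x by (simp add: sum.distrib)
      also have "\<dots> = 2 * cnj (\<phi> (w $ 0))" using x by (simp add: w_def hom_distribs r)
      finally show ?thesis .
    qed
    moreover have "\<phi> (c 0) = 2 * cnj (\<phi> (w $ 0)) * inverse (\<phi> s)"
      by (simp add: c_def divide_inverse hom_mult hom_inverse \<phi>(4) two)
    ultimately have "\<phi> (c 0) = \<phi> 1" using right_inverse[OF \<open>\<phi> s \<noteq> 0\<close>] by simp
    then have c0: "c 0 = 1" using \<phi>(2) by (auto dest: injD)
    have "(\<Sum>j<d. c j * unit_vec d 0 $ j) = (\<Sum>j<d. if j = 0 then c j else 0)"
      by (rule sum.cong) auto
    then have "(\<Sum>j<d. c j * unit_vec d 0 $ j) = 1" using x(2) c0 by simp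
    then show ?thesis using k x by (intro eq_vecI) (auto simp del: index_mult_mat_vec simp: ky w_def)
  qed
  ultimately show ?thesis by auto
qed

lemma isom_smult:
  assumes "k \<in> isoms d" "0 < d" "v c = 1"
  shows "c \<cdot>\<^sub>m k \<in> isoms d"
proof (rule isom_I)
  fix w :: "'k vec" assume w: "w \<in> carrier_vec d"
  have "(c \<cdot>\<^sub>m k) *\<^sub>v w = c \<cdot>\<^sub>v (k *\<^sub>v w)"
    using isom_carrier[OF assms(1)] w by (intro eq_vecI) (auto simp: scalar_prod_def sum_distrib_left mult.assoc)
  then show "N ((c \<cdot>\<^sub>m k) *\<^sub>v w) = N w"
    using N_smult[of "k *\<^sub>v w" d c] isom_carrier[OF assms(1)] w assms isom_norm[OF assms(1) w] by auto
qed (use assms isom_carrier in auto)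

lemma smult_mat_vec:
  assumes "A \<in> carrier_mat n m" "w \<in> carrier_vec m"
  shows "(c \<cdot>\<^sub>m A) *\<^sub>v w = c \<cdot>\<^sub>v (A *\<^sub>v w)"
  using assms by (intro eq_vecI) (auto simp: scalar_prod_def sum_distrib_left mult.assoc)

lemma isom_first_col:
  assumes x: "x \<in> carrier_vec d" "0 < d" "N x = 1"
  shows "\<exists>k\<in>isoms d. k *\<^sub>v unit_vec d 0 = x"
proof (cases "ultrametric v")
  case False
  obtain \<phi> :: "'k \<Rightarrow> complex" and cj where \<phi>: "field_hom \<phi>" "inj \<phi>" "\<And>x. v x = cmod (\<phi> x)"
    "\<And>x. \<phi> (cj x) = cnj (\<phi> x)" "range \<phi> = UNIV \<or> range \<phi> = \<real>"
    using arch_conj[OF False] by metis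
  interpret field_hom \<phi> by fact
  \<comment> \<open>The phase conj(x_0) / |x_0| lies in the field and turns the first coordinate
    into a real number; the isometry found for the rotated vector is rotated back
    afterwards.\<close>
  have "\<exists>u. v u = 1 \<and> \<phi> (u * x $ 0) \<in> \<real>"
  proof (cases "x $ 0 = 0")
    case True
    then show ?thesis by (intro exI[of _ 1]) auto
  next
    case nz: False
    have "complex_of_real (cmod (\<phi> (x $ 0))) \<in> range \<phi>" using \<phi>(5) by auto
    then obtain m where m: "\<phi> m = complex_of_real (cmod (\<phi> (x $ 0)))" by (metis imageE)
    have "\<phi> (x $ 0) \<noteq> 0" using nz by simp
    then have "v (cj (x $ 0) / m) = 1" "\<phi> (cj (x $ 0) / m * x $ 0) = complex_of_real (cmod (\<phi> (x $ 0)))"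
    proof -
      have h: "\<phi> (cj (x $ 0) / m) = cnj (\<phi> (x $ 0)) / complex_of_real (cmod (\<phi> (x $ 0)))"
        by (simp only: divide_inverse hom_mult hom_inverse \<phi>(4) m)
      show "v (cj (x $ 0) / m) = 1" using \<open>\<phi> (x $ 0) \<noteq> 0\<close> by (simp add: \<phi>(3) h norm_divide)
      have "cnj (\<phi> (x $ 0)) * \<phi> (x $ 0) = complex_of_real (cmod (\<phi> (x $ 0))) * complex_of_real (cmod (\<phi> (x $ 0)))"
        using complex_norm_square[of "\<phi> (x $ 0)"] by (simp add: power2_eq_square mult.commute)
      then show "\<phi> (cj (x $ 0) / m * x $ 0) = complex_of_real (cmod (\<phi> (x $ 0)))"
        unfolding hom_mult h using \<open>\<phi> (x $ 0) \<noteq> 0\<close> by simp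
    qed
    then show ?thesis by (metis Reals_of_real)
  qed
  then obtain u where u: "v u = 1" "\<phi> (u * x $ 0) \<in> \<real>" by auto
  obtain k where k: "k \<in> isoms d" "k *\<^sub>v unit_vec d 0 = u \<cdot>\<^sub>v x"
    using isom_first_col_arch_real[OF False \<phi>(1-4), of "u \<cdot>\<^sub>v x" d] x u by (auto simp: N_smult[of _ d])
  have "u \<noteq> 0" using u by auto
  then have "(inverse u \<cdot>\<^sub>m k) *\<^sub>v unit_vec d 0 = x"
    using smult_mat_vec[OF isom_carrier[OF k(1)], of "unit_vec d 0" "inverse u"] k x by (auto simp: smult_smult_assoc)
  moreover have "inverse u \<cdot>\<^sub>m k \<in> isoms d" using isom_smult k x u by (simp add: v_inverse)
  ultimately show ?thesis by blast
qed (use isom_first_col_nonarch x in blast)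

end

section \<open>Block matrices and the induction for Cartan decompositions\<close>

definition blk :: "nat \<Rightarrow> 'k::field \<Rightarrow> 'k mat \<Rightarrow> 'k mat" where
  "blk n c A = mat (Suc n) (Suc n) (\<lambda>(i,j). if i = 0 \<and> j = 0 then c else if i = 0 \<or> j = 0 then 0 else A $$ (i - 1, j - 1))"

lemma blk_carrier [simp]: "blk n c A \<in> carrier_mat (Suc n) (Suc n)"
  by (simp add: blk_def)

lemma mult_mat_coord:
  assumes "A \<in> carrier_mat n m" "B \<in> carrier_mat m p" "i < n" "j < p"
  shows "(A * B) $$ (i,j) = (\<Sum>q<m. A $$ (i,q) * B $$ (q,j))"
  using assms by (auto simp: scalar_prod_def atLeast0LessThan intro!: sum.cong)

lemma blk_mult:
  assumes "A \<in> carrier_mat n n" "B \<in> carrier_mat n n"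
  shows "blk n c A * blk n c' B = blk n (c * c') (A * B)"
proof (rule eq_matI)
  fix i j assume "i < dim_row (blk n (c * c') (A * B))" "j < dim_col (blk n (c * c') (A * B))"
  then have ij: "i < Suc n" "j < Suc n" by (auto simp: blk_def)
  have "(blk n c A * blk n c' B) $$ (i,j) = (\<Sum>q<Suc n. blk n c A $$ (i,q) * blk n c' B $$ (q,j))"
    by (rule mult_mat_coord) (use ij in auto)
  also have "\<dots> = blk n c A $$ (i,0) * blk n c' B $$ (0,j) + (\<Sum>q<n. blk n c A $$ (i,Suc q) * blk n c' B $$ (Suc q,j))"
    by (rule sum.lessThan_Suc_shift)
  also have "\<dots> = blk n (c * c') (A * B) $$ (i,j)"
  proof (cases "i = 0 \<or> j = 0")
    case False
    then obtain i' j' where "i = Suc i'" "j = Suc j'" by (metis not0_implies_Suc)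
    then show ?thesis using ij mult_mat_coord[OF assms, of i' j'] by (simp add: blk_def del: index_mult_mat)
  qed (use ij in \<open>auto simp: blk_def intro!: sum.neutral\<close>)
  finally show "(blk n c A * blk n c' B) $$ (i,j) = blk n (c * c') (A * B) $$ (i,j)" .
qed (auto simp: blk_def)

context local_field_abs begin

text \<open>Maximum or Pythagoras, according to the branch of the norm. For n = 0 the norm of the
  remaining coordinates would be unspecified in the first branch, so the induction below starts in
  dimension 1.\<close>

lemma N_Suc:
  assumes "w \<in> carrier_vec (Suc n)" "0 < n"
  shows "N w = (if ultrametric v then max (v (w $ 0)) (N (vec n (\<lambda>i. w $ Suc i)))
    else sqrt ((v (w $ 0))\<^sup>2 + (N (vec n (\<lambda>i. w $ Suc i)))\<^sup>2))"
proof (cases "ultrametric v")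
  case True
  let ?w = "vec n (\<lambda>i. w $ Suc i)"
  have "N w \<le> max (v (w $ 0)) (N ?w)" unfolding N_nonarch_le_iff[OF True assms(1) zero_less_Suc]
  proof (intro allI impI)
    fix i assume "i < Suc n"
    then show "v (w $ i) \<le> max (v (w $ 0)) (N ?w)"
      using N_coord_le[of ?w n "i - 1"] by (cases i) auto
  qed
  moreover have "N ?w \<le> N w"
    using N_coord_le[OF assms(1)] assms(2) by (subst N_nonarch_le_iff[OF True, of _ n]) auto
  ultimately show ?thesis using True N_coord_le[OF assms(1), of 0] by auto
next
  case False
  have "(\<Sum>i<Suc n. (v (w $ i))\<^sup>2) = (v (w $ 0))\<^sup>2 + (\<Sum>i<n. (v (w $ Suc i))\<^sup>2)"
    by (rule sum.lessThan_Suc_shift)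
  then show ?thesis using False assms by (simp add: N_arch[of _ "Suc n"] N_arch[of _ n] L2_set_def sum_nonneg)
qed

lemma blk_mult_vec:
  assumes "A \<in> carrier_mat n n" "w \<in> carrier_vec (Suc n)"
  shows "(blk n c A *\<^sub>v w) $ 0 = c * w $ 0"
    "vec n (\<lambda>i. (blk n c A *\<^sub>v w) $ Suc i) = A *\<^sub>v vec n (\<lambda>i. w $ Suc i)"
proof -
  have e: "(blk n c A *\<^sub>v w) $ i = blk n c A $$ (i,0) * w $ 0 + (\<Sum>q<n. blk n c A $$ (i,Suc q) * w $ Suc q)"
    if "i < Suc n" for i
    unfolding mult_vec_coord[OF blk_carrier assms(2) that] by (rule sum.lessThan_Suc_shift)
  show "(blk n c A *\<^sub>v w) $ 0 = c * w $ 0" by (subst e) (auto simp: blk_def intro!: sum.neutral)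
  show "vec n (\<lambda>i. (blk n c A *\<^sub>v w) $ Suc i) = A *\<^sub>v vec n (\<lambda>i. w $ Suc i)"
  proof (rule eq_vecI)
    fix i assume "i < dim_vec (A *\<^sub>v vec n (\<lambda>i. w $ Suc i))"
    then have i: "i < n" using assms by auto
    then show "vec n (\<lambda>i. (blk n c A *\<^sub>v w) $ Suc i) $ i = (A *\<^sub>v vec n (\<lambda>i. w $ Suc i)) $ i"
      using mult_vec_coord[OF assms(1), of "vec n (\<lambda>i. w $ Suc i)" i] e[of "Suc i"]
      by (simp del: index_mult_mat_vec) (simp add: blk_def)
  qed (use assms in auto)
qed

lemma blk_isom:
  assumes "k \<in> isoms n" "0 < n"
  shows "blk n 1 k \<in> isoms (Suc n)"
proof (rule isom_I)
  fix w :: "'k vec" assume w: "w \<in> carrier_vec (Suc n)"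
  then have c: "blk n 1 k *\<^sub>v w \<in> carrier_vec (Suc n)" by (meson blk_carrier mult_mat_vec_carrier)
  show "N (blk n 1 k *\<^sub>v w) = N w"
    unfolding N_Suc[OF c assms(2)] N_Suc[OF w assms(2)] blk_mult_vec[OF isom_carrier[OF assms(1)] w]
    using isom_norm[OF assms(1), of "vec n (\<lambda>i. w $ Suc i)"] by simp
qed auto

text \<open>The operator norm is attained: a maximizing sequence of unit vectors has a convergent
  subsequence, and \<open>N (g *\<^sub>v w)\<close> is continuous in \<open>w\<close>. Other vectors
  reduce to unit vectors because exact normalization is possible.\<close>

lemma max_norm_direction:
  assumes g: "g \<in> carrier_mat d d" and d: "0 < d"
  obtains x where "x \<in> carrier_vec d" "N x = 1" "\<And>w. w \<in> carrier_vec d \<Longrightarrow> N (g *\<^sub>v w) \<le> N (g *\<^sub>v x) * N w"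
proof -
  define B where "B = {N (g *\<^sub>v w) | w. w \<in> carrier_vec d \<and> N w = 1}"
  obtain C where C: "\<And>x. x \<in> carrier_vec d \<Longrightarrow> N (g *\<^sub>v x) \<le> C * N x" using op_bound[OF g d] by metis
  have bdd: "bdd_above B" by (rule bdd_aboveI[of _ C]) (use C in \<open>force simp: B_def\<close>)
  have "N (g *\<^sub>v unit_vec d 0) \<in> B" unfolding B_def using N_unit_vec[OF d] by auto
  then have ne: "B \<noteq> {}" by auto
  define S where "S = Sup B"
  have "\<exists>w. w \<in> carrier_vec d \<and> N w = 1 \<and> S - inverse (real (Suc n)) < N (g *\<^sub>v w)" for n
  proof -
    have "S - inverse (real (Suc n)) < S" by simp
    then show ?thesis unfolding S_def less_cSup_iff[OF ne bdd] by (auto simp: B_def)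
  qed
  then obtain x where x: "\<And>n. x n \<in> carrier_vec d" "\<And>n. N (x n) = 1" "\<And>n. S - inverse (real (Suc n)) < N (g *\<^sub>v x n)"
    by metis
  obtain l s where l: "l \<in> carrier_vec d" "strict_mono (s :: nat \<Rightarrow> nat)" "(\<lambda>t. N (x (s t) - l)) \<longlonglongrightarrow> 0"
    using bounded_vec_convergent_subseq[of x d 1] x d by auto
  have gc: "g *\<^sub>v w \<in> carrier_vec d" if "w \<in> carrier_vec d" for w using g that by auto
  have "(\<lambda>t. N (x (s t))) \<longlonglongrightarrow> N l" 
    using N_limit_unique[OF l(1) d, of "\<lambda>t. x (s t)"] l x by simp
  then have l1: "N l = 1" using x(2) by (simp add: LIMSEQ_const_iff)
  have "(\<lambda>t. N (g *\<^sub>v x (s t) - g *\<^sub>v l)) \<longlonglongrightarrow> 0"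
  proof (rule tendsto_sandwich[of "\<lambda>_. 0" _ _ "\<lambda>t. C * N (x (s t) - l)"])
    show "(\<lambda>t. C * N (x (s t) - l)) \<longlonglongrightarrow> 0" using tendsto_mult_left[OF l(3), of C] by simp
    show "\<forall>\<^sub>F t in sequentially. N (g *\<^sub>v x (s t) - g *\<^sub>v l) \<le> C * N (x (s t) - l)"
      using C[of "x (s _) - l"] mult_minus_distrib_mat_vec[OF g x(1) l(1)] x(1) l(1) by (auto intro!: always_eventually)
    show "\<forall>\<^sub>F t in sequentially. 0 \<le> N (g *\<^sub>v x (s t) - g *\<^sub>v l)"
      using N_nonneg[OF _ d] gc x(1) l(1) by (auto intro!: always_eventually)
  qed auto
  then have lim: "(\<lambda>t. N (g *\<^sub>v x (s t))) \<longlonglongrightarrow> N (g *\<^sub>v l)"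
    using N_limit_unique[OF gc[OF l(1)] d, of "\<lambda>t. g *\<^sub>v x (s t)"] gc x(1) by blast
  have "(\<lambda>t. S - inverse (real (Suc (s t)))) \<longlonglongrightarrow> S - 0"
    by (intro tendsto_intros LIMSEQ_subseq_LIMSEQ[OF LIMSEQ_inverse_real_of_nat l(2), unfolded comp_def])
  then have "S \<le> N (g *\<^sub>v l)"
    using LIMSEQ_le[OF _ lim, of "\<lambda>t. S - inverse (real (Suc (s t)))" S] x(3) by (auto intro: less_imp_le)
  have "N (g *\<^sub>v w) \<le> N (g *\<^sub>v l) * N w" if w: "w \<in> carrier_vec d" for w
  proof (cases "w = 0\<^sub>v d")
    case True
    then have "g *\<^sub>v w = 0\<^sub>v d" using g by auto
    then show ?thesis using True d by simp
  next
    case False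
    obtain c y where y: "c \<noteq> 0" "y \<in> carrier_vec d" "N y = 1" "w = c \<cdot>\<^sub>v y" "N w = v c"
      using N_normalize[OF w d False] by metis
    have "N (g *\<^sub>v y) \<in> B" using y by (auto simp: B_def)
    then have "N (g *\<^sub>v y) \<le> N (g *\<^sub>v l)" using cSup_upper[OF _ bdd] \<open>S \<le> _\<close> unfolding S_def by fastforce
    moreover have "g *\<^sub>v w = c \<cdot>\<^sub>v (g *\<^sub>v y)" using g y mult_mat_vec by auto
    ultimately show ?thesis using N_smult[OF gc[OF y(2)] d, of c] y by (simp add: mult.commute mult_left_mono)
  qed
  then show ?thesis using that l(1) l1 by blast
qed

text \<open>Subtracting \<open>g $$ (0,j) / lam\<close> times column 0 from column j clears the
  first row. In the ultrametric case these coefficients have absolute value at most 1, since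
  \<open>v lam\<close> bounds the operator norm of \<open>g\<close>, so the unipotent matrix
  \<open>l\<close> and its inverse do not increase norms. In the Archimedean case \<open>l\<close>
  turns out to be the identity.\<close>

lemma eliminate_row:
  assumes g: "g \<in> carrier_mat (Suc n) (Suc n)" and lam: "g *\<^sub>v unit_vec (Suc n) 0 = lam \<cdot>\<^sub>v unit_vec (Suc n) 0" "lam \<noteq> 0"
    and le: "\<And>w. w \<in> carrier_vec (Suc n) \<Longrightarrow> N (g *\<^sub>v w) \<le> v lam * N w"
  obtains l G where "l \<in> isoms (Suc n)" "G \<in> carrier_mat n n" "g * l = blk n lam G"
proof -
  have col0: "g $$ (i,0) = (if i = 0 then lam else 0)" if "i < Suc n" for i
  proof -
    have "g $$ (i,0) = (g *\<^sub>v unit_vec (Suc n) 0) $ i" using g that by auto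
    then show ?thesis unfolding lam using that by auto
  qed
  define l where "l = mat (Suc n) (Suc n) (\<lambda>(i,j). (if i = j then 1 else 0) - (if i = 0 \<and> j \<noteq> 0 then g $$ (0,j) / lam else 0))"
  have l: "l \<in> carrier_mat (Suc n) (Suc n)" by (simp add: l_def)
  define G where "G = mat n n (\<lambda>(i,j). g $$ (Suc i, Suc j))"
  have "g * l = blk n lam G"
  proof (rule eq_matI)
    fix i j assume "i < dim_row (blk n lam G)" "j < dim_col (blk n lam G)"
    then have ij: "i < Suc n" "j < Suc n" by (auto simp: blk_def)
    have "(g * l) $$ (i,j) = (\<Sum>q<Suc n. g $$ (i,q) * l $$ (q,j))"
      by (rule mult_mat_coord[OF g l ij])
    also have "\<dots> = (\<Sum>q<Suc n. (if q = j then g $$ (i,q) else 0) - (if q = 0 then (if j \<noteq> 0 then g $$ (i,0) * g $$ (0,j) / lam else 0) else 0))"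
      by (rule sum.cong) (use ij in \<open>auto simp: l_def algebra_simps\<close>)
    also have "\<dots> = g $$ (i,j) - (if j \<noteq> 0 then g $$ (i,0) * g $$ (0,j) / lam else 0)"
      using ij by (simp add: sum_subtractf del: sum.lessThan_Suc)
    also have "\<dots> = blk n lam G $$ (i,j)"
      using ij lam(2) by (cases i; cases j) (auto simp: blk_def G_def col0)
    finally show "(g * l) $$ (i,j) = blk n lam G $$ (i,j)" .
  qed (use g l in \<open>auto simp: blk_def\<close>)
  moreover have "l \<in> isoms (Suc n)"
  proof (cases "ultrametric v")
    case True
    have "v (g $$ (0,j) / lam) \<le> 1" if "j < Suc n" for j
    proof -
      have "v (g $$ (0,j)) \<le> N (g *\<^sub>v unit_vec (Suc n) j)"
        using N_coord_le[of "g *\<^sub>v unit_vec (Suc n) j" "Suc n" 0] g that by auto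
      also have "\<dots> \<le> v lam" using le[of "unit_vec (Suc n) j"] N_unit_vec[OF that] by auto
      finally show ?thesis using lam(2) by (simp add: v_divide)
    qed
    note b = this
    define b where "b w = (\<Sum>j<n. g $$ (0,Suc j) / lam * w $ Suc j)" for w :: "'k vec"
    have lw: "(l *\<^sub>v w) $ i = (if i = 0 then w $ 0 - b w else w $ i)" if "w \<in> carrier_vec (Suc n)" "i < Suc n" for w i
    proof -
      have "(l *\<^sub>v w) $ i = (\<Sum>j<Suc n. (if j = i then w $ j else 0) - (if i = 0 then (if j \<noteq> 0 then g $$ (0,j) / lam * w $ j else 0) else 0))"
        unfolding mult_vec_coord[OF l that] using that by (intro sum.cong) (auto simp: l_def algebra_simps)
      also have "\<dots> = w $ i - (if i = 0 then (\<Sum>j<Suc n. if j \<noteq> 0 then g $$ (0,j) / lam * w $ j else 0) else 0)"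
        using that by (simp add: sum_subtractf del: sum.lessThan_Suc)
      also have "(\<Sum>j<Suc n. if j \<noteq> 0 then g $$ (0,j) / lam * w $ j else 0) = b w"
        unfolding b_def by (subst sum.lessThan_Suc_shift) auto
      finally show ?thesis by auto
    qed
    have bw: "v (b w) \<le> C" if "\<And>i. 0 < i \<Longrightarrow> i < Suc n \<Longrightarrow> v (w $ i) \<le> C" "0 \<le> C" for w C
      unfolding b_def
    proof (rule v_sum_ultra[OF True])
      fix i assume "i \<in> {..<n}"
      then have "v (w $ Suc i) \<le> C" "v (g $$ (0,Suc i) / lam) \<le> 1" using that(1)[of "Suc i"] b by auto
      then show "v (g $$ (0, Suc i) / lam * w $ Suc i) \<le> C"
        unfolding v_mult using mult_mono[of "v (g $$ (0,Suc i) / lam)" 1 "v (w $ Suc i)" C] by simp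
    qed fact
    show ?thesis
    proof (rule isom_I[OF zero_less_Suc l])
      fix w :: "'k vec" assume w: "w \<in> carrier_vec (Suc n)"
      have lwc: "l *\<^sub>v w \<in> carrier_vec (Suc n)" using l w by auto
      show "N (l *\<^sub>v w) = N w"
      proof (rule antisym)
        show "N (l *\<^sub>v w) \<le> N w" unfolding N_nonarch_le_iff[OF True lwc zero_less_Suc]
        proof (intro allI impI)
          fix i assume i: "i < Suc n"
          have "v (b w) \<le> N w" using bw N_coord_le[OF w] N_nonneg[OF w] by auto
          then have "v (w $ 0 + - b w) \<le> N w"
            using v_add_ultra[OF True, of "w $ 0" "- b w"] N_coord_le[OF w zero_less_Suc] by simp
          then show "v ((l *\<^sub>v w) $ i) \<le> N w" using lw[OF w i] N_coord_le[OF w i] by auto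
        qed
        show "N w \<le> N (l *\<^sub>v w)" unfolding N_nonarch_le_iff[OF True w zero_less_Suc]
        proof (intro allI impI)
          fix i assume i: "i < Suc n"
          have o: "v (w $ i) \<le> N (l *\<^sub>v w)" if "0 < i" "i < Suc n" for i
            using N_coord_le[OF lwc that(2)] lw[OF w that(2)] that by simp
          then have "v (b w) \<le> N (l *\<^sub>v w)" using bw N_nonneg[OF lwc] by auto
          moreover have "v (w $ 0 - b w) \<le> N (l *\<^sub>v w)" 
            using N_coord_le[OF lwc zero_less_Suc] lw[OF w zero_less_Suc] by simp
          ultimately have "v (w $ 0) \<le> N (l *\<^sub>v w)" using v_add_ultra[OF True, of "w $ 0 - b w" "b w"] by simp
          then show "v (w $ i) \<le> N (l *\<^sub>v w)" using o i by (cases "i = 0") auto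
        qed
      qed
    qed
  next
    case False
    obtain \<phi> :: "'k \<Rightarrow> complex" and cj where \<phi>: "field_hom \<phi>" "inj \<phi>" "\<And>x. v x = cmod (\<phi> x)"
      "\<And>x. \<phi> (cj x) = cnj (\<phi> x)" using arch_conj[OF False] by metis
    interpret field_hom \<phi> by fact
    \<comment> \<open>The bound on the norm of \<open>g\<close>, tested on the conjugate of its first row, forces that row to be
      \<open>(lam, 0, ..., 0)\<close>.\<close>
    define w where "w = vec (Suc n) (\<lambda>j. cj (g $$ (0,j)))"
    have w: "w \<in> carrier_vec (Suc n)" by (simp add: w_def)
    define T where "T = (\<Sum>j<Suc n. (v (g $$ (0,j)))\<^sup>2)"
    have "\<phi> ((g *\<^sub>v w) $ 0) = complex_of_real T"
      unfolding mult_vec_coord[OF g w zero_less_Suc] hom_sum T_def of_real_sum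
      by (rule sum.cong) (auto simp: w_def hom_mult \<phi>(3,4) complex_norm_square simp del: of_real_power)
    moreover have T0: "0 \<le> T" unfolding T_def by (rule sum_nonneg) simp
    ultimately have "v ((g *\<^sub>v w) $ 0) = T" by (simp add: \<phi>(3))
    then have "T \<le> N (g *\<^sub>v w)" using N_coord_le[of "g *\<^sub>v w" "Suc n" 0] g w by auto
    also have "\<dots> \<le> v lam * N w" by (rule le[OF w])
    also have "N w = sqrt T" using False w
      by (simp add: N_arch[of _ "Suc n"] L2_set_def T_def \<phi>(3) w_def \<phi>(4) del: sum.lessThan_Suc)
    finally have "sqrt T * sqrt T \<le> v lam * sqrt T" using T0 by simp
    \<comment> \<open>The estimate gives T \<le> |lam|^2, but |lam|^2 is already one summand of T,
      so all other summands vanish.\<close>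
    moreover have T_eq: "T = (v lam)\<^sup>2 + (\<Sum>j<n. (v (g $$ (0,Suc j)))\<^sup>2)"
      unfolding T_def by (subst sum.lessThan_Suc_shift) (simp add: col0)
    have "0 < (v lam)\<^sup>2" using lam(2) by simp
    then have Tpos: "0 < T" unfolding T_eq by (intro add_pos_nonneg sum_nonneg) auto
    ultimately have "sqrt T \<le> v lam" using mult_le_cancel_right[of "sqrt T" "sqrt T" "v lam"] by auto
    then have "T \<le> (v lam)\<^sup>2" using T0 by (metis power_mono real_sqrt_ge_zero real_sqrt_pow2)
    then have "(\<Sum>j<n. (v (g $$ (0,Suc j)))\<^sup>2) = 0"
      using T_eq sum_nonneg[of "{..<n}" "\<lambda>j. (v (g $$ (0,Suc j)))\<^sup>2"] by auto
    then have "g $$ (0,Suc j) = 0" if "j < n" for j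
      using that by (subst (asm) sum_nonneg_eq_0_iff) auto
    then have "g $$ (0,j) = 0" if "0 < j" "j < Suc n" for j using that by (cases j) auto
    then have "l = 1\<^sub>m (Suc n)" by (intro eq_matI) (auto simp: l_def)
    then show ?thesis using one_isom by simp
  qed
  ultimately show ?thesis using that[of l G] by (simp add: G_def)
qed

text \<open>\<open>l1\<close> moves the first unit vector to a direction of maximal stretch and
  \<open>k1\<close> moves it to the direction of its image. After these changes of basis the first
  unit vector is an eigenvector whose eigenvalue has the operator norm as absolute value. Clearing
  the first row leaves a block \<open>G\<close> of size n for the induction hypothesis.\<close>

lemma cartan_step:
  assumes g: "g \<in> carrier (GL (Suc n))" and n: "0 < n"
    and IH: "\<And>g. g \<in> carrier (GL n) \<Longrightarrow> \<exists>kal. cartan_decomposition v n g kal"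
  shows "\<exists>kal. cartan_decomposition v (Suc n) g kal"
proof -
  let ?e = "unit_vec (Suc n) 0"
  have gc: "g \<in> carrier_mat (Suc n) (Suc n)" using g by simp
  obtain x where x: "x \<in> carrier_vec (Suc n)" "N x = 1"
    "\<And>w. w \<in> carrier_vec (Suc n) \<Longrightarrow> N (g *\<^sub>v w) \<le> N (g *\<^sub>v x) * N w"
    using max_norm_direction[OF gc zero_less_Suc] by metis
  have "x \<noteq> 0\<^sub>v (Suc n)" using x(2) by auto
  then have gx: "g *\<^sub>v x \<in> carrier_vec (Suc n)" "g *\<^sub>v x \<noteq> 0\<^sub>v (Suc n)" using GL_inj[OF g x(1)] x(1) gc by auto
  obtain lam y where y: "lam \<noteq> 0" "y \<in> carrier_vec (Suc n)" "N y = 1" "g *\<^sub>v x = lam \<cdot>\<^sub>v y" "N (g *\<^sub>v x) = v lam"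
    using N_normalize[OF gx(1) zero_less_Suc gx(2)] by metis
  obtain k1 l1 where k1: "k1 \<in> isoms (Suc n)" "k1 *\<^sub>v ?e = y" and l1: "l1 \<in> isoms (Suc n)" "l1 *\<^sub>v ?e = x"
    using isom_first_col[OF x(1) _ x(2)] isom_first_col[OF y(2) _ y(3)] by auto
  obtain k1' where k1': "k1' \<in> isoms (Suc n)" "k1 * k1' = 1\<^sub>m (Suc n)" "k1' * k1 = 1\<^sub>m (Suc n)"
    using isom_inverse[OF k1(1)] by metis
  obtain l1' where l1': "l1' \<in> isoms (Suc n)" "l1 * l1' = 1\<^sub>m (Suc n)" "l1' * l1 = 1\<^sub>m (Suc n)"
    using isom_inverse[OF l1(1)] by metis
  note c1 = isom_carrier[OF k1(1)] isom_carrier[OF l1(1)] isom_carrier[OF k1'(1)] isom_carrier[OF l1'(1)]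
  define g1 where "g1 = k1' * g * l1"
  have g1: "g1 \<in> carrier_mat (Suc n) (Suc n)" unfolding g1_def using c1 gc by auto
  have g1v: "g1 *\<^sub>v w = k1' *\<^sub>v (g *\<^sub>v (l1 *\<^sub>v w))" if "w \<in> carrier_vec (Suc n)" for w
    unfolding g1_def using c1 gc that by (simp add: assoc_mult_mat_vec[of _ "Suc n" "Suc n" _ "Suc n"])
  have g1e: "g1 *\<^sub>v ?e = lam \<cdot>\<^sub>v ?e"
  proof -
    have "k1' *\<^sub>v y = ?e" using inverse_mult_vec[OF k1'(3) c1(3,1), of ?e] k1 by auto
    then show ?thesis unfolding g1v[OF unit_vec_carrier] l1 y(4) using mult_mat_vec[OF c1(3) y(2)] by simp
  qed
  have g1le: "N (g1 *\<^sub>v w) \<le> v lam * N w" if "w \<in> carrier_vec (Suc n)" for w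
  proof -
    have "l1 *\<^sub>v w \<in> carrier_vec (Suc n)" "g *\<^sub>v (l1 *\<^sub>v w) \<in> carrier_vec (Suc n)" using c1 gc that by auto
    then show ?thesis unfolding g1v[OF that]
      using isom_norm[OF k1'(1)] isom_norm[OF l1(1) that] x(3) y(5) by metis
  qed
  obtain l2 G where G: "l2 \<in> isoms (Suc n)" "G \<in> carrier_mat n n" "g1 * l2 = blk n lam G"
    using eliminate_row[OF g1 g1e y(1) g1le] by metis
  obtain l2' where l2': "l2' \<in> isoms (Suc n)" "l2 * l2' = 1\<^sub>m (Suc n)" "l2' * l2 = 1\<^sub>m (Suc n)"
    using isom_inverse[OF G(1)] by metis
  note c2 = isom_carrier[OF G(1)] isom_carrier[OF l2'(1)]
  have bGL: "blk n lam G \<in> carrier (GL (Suc n))"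
    unfolding G(3)[symmetric] g1_def using GL_mult isom_GL k1'(1) l1(1) G(1) g by blast
  have ble: "N (blk n lam G *\<^sub>v w) \<le> v lam * N w" if w: "w \<in> carrier_vec (Suc n)" for w
  proof -
    have "l2 *\<^sub>v w \<in> carrier_vec (Suc n)" using c2 w by auto
    then show ?thesis
      unfolding G(3)[symmetric] assoc_mult_mat_vec[OF g1 c2(1) w] using g1le isom_norm[OF G(1) w] by metis
  qed
  \<comment> \<open>Padding with a leading 0 embeds the smaller space isometrically, so that the
    norm bound and the injectivity of the block matrix pass to \<open>G\<close>.\<close>
  define ext where "ext w = vec (Suc n) (\<lambda>i. case i of 0 \<Rightarrow> 0 | Suc j \<Rightarrow> w $ j)" for w :: "'k vec"
  have ext: "ext w \<in> carrier_vec (Suc n)" "ext w $ 0 = 0" "vec n (\<lambda>i. ext w $ Suc i) = w"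
    if "w \<in> carrier_vec n" for w using that by (auto simp: ext_def)
  have N0: "N w = N (vec n (\<lambda>i. w $ Suc i))" if "w \<in> carrier_vec (Suc n)" "w $ 0 = 0" for w
    using that N_Suc[OF that(1) n] N_nonneg[of "vec n (\<lambda>i. w $ Suc i)" n] n by auto
  have bext: "blk n lam G *\<^sub>v ext w \<in> carrier_vec (Suc n)" "(blk n lam G *\<^sub>v ext w) $ 0 = 0"
     "vec n (\<lambda>i. (blk n lam G *\<^sub>v ext w) $ Suc i) = G *\<^sub>v w" if "w \<in> carrier_vec n" for w
    using blk_mult_vec[OF G(2) ext(1)[OF that], of lam] ext[OF that] mult_mat_vec_carrier[OF blk_carrier ext(1)[OF that]] by auto
  have Gle: "N (G *\<^sub>v w) \<le> v lam * N w" if w: "w \<in> carrier_vec n" for w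
    using ble[OF ext(1)[OF w]] N0[OF bext(1,2)[OF w]] N0[OF ext(1,2)[OF w]] bext(3)[OF w] ext(3)[OF w] by simp
  have "G \<in> carrier (GL n)"
  proof (rule inj_imp_GL[OF G(2)])
    fix w assume w: "w \<in> carrier_vec n" "G *\<^sub>v w = 0\<^sub>v n"
    have "N (blk n lam G *\<^sub>v ext w) = 0" using N0[OF bext(1,2)[OF w(1)]] bext(3)[OF w(1)] w n by simp
    then have "blk n lam G *\<^sub>v ext w = 0\<^sub>v (Suc n)" using N_eq_0 bext(1)[OF w(1)] by blast
    then have "ext w = 0\<^sub>v (Suc n)" using GL_inj[OF bGL ext(1)[OF w(1)]] by blast
    then have "vec n (\<lambda>i. ext w $ Suc i) = 0\<^sub>v n" by (intro eq_vecI) auto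
    then show "w = 0\<^sub>v n" using ext(3)[OF w(1)] by simp
  qed
  then obtain k3 a3 l3 where "cartan_decomposition v n G (k3, a3, l3)" using IH by (metis prod_cases3)
  then have c3: "k3 \<in> isoms n" "l3 \<in> isoms n" "a3 \<in> carrier (GL n)" "diagonal_mat a3"
     "\<And>i j. i \<le> j \<Longrightarrow> j < n \<Longrightarrow> v (a3 $$ (j,j)) \<le> v (a3 $$ (i,i))" "G = k3 * a3 * l3"
    by (auto simp: cartan_decomposition_def)
  note c3c = isom_carrier[OF c3(1)] isom_carrier[OF c3(2)]
  have a3c: "a3 \<in> carrier_mat n n" using c3(3) by simp
  obtain l3' where l3': "l3' \<in> isoms n" "l3 * l3' = 1\<^sub>m n" "l3' * l3 = 1\<^sub>m n"
    using isom_inverse[OF c3(2)] by metis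
  \<comment> \<open>The only ordering of diagonal entries that the induction hypothesis does not
    provide is the one across the block boundary. It follows by testing the bound on
    \<open>G\<close> at the vector that \<open>l3\<close> sends to the first unit vector.\<close>
  have a00: "v (a3 $$ (0,0)) \<le> v lam"
  proof -
    let ?u = "l3' *\<^sub>v unit_vec n 0"
    have u: "?u \<in> carrier_vec n" using isom_carrier[OF l3'(1)] by auto
    have "l3 *\<^sub>v ?u = unit_vec n 0" using inverse_mult_vec[OF l3'(2) c3c(2) isom_carrier[OF l3'(1)], of "unit_vec n 0"] by simp
    then have "G *\<^sub>v ?u = k3 *\<^sub>v (a3 *\<^sub>v unit_vec n 0)"
      unfolding c3(6) using c3c a3c u by (simp add: assoc_mult_mat_vec[of _ n n _ n])
    moreover have "a3 *\<^sub>v unit_vec n 0 \<in> carrier_vec n" using a3c by auto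
    ultimately have "N (a3 *\<^sub>v unit_vec n 0) = N (G *\<^sub>v ?u)" using isom_norm[OF c3(1)] by metis
    also have "\<dots> \<le> v lam" using Gle[OF u] isom_norm[OF l3'(1), of "unit_vec n 0"] N_unit_vec[OF n] by simp
    finally have "N (a3 *\<^sub>v unit_vec n 0) \<le> v lam" .
    moreover have "(a3 *\<^sub>v unit_vec n 0) $ 0 = a3 $$ (0,0)" using a3c n by auto
    ultimately show ?thesis using N_coord_le[of "a3 *\<^sub>v unit_vec n 0" n 0] a3c n by auto
  qed
  define k a l where "k = k1 * blk n 1 k3" and "a = blk n lam a3" and "l = blk n 1 l3 * (l2' * l1')"
  have bl: "blk n lam G = blk n 1 k3 * a * blk n 1 l3"
    unfolding a_def c3(6) using c3c a3c by (simp add: blk_mult)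
  have "k \<in> isoms (Suc n)" "l \<in> isoms (Suc n)" unfolding k_def l_def
    using isom_mult blk_isom n c3(1,2) k1(1) l2'(1) l1'(1) by auto
  moreover have geq: "g = k * a * l"
  proof -
    let ?C = "carrier_mat (Suc n) (Suc n)"
    define K3 L3 where KL: "K3 = blk n 1 k3" "L3 = blk n 1 l3"
    have C: "K3 \<in> ?C" "a \<in> ?C" "L3 \<in> ?C" by (auto simp: a_def KL)
    have "k * a * l = k1 * (K3 * a * L3) * (l2' * l1')"
      unfolding k_def l_def KL[symmetric] using C c1 c2 by (simp add: assoc_mult_mat[of _ "Suc n" "Suc n" _ "Suc n" _ "Suc n"])
    also have "\<dots> = k1 * (k1' * g * l1 * l2) * (l2' * l1')" using G(3) bl unfolding g1_def KL by simp
    also have "\<dots> = (k1 * k1') * g * (l1 * ((l2 * l2') * l1'))"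
      using C c1 c2 gc by (simp add: assoc_mult_mat[of _ "Suc n" "Suc n" _ "Suc n" _ "Suc n"])
    also have "\<dots> = g" using k1'(2) l2'(2) l1'(2) c1 gc by simp
    finally show ?thesis by simp
  qed
  moreover have "diagonal_mat a"
    using c3(4) a3c unfolding diagonal_mat_def a_def by (auto simp: blk_def)
  moreover have "v (a $$ (j,j)) \<le> v (a $$ (i,i))" if "i \<le> j" "j < Suc n" for i j
  proof (cases "j = 0")
    case False
    then obtain j' where "j = Suc j'" by (metis not0_implies_Suc)
    then have j': "j = Suc j'" "j' < n" using that by auto
    have "v (a3 $$ (j',j')) \<le> v lam" using c3(5)[of 0 j'] a00 j' by simp
    then show ?thesis using that j' c3(5)[of "i - 1" j'] by (cases i) (auto simp: a_def blk_def)
  qed (use that in simp)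
  moreover have "a \<in> carrier (GL (Suc n))"
  proof (rule inj_imp_GL)
    fix w assume w: "w \<in> carrier_vec (Suc n)" "a *\<^sub>v w = 0\<^sub>v (Suc n)"
    have "lam * w $ 0 = 0" using blk_mult_vec(1)[OF a3c w(1), of lam] w(2) unfolding a_def by simp
    moreover have "a3 *\<^sub>v vec n (\<lambda>i. w $ Suc i) = 0\<^sub>v n"
      unfolding blk_mult_vec(2)[OF a3c w(1), of lam, symmetric] w(2)[unfolded a_def] by (intro eq_vecI) auto
    then have "vec n (\<lambda>i. w $ Suc i) = 0\<^sub>v n" using GL_inj[OF c3(3)] by simp
    then have "w $ Suc i = 0" if "i < n" for i using that by (metis index_vec index_zero_vec(1))
    ultimately show "w = 0\<^sub>v (Suc n)" using w(1) y(1)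
      by (intro eq_vecI) (auto simp: less_Suc_eq_0_disj)
  qed (simp add: a_def)
  ultimately have "cartan_decomposition v (Suc n) g (k, a, l)"
    unfolding cartan_decomposition_def by auto
  then show ?thesis by blast
qed

text \<open>This makes the \<open>SOME\<close> in \<open>chosen_cartan\<close> meaningful. A 1 by 1
  matrix is its own diagonal part.\<close>

lemma cartan_exists:
  assumes "0 < d" "g \<in> carrier (GL d)"
  shows "\<exists>kal. cartan_decomposition v d g kal"
proof -
  have "g \<in> carrier (GL (Suc m)) \<Longrightarrow> \<exists>kal. cartan_decomposition v (Suc m) g kal" for m g
  proof (induction m arbitrary: g)
    case 0
    have "g \<in> carrier_mat 1 1" using 0 by simp
    then have "cartan_decomposition v (Suc 0) g (1\<^sub>m 1, g, 1\<^sub>m 1)"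
      using 0 one_isom[of 1] by (auto simp: cartan_decomposition_def diagonal_mat_def)
    then show ?case by blast
  next
    case (Suc m)
    then show ?case using cartan_step[OF Suc.prems] by auto
  qed
  then show ?thesis using assms by (metis Suc_pred)
qed

end

section \<open>Singular values\<close>

definition coord_subspace :: "nat \<Rightarrow> nat \<Rightarrow> 'k::field vec set" where
  "coord_subspace d p = {x \<in> carrier_vec d. \<forall>i<d. p \<le> i \<longrightarrow> x $ i = 0}"

lemma coord_subspace_carrier: "x \<in> coord_subspace d p \<Longrightarrow> x \<in> carrier_vec d"
  by (simp add: coord_subspace_def)

text \<open>The span is the column space of the truncated identity matrix, whose elements are
  explicit. Afterwards only the description by vanishing coordinates is used.\<close>

lemma span_unit_vecs:
  assumes "p \<le> d"
  shows "LinearCombinations.module.span class_ring (module_vec TYPE('k::field) d) (unit_vec d ` {..<p})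
    = (coord_subspace d p :: 'k vec set)"
proof -
  interpret vec_space "TYPE('k)" d .
  define A where "A = mat d p (\<lambda>(i,j). if i = j then 1 else 0 :: 'k)"
  have A: "A \<in> carrier_mat d p" by (simp add: A_def)
  have "set (cols A) = unit_vec d ` {..<p}"
  proof -
    have "col A j = unit_vec d j" if "j < p" for j
      using that assms by (intro eq_vecI) (auto simp: A_def unit_vec_def)
    then show ?thesis using A by (auto simp: cols_def)
  qed
  then have "span (unit_vec d ` {..<p}) = col_space A" by (simp add: col_space_def)
  also have "\<dots> = coord_subspace d p"
  proof -
    have Ax: "(A *\<^sub>v x) $ i = (if i < p then x $ i else 0)" if "x \<in> carrier_vec p" "i < d" for x i
    proof -
      have "(A *\<^sub>v x) $ i = (\<Sum>j<p. A $$ (i,j) * x $ j)"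
        using that A by (auto simp: scalar_prod_def atLeast0LessThan intro!: sum.cong)
      also have "\<dots> = (\<Sum>j<p. if j = i then x $ j else 0)"
        by (rule sum.cong) (use that assms in \<open>auto simp: A_def\<close>)
      finally show ?thesis by simp
    qed
    have "y \<in> coord_subspace d p \<longleftrightarrow> y \<in> carrier_vec d \<and> (\<exists>x\<in>carrier_vec p. A *\<^sub>v x = y)" for y
    proof
      assume y: "y \<in> coord_subspace d p"
      have "A *\<^sub>v vec p (\<lambda>i. y $ i) = y"
      proof (rule eq_vecI)
        fix i assume "i < dim_vec y"
        then have "i < d" using y by (auto simp: coord_subspace_def)
        then show "(A *\<^sub>v vec p (\<lambda>i. y $ i)) $ i = y $ i"
          using Ax[of "vec p (\<lambda>i. y $ i)" i] y by (auto simp: coord_subspace_def simp del: index_mult_mat_vec)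
      qed (use A y in \<open>auto simp: coord_subspace_def\<close>)
      then show "y \<in> carrier_vec d \<and> (\<exists>x\<in>carrier_vec p. A *\<^sub>v x = y)"
        using y by (auto simp: coord_subspace_def intro!: bexI[of _ "vec p (\<lambda>i. y $ i)"])
    next
      assume "y \<in> carrier_vec d \<and> (\<exists>x\<in>carrier_vec p. A *\<^sub>v x = y)"
      then show "y \<in> coord_subspace d p" using Ax by (auto simp: coord_subspace_def simp del: index_mult_mat_vec)
    qed
    then show ?thesis using col_space_eq[OF A] A by auto
  qed
  finally show ?thesis .
qed

text \<open>Padding the n < d equations with zero rows gives a square matrix. Row n is zero, so
  every summand of the Leibniz formula vanishes and the matrix is singular.\<close>

lemma common_kernel_vec:
  fixes R :: "nat \<Rightarrow> 'k::field vec"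
  assumes "n < d" "\<And>m. m < n \<Longrightarrow> R m \<in> carrier_vec d"
  obtains x where "x \<in> carrier_vec d" "x \<noteq> 0\<^sub>v d" "\<And>m. m < n \<Longrightarrow> R m \<bullet> x = 0"
proof -
  define M where "M = mat d d (\<lambda>(i,j). if i < n then R i $ j else 0)"
  have M: "M \<in> carrier_mat d d" by (simp add: M_def)
  have rw: "row M i = R i" if "i < n" for i
    using that assms(1) carrier_vecD[OF assms(2)[OF that]] by (intro eq_vecI) (auto simp: M_def)
  have "det M = 0" unfolding det_def'[OF M]
  proof (rule sum.neutral, rule ballI)
    fix p assume "p \<in> {p. p permutes {0..<d}}"
    then have "p n < d" using assms(1) permutes_in_image[of p "{0..<d}" n] by auto
    then have "M $$ (n, p n) = 0" using assms(1) by (simp add: M_def)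
    then have "(\<Prod>i = 0..<d. M $$ (i, p i)) = 0" using assms(1) by (intro prod_zero) auto
    then show "signof p * (\<Prod>i = 0..<d. M $$ (i, p i)) = 0" by simp
  qed
  then obtain x where x: "x \<in> carrier_vec d" "x \<noteq> 0\<^sub>v d" "M *\<^sub>v x = 0\<^sub>v d"
    using det_0_iff_vec_prod_zero_field[OF M] by auto
  have "R m \<bullet> x = 0" if "m < n" for m
  proof -
    have "(M *\<^sub>v x) $ m = R m \<bullet> x" using that M assms(1) rw by simp
    then show ?thesis using x(3) that assms(1) by simp
  qed
  then show ?thesis using that x by blast
qed

lemma mult_left_chain_le: "a \<le> b \<Longrightarrow> c * b \<le> e \<Longrightarrow> 0 \<le> c \<Longrightarrow> c * a \<le> (e::real)"
  using mult_left_mono[of a b c] by linarith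

lemma mult_left_chain_ge: "b \<le> a \<Longrightarrow> e \<le> c * b \<Longrightarrow> 0 \<le> c \<Longrightarrow> e \<le> c * (a::real)"
  using mult_left_mono[of b a c] by linarith

context local_field_abs begin

text \<open>This relation is not symmetric, but its errors add up under composition, and as the errors tend
  to \<open>0\<close> the limits of both sides agree if they have equal dimensions (\<open>near_limit_eq\<close>).\<close>
definition near :: "real \<Rightarrow> 'k vec set \<Rightarrow> 'k vec set \<Rightarrow> bool" where
  "near e U W \<longleftrightarrow> (\<forall>u\<in>U. \<exists>w\<in>W. N w \<le> N u \<and> N (u - w) \<le> e * N u)"

lemma near_mono: 
  assumes "near e U W" "e \<le> e'" "U \<subseteq> carrier_vec d" "0 < d"
  shows "near e' U W"
  unfolding near_def
proof
  fix u assume u: "u \<in> U"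
  then obtain w where w: "w \<in> W" "N w \<le> N u" "N (u - w) \<le> e * N u" using assms(1) unfolding near_def by blast
  have "e * N u \<le> e' * N u" using assms N_nonneg[of u d] u by (auto intro: mult_right_mono)
  then show "\<exists>w\<in>W. N w \<le> N u \<and> N (u - w) \<le> e' * N u" using w by force
qed

text \<open>The clause \<open>N w \<le> N u\<close> in \<open>near\<close> does the work: it turns
  the second error, which is relative to \<open>N y\<close>, into one relative to
  \<open>N u\<close>, so that errors add without a growing factor.\<close>

lemma near_trans:
  assumes "near e U V" "near e' V W" "U \<subseteq> carrier_vec d" "V \<subseteq> carrier_vec d" "W \<subseteq> carrier_vec d" "0 < d" "0 \<le> e'"
  shows "near (e + e') U W"
  unfolding near_def
proof
  fix u assume u: "u \<in> U"
  obtain y where y: "y \<in> V" "N y \<le> N u" "N (u - y) \<le> e * N u" using assms(1) u unfolding near_def by blast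
  obtain w where w: "w \<in> W" "N w \<le> N y" "N (y - w) \<le> e' * N y" using assms(2) y unfolding near_def by blast
  have "N (u - w) \<le> N (u - y) + N (y - w)" using N_diff_triangle[of u d y w] u y w assms by auto
  also have "\<dots> \<le> e * N u + e' * N u" using y w mult_left_mono[OF y(2) assms(7)] by linarith
  finally show "\<exists>w\<in>W. N w \<le> N u \<and> N (u - w) \<le> (e + e') * N u"
    using w y by (auto simp: distrib_right intro!: bexI[of _ w])
qed

lemma cartan_D:
  assumes "cartan_decomposition v d g (k, a, l)"
  shows "k \<in> isoms d" "l \<in> isoms d" "a \<in> carrier (GL d)" "g = k * a * l"
    "\<And>i j. i \<le> j \<Longrightarrow> j < d \<Longrightarrow> v (a $$ (j,j)) \<le> v (a $$ (i,i))"
    "\<And>x i. x \<in> carrier_vec d \<Longrightarrow> i < d \<Longrightarrow> (a *\<^sub>v x) $ i = a $$ (i,i) * x $ i"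
    "k \<in> carrier_mat d d" "a \<in> carrier_mat d d" "l \<in> carrier_mat d d"
    "\<And>i. i < d \<Longrightarrow> a $$ (i,i) \<noteq> 0"
    "\<And>x. x \<in> carrier_vec d \<Longrightarrow> g *\<^sub>v x = k *\<^sub>v (a *\<^sub>v (l *\<^sub>v x))"
proof -
  show c: "k \<in> isoms d" "l \<in> isoms d" "a \<in> carrier (GL d)" "g = k * a * l"
    and ord: "\<And>i j. i \<le> j \<Longrightarrow> j < d \<Longrightarrow> v (a $$ (j,j)) \<le> v (a $$ (i,i))"
    using assms by (auto simp: cartan_decomposition_def)
  show m: "k \<in> carrier_mat d d" "a \<in> carrier_mat d d" "l \<in> carrier_mat d d"
    using c isom_carrier by auto
  show ax: "(a *\<^sub>v x) $ i = a $$ (i,i) * x $ i" if "x \<in> carrier_vec d" "i < d" for x i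
  proof -
    have "a $$ (i,j) * x $ j = (if j = i then a $$ (i,i) * x $ i else 0)" if "j < d" for j
      using assms that m \<open>i < d\<close> by (auto simp: cartan_decomposition_def diagonal_mat_def)
    then have "(\<Sum>j<d. a $$ (i,j) * x $ j) = (\<Sum>j<d. if j = i then a $$ (i,i) * x $ i else 0)"
      by (intro sum.cong) auto
    then show ?thesis using mult_vec_coord[OF m(2) that] that by simp
  qed
  show "a $$ (i,i) \<noteq> 0" if i: "i < d" for i
  proof
    assume "a $$ (i,i) = 0"
    then have "a *\<^sub>v unit_vec d i = 0\<^sub>v d"
      by (intro eq_vecI) (use m in \<open>auto simp: ax unit_vec_def simp del: index_mult_mat_vec\<close>)
    then have "unit_vec d i = (0\<^sub>v d :: 'k vec)" using GL_inj[OF c(3)] by auto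
    then have "unit_vec d i $ i = (0 :: 'k)" using i by simp
    then show False using i by simp
  qed
  show "g *\<^sub>v x = k *\<^sub>v (a *\<^sub>v (l *\<^sub>v x))" if "x \<in> carrier_vec d" for x
    unfolding c(4) using m that by (simp add: assoc_mult_mat_vec[of _ d d _ d])
qed

text \<open>A vector supported on the indices 0 to i meets only diagonal entries at least as large
  as the i-th one. Indices start at 0, so this entry is the singular value number i + 1.\<close>

lemma N_diag_ge:
  assumes c: "cartan_decomposition v d g (k, a, l)" and x: "x \<in> coord_subspace d (Suc i)" "i < d"
  shows "v (a $$ (i,i)) * N x \<le> N (a *\<^sub>v x)"
proof -
  have xc: "x \<in> carrier_vec d" using x by (simp add: coord_subspace_def)
  have "N (a $$ (i,i) \<cdot>\<^sub>v x) \<le> N (a *\<^sub>v x)"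
  proof (rule N_mono)
    fix j assume j: "j < d"
    show "v ((a $$ (i,i) \<cdot>\<^sub>v x) $ j) \<le> v ((a *\<^sub>v x) $ j)"
      using cartan_D(5)[OF c, of j i] x xc j
      by (cases "j \<le> i") (auto simp: cartan_D(6)[OF c xc j] v_mult coord_subspace_def mult_right_mono)
  qed (use x xc cartan_D(8)[OF c] in auto)
  then show ?thesis using N_smult[OF xc, of "a $$ (i,i)"] x by simp
qed

lemma N_diag_le:
  assumes c: "cartan_decomposition v d g (k, a, l)" and x: "x \<in> carrier_vec d" "\<And>j. j < i \<Longrightarrow> x $ j = 0" "i < d"
  shows "N (a *\<^sub>v x) \<le> v (a $$ (i,i)) * N x"
proof -
  have "N (a *\<^sub>v x) \<le> N (a $$ (i,i) \<cdot>\<^sub>v x)"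
  proof (rule N_mono)
    fix j assume j: "j < d"
    show "v ((a *\<^sub>v x) $ j) \<le> v ((a $$ (i,i) \<cdot>\<^sub>v x) $ j)"
      using cartan_D(5)[OF c, of i j] x j
      by (cases "i \<le> j") (auto simp: cartan_D(6)[OF c x(1) j] v_mult mult_right_mono)
  qed (use x cartan_D(8)[OF c] in auto)
  then show ?thesis using N_smult[OF x(1), of "a $$ (i,i)"] x by simp
qed

lemma cartan_norm:
  assumes c: "cartan_decomposition v d g (k, a, l)" and x: "x \<in> carrier_vec d"
  shows "N (g *\<^sub>v x) = N (a *\<^sub>v (l *\<^sub>v x))" "N (l *\<^sub>v x) = N x" "l *\<^sub>v x \<in> carrier_vec d"
proof -
  show *: "l *\<^sub>v x \<in> carrier_vec d" using cartan_D(9)[OF c] x by auto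
  then have "a *\<^sub>v (l *\<^sub>v x) \<in> carrier_vec d" using cartan_D(8)[OF c] by auto
  then show "N (g *\<^sub>v x) = N (a *\<^sub>v (l *\<^sub>v x))" "N (l *\<^sub>v x) = N x"
    using isom_norm cartan_D(1,2)[OF c] cartan_D(11)[OF c x] x by auto
qed

lemma cartan_norm_ge:
  assumes c: "cartan_decomposition v d g (k, a, l)" and x: "x \<in> carrier_vec d" and i: "i < d"
    and "\<And>j. Suc i \<le> j \<Longrightarrow> j < d \<Longrightarrow> (l *\<^sub>v x) $ j = 0"
  shows "v (a $$ (i,i)) * N x \<le> N (g *\<^sub>v x)"
proof -
  have "l *\<^sub>v x \<in> coord_subspace d (Suc i)"
    unfolding coord_subspace_def using cartan_norm(3)[OF c x] assms(4) by blast
  from N_diag_ge[OF c this i] show ?thesis unfolding cartan_norm(1,2)[OF c x] .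
qed

lemma cartan_norm_le:
  assumes c: "cartan_decomposition v d g (k, a, l)" and x: "x \<in> carrier_vec d" and i: "i < d"
    and "\<And>j. j < i \<Longrightarrow> (l *\<^sub>v x) $ j = 0"
  shows "N (g *\<^sub>v x) \<le> v (a $$ (i,i)) * N x"
  using N_diag_le[OF c cartan_norm(3)[OF c x] assms(4) i] unfolding cartan_norm(1,2)[OF c x] .

lemma cartan_carrier: "cartan_decomposition v d g (k, a, l) \<Longrightarrow> g \<in> carrier_mat d d"
  using cartan_D(4,7,8,9)[of d g k a l] mult_carrier_mat by blast

lemma smult_mult_mat_vec:
  assumes "A \<in> carrier_mat d d" "B \<in> carrier_mat d d" "x \<in> carrier_vec d"
  shows "(s \<cdot>\<^sub>m (A * B)) *\<^sub>v x = s \<cdot>\<^sub>v (A *\<^sub>v (B *\<^sub>v x))"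
  using smult_mat_vec[OF mult_carrier_mat[OF assms(1,2)] assms(3), of s]
  unfolding assoc_mult_mat_vec[OF assms] .

text \<open>Two subspaces whose codimensions add up to less than d meet nontrivially. Each of them
  is given by the vanishing of selected coordinates of the image under a matrix.\<close>

lemma common_kernel_rows:
  assumes A: "(A :: 'k mat) \<in> carrier_mat d d" and B: "B \<in> carrier_mat d d"
    and P: "P \<subseteq> {..<d}" "Q \<subseteq> {..<d}" "card P + card Q < d"
  obtains x where "x \<in> carrier_vec d" "x \<noteq> 0\<^sub>v d" "\<And>j. j \<in> P \<Longrightarrow> (A *\<^sub>v x) $ j = 0" "\<And>j. j \<in> Q \<Longrightarrow> (B *\<^sub>v x) $ j = 0"
proof -
  have "finite P" "finite Q" using P finite_subset by blast+
  then obtain ps qs where l: "set ps = P" "distinct ps" "set qs = Q" "distinct qs"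
    using finite_distinct_list by metis
  define fs where "fs = map (row A) ps @ map (row B) qs"
  have len: "length fs < d" using P(3) l by (simp add: fs_def distinct_card[symmetric])
  have "set fs \<subseteq> carrier_vec d" using A B by (auto simp: fs_def)
  then have "fs ! m \<in> carrier_vec d" if "m < length fs" for m using nth_mem[OF that] by blast
  then obtain x where x: "x \<in> carrier_vec d" "x \<noteq> 0\<^sub>v d" "\<And>m. m < length fs \<Longrightarrow> fs ! m \<bullet> x = 0"
    using common_kernel_vec[OF len, of "\<lambda>m. fs ! m"] by blast
  then have "f \<bullet> x = 0" if "f \<in> set fs" for f using that by (metis in_set_conv_nth)
  then have "row A j \<bullet> x = 0" if "j \<in> P" for j using that l(1) by (simp add: fs_def)
  moreover have "row B j \<bullet> x = 0" if "j \<in> Q" for j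
    using that l(3) \<open>\<And>f. f \<in> set fs \<Longrightarrow> f \<bullet> x = 0\<close> by (simp add: fs_def)
  ultimately show ?thesis using that[OF x(1,2)] P(1,2) A B by (auto simp: subset_iff)
qed

text \<open>As in the Courant--Fischer principle, the two products are compared on a vector in the
  intersection of a subspace where the one is large and a subspace where the other is small.\<close>
lemma cartan_sv_ge:
  assumes c: "cartan_decomposition v d g (k, a, l)" and c': "cartan_decomposition v d g' (k', a', l')"
    and h: "h \<in> carrier_mat d d" and g': "g' = s \<cdot>\<^sub>m (g * h)"
    and H: "\<And>x. x \<in> carrier_vec d \<Longrightarrow> N x \<le> H * N (h *\<^sub>v x)" "0 \<le> H" and i: "i < d"
  shows "v s * v (a $$ (i,i)) \<le> H * v (a' $$ (i,i))"
proof -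
  have lh: "l * h \<in> carrier_mat d d" using cartan_D(9)[OF c] h by auto
  \<comment> \<open>There are i conditions that remove the large directions of \<open>g'\<close> and
    d - 1 - i that remove the small directions of \<open>g\<close>, altogether d - 1.\<close>
  obtain x where x: "x \<in> carrier_vec d" "x \<noteq> 0\<^sub>v d"
    and 1: "\<And>j. j < i \<Longrightarrow> (l' *\<^sub>v x) $ j = 0" and 2: "\<And>j. Suc i \<le> j \<Longrightarrow> j < d \<Longrightarrow> (l *\<^sub>v (h *\<^sub>v x)) $ j = 0"
    by (rule common_kernel_rows[OF cartan_D(9)[OF c'] lh, of "{..<i}" "{Suc i..<d}"])
      (use i in \<open>auto simp del: index_mult_mat_vec simp: assoc_mult_mat_vec[OF cartan_D(9)[OF c] h]\<close>)
  have hx: "h *\<^sub>v x \<in> carrier_vec d" using h x by auto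
  have g: "g \<in> carrier_mat d d" using cartan_carrier[OF c] .
  have "g' *\<^sub>v x = s \<cdot>\<^sub>v (g *\<^sub>v (h *\<^sub>v x))"
    unfolding g' by (rule smult_mult_mat_vec[OF g h x(1)])
  then have "N (g' *\<^sub>v x) = v s * N (g *\<^sub>v (h *\<^sub>v x))" using N_smult[OF mult_mat_vec_carrier[OF g hx], of s] i by simp
  moreover have "v (a $$ (i,i)) * N (h *\<^sub>v x) \<le> N (g *\<^sub>v (h *\<^sub>v x))"
    by (rule cartan_norm_ge[OF c hx i 2])
  moreover have "N (g' *\<^sub>v x) \<le> v (a' $$ (i,i)) * N x"
    by (rule cartan_norm_le[OF c' x(1) i 1])
  ultimately have *: "v s * (v (a $$ (i,i)) * N (h *\<^sub>v x)) \<le> v (a' $$ (i,i)) * N x"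
    using mult_left_mono[of "v (a $$ (i,i)) * N (h *\<^sub>v x)" "N (g *\<^sub>v (h *\<^sub>v x))" "v s"] by (metis order_trans v_nonneg)
  have "v s * v (a $$ (i,i)) * N x \<le> v s * v (a $$ (i,i)) * (H * N (h *\<^sub>v x))"
    using H(1)[OF x(1)] by (auto intro!: mult_left_mono)
  also have "\<dots> = H * (v s * (v (a $$ (i,i)) * N (h *\<^sub>v x)))" by simp
  also have "\<dots> \<le> H * (v (a' $$ (i,i)) * N x)" using * H(2) by (rule mult_left_mono)
  finally have "v s * v (a $$ (i,i)) * N x \<le> H * v (a' $$ (i,i)) * N x" by (simp add: mult.assoc)
  moreover have "0 < N x" using N_pos x i by auto
  ultimately show ?thesis by simp
qed

text \<open>Reversal of the order of singular values under inversion, with a scalar s because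
  everything lives in the projective group. For each inequality the conditions on the two factors
  number i and d - 1 - i, so a nonzero test vector remains.\<close>

lemma cartan_sv_inverse:
  assumes c: "cartan_decomposition v d g (k, a, l)" and c': "cartan_decomposition v d g' (k', a', l')"
    and g': "g' * g = s \<cdot>\<^sub>m 1\<^sub>m d" and i: "i < d"
  shows "v (a' $$ (i,i)) * v (a $$ (d - 1 - i, d - 1 - i)) = v s"
proof -
  have g: "g \<in> carrier_mat d d" using cartan_carrier[OF c] .
  have g'c: "g' \<in> carrier_mat d d" using cartan_carrier[OF c'] .
  have lg: "l' * g \<in> carrier_mat d d" using cartan_D(9)[OF c'] g by auto
  let ?i = "d - 1 - i"
  have gg: "N (g' *\<^sub>v (g *\<^sub>v x)) = v s * N x" "g *\<^sub>v x \<in> carrier_vec d" if "x \<in> carrier_vec d" for x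
  proof -
    show "g *\<^sub>v x \<in> carrier_vec d" using g that by auto
    have "g' *\<^sub>v (g *\<^sub>v x) = (s \<cdot>\<^sub>m 1\<^sub>m d) *\<^sub>v x"
      unfolding g'[symmetric] by (rule assoc_mult_mat_vec[OF g'c g that, symmetric])
    also have "\<dots> = s \<cdot>\<^sub>v (1\<^sub>m d *\<^sub>v x)" by (rule smult_mat_vec[OF one_carrier_mat that])
    finally have "g' *\<^sub>v (g *\<^sub>v x) = s \<cdot>\<^sub>v x" unfolding one_mult_mat_vec[OF that] .
    then show "N (g' *\<^sub>v (g *\<^sub>v x)) = v s * N x" using N_smult[OF that, of s] i by simp
  qed
  note l = cartan_D(9)[OF c] and l' = cartan_D(9)[OF c']
  show ?thesis
  proof (rule antisym)
    obtain x where x: "x \<in> carrier_vec d" "x \<noteq> 0\<^sub>v d"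
      and 1: "\<And>j. Suc ?i \<le> j \<Longrightarrow> j < d \<Longrightarrow> (l *\<^sub>v x) $ j = 0"
      and 2: "\<And>j. Suc i \<le> j \<Longrightarrow> j < d \<Longrightarrow> (l' *\<^sub>v (g *\<^sub>v x)) $ j = 0"
      by (rule common_kernel_rows[OF l lg, of "{Suc ?i..<d}" "{Suc i..<d}"])
        (use i in \<open>auto simp del: index_mult_mat_vec simp: assoc_mult_mat_vec[OF l' g]\<close>)
    have "v (a $$ (?i,?i)) * N x \<le> N (g *\<^sub>v x)"
      by (rule cartan_norm_ge[OF c x(1) _ 1]) (use i in auto)
    moreover have "v (a' $$ (i,i)) * N (g *\<^sub>v x) \<le> v s * N x"
      using cartan_norm_ge[OF c' gg(2)[OF x(1)] i 2] unfolding gg(1)[OF x(1)] .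
    ultimately have "v (a' $$ (i,i)) * (v (a $$ (?i,?i)) * N x) \<le> v s * N x"
      using mult_left_chain_le v_nonneg by blast
    moreover have "0 < N x" using N_pos x i by auto
    ultimately show "v (a' $$ (i,i)) * v (a $$ (?i,?i)) \<le> v s" by (simp add: mult.assoc[symmetric])
  next
    obtain x where x: "x \<in> carrier_vec d" "x \<noteq> 0\<^sub>v d"
      and 1: "\<And>j. j < ?i \<Longrightarrow> (l *\<^sub>v x) $ j = 0" and 2: "\<And>j. j < i \<Longrightarrow> (l' *\<^sub>v (g *\<^sub>v x)) $ j = 0"
      by (rule common_kernel_rows[OF l lg, of "{..<?i}" "{..<i}"])
        (use i in \<open>auto simp del: index_mult_mat_vec simp: assoc_mult_mat_vec[OF l' g]\<close>)
    have "N (g *\<^sub>v x) \<le> v (a $$ (?i,?i)) * N x"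
      by (rule cartan_norm_le[OF c x(1) _ 1]) (use i in auto)
    moreover have "v s * N x \<le> v (a' $$ (i,i)) * N (g *\<^sub>v x)"
      using cartan_norm_le[OF c' gg(2)[OF x(1)] i 2] unfolding gg(1)[OF x(1)] .
    ultimately have "v s * N x \<le> v (a' $$ (i,i)) * (v (a $$ (?i,?i)) * N x)"
      using mult_left_chain_ge v_nonneg by blast
    moreover have "0 < N x" using N_pos x i by auto
    ultimately show "v s \<le> v (a' $$ (i,i)) * v (a $$ (?i,?i))" by (simp add: mult.assoc[symmetric])
  qed
qed

lemma isom_image_carrier: "k \<in> carrier_mat d d \<Longrightarrow> (*\<^sub>v) k ` coord_subspace d p \<subseteq> carrier_vec d"
  by (auto simp: coord_subspace_def)

text \<open>The estimate behind the limit maps: \<open>H\<close> bounds the inverse of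
  \<open>h\<close> and \<open>H'\<close> bounds \<open>h\<close> itself. A vector of the dominant
  subspace of \<open>g'\<close> is the image under \<open>g\<close> of something not too long,
  because \<open>g'\<close> stretches its preimage by at least its p-th singular value. Dropping the
  components of this image beyond the first p directions of \<open>g\<close> costs at most the next
  singular value of \<open>g\<close>. With indices starting at 0, \<open>a $$ (p,p)\<close> is the
  singular value number p + 1.\<close>

lemma cartan_near:
  assumes c: "cartan_decomposition v d g (k, a, l)" and c': "cartan_decomposition v d g' (k', a', l')"
    and h: "h \<in> carrier_mat d d" and g': "g' = s \<cdot>\<^sub>m (g * h)" "s \<noteq> 0"
    and H: "\<And>x. x \<in> carrier_vec d \<Longrightarrow> N x \<le> H * N (h *\<^sub>v x)" "0 \<le> H"
    and H': "\<And>x. x \<in> carrier_vec d \<Longrightarrow> N (h *\<^sub>v x) \<le> H' * N x" "0 \<le> H'"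
    and p: "0 < p" "p < d"
  shows "near (H * H' * (v (a $$ (p,p)) / v (a $$ (p-1,p-1)))) ((*\<^sub>v) k' ` coord_subspace d p) ((*\<^sub>v) k ` coord_subspace d p)"
  unfolding near_def
proof
  fix u assume "u \<in> (*\<^sub>v) k' ` coord_subspace d p"
  then obtain x where x: "x \<in> coord_subspace d p" "u = k' *\<^sub>v x" by auto
  have d: "0 < d" using p by simp
  note D = cartan_D[OF c] and D' = cartan_D[OF c']
  have xc: "x \<in> carrier_vec d" using x by (simp add: coord_subspace_def)
  have Nu: "N u = N x" using x isom_norm[OF D'(1) xc] by simp
  \<comment> \<open>The preimage of \<open>x\<close> under \<open>a'\<close>. It is again supported
    on the first p coordinates, which bounds its norm by that of \<open>u\<close> divided by the
    p-th singular value of \<open>g'\<close>.\<close>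
  define y where "y = vec d (\<lambda>i. x $ i / a' $$ (i,i))"
  have y: "y \<in> carrier_vec d" "y \<in> coord_subspace d p" using x by (auto simp: y_def coord_subspace_def)
  have ay: "a' *\<^sub>v y = x"
  proof (rule eq_vecI)
    fix i assume "i < dim_vec x"
    then have i: "i < d" using xc by auto
    show "(a' *\<^sub>v y) $ i = x $ i" unfolding D'(6)[OF y(1) i] using D'(10)[OF i] i by (simp add: y_def)
  qed (use xc D'(8) in auto)
  have Ny: "v (a' $$ (p-1,p-1)) * N y \<le> N x"
    using N_diag_ge[OF c', of y "p - 1"] y p ay by simp
  obtain l'' where l'': "l'' \<in> isoms d" "l' * l'' = 1\<^sub>m d" using isom_inverse[OF D'(2)] by metis
  have ly: "l'' *\<^sub>v y \<in> carrier_vec d" using isom_carrier[OF l''(1)] y by auto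
  have g: "g \<in> carrier_mat d d" using cartan_carrier[OF c] .
  define z where "z = h *\<^sub>v (l'' *\<^sub>v y)"
  have z: "z \<in> carrier_vec d" unfolding z_def using h ly by auto
  have Nz: "N z \<le> H' * N y" unfolding z_def using H'(1)[OF ly] isom_norm[OF l''(1) y(1)] by simp
  define t where "t = l *\<^sub>v z"
  have t: "t \<in> carrier_vec d" "N t = N z" unfolding t_def using cartan_norm[OF c z] by auto
  have "u = k' *\<^sub>v (a' *\<^sub>v (l' *\<^sub>v (l'' *\<^sub>v y)))"
    unfolding x(2) inverse_mult_vec[OF l''(2) D'(9) isom_carrier[OF l''(1)] y(1)] ay ..
  also have "\<dots> = g' *\<^sub>v (l'' *\<^sub>v y)" using D'(11)[OF ly] by simp
  also have "\<dots> = s \<cdot>\<^sub>v (g *\<^sub>v z)"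
    unfolding g' z_def by (rule smult_mult_mat_vec[OF g h ly])
  also have "\<dots> = s \<cdot>\<^sub>v (k *\<^sub>v (a *\<^sub>v t))" using D(11)[OF z] by (simp add: t_def)
  finally have u: "u = s \<cdot>\<^sub>v (k *\<^sub>v (a *\<^sub>v t))" .
  have at: "a *\<^sub>v t \<in> carrier_vec d" using D(8) t by auto
  define q where "q = s \<cdot>\<^sub>v (a *\<^sub>v t)"
  have q: "q \<in> carrier_vec d" using at by (simp add: q_def)
  have uq: "u = k *\<^sub>v q" unfolding u q_def using mult_mat_vec[OF D(7) at] by simp
  \<comment> \<open>The candidate near \<open>u\<close> is the truncation of \<open>u\<close> in the
    basis given by \<open>k\<close>. The discarded part is \<open>s\<close> times the image under
    \<open>a\<close> of a vector without the first p coordinates.\<close>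
  define q1 where "q1 = vec d (\<lambda>i. if i < p then q $ i else 0)"
  define t2 where "t2 = vec d (\<lambda>i. if i < p then 0 else t $ i)"
  have q1: "q1 \<in> coord_subspace d p" "q1 \<in> carrier_vec d" by (auto simp: q1_def coord_subspace_def)
  have t2: "t2 \<in> carrier_vec d" by (simp add: t2_def)
  have qq: "q - q1 = s \<cdot>\<^sub>v (a *\<^sub>v t2)"
    by (rule eq_vecI) (use q q1 at t t2 D(8) in \<open>auto simp: q_def q1_def t2_def D(6)[OF t(1)] D(6)[OF t2, unfolded t2_def] simp del: index_mult_mat_vec\<close>)
  have at2: "a *\<^sub>v t2 \<in> carrier_vec d" using D(8) t2 by auto
  have w: "k *\<^sub>v q1 \<in> (*\<^sub>v) k ` coord_subspace d p" using q1 by auto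
  have "N q1 \<le> N q" by (rule N_mono[OF q1(2) q d]) (auto simp: q1_def)
  then have 1: "N (k *\<^sub>v q1) \<le> N u" unfolding uq using isom_norm[OF D(1)] q1 q by simp
  have "N (u - k *\<^sub>v q1) = N (q - q1)"
    unfolding uq using mult_minus_distrib_mat_vec[OF D(7) q q1(2)] isom_norm[OF D(1), of "q - q1"] q q1 by simp
  also have "\<dots> = v s * N (a *\<^sub>v t2)" unfolding qq using N_smult[OF at2 d] .
  also have "\<dots> \<le> v s * (v (a $$ (p,p)) * N t2)"
    by (intro mult_left_mono N_diag_le[OF c t2]) (use p in \<open>auto simp: t2_def\<close>)
  also have "\<dots> \<le> v s * (v (a $$ (p,p)) * (H' * N y))"
  proof -
    have "N t2 \<le> N t" by (rule N_mono[OF t2 t(1) d]) (auto simp: t2_def)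
    then show ?thesis using t(2) Nz by (intro mult_left_mono) auto
  qed
  also have "\<dots> \<le> H * H' * (v (a $$ (p,p)) / v (a $$ (p-1,p-1))) * N u"
  proof -
    \<comment> \<open>The scalar \<open>s\<close> disappears here: \<open>cartan_sv_ge\<close>
      bounds |s| times the p-th singular value of \<open>g\<close> by \<open>H\<close> times that of
      \<open>g'\<close>.\<close>
    let ?m = "v (a $$ (p-1,p-1))" and ?m' = "v (a' $$ (p-1,p-1))"
    have pos: "0 < ?m" using D(10)[of "p - 1"] p by simp
    have sv: "v s * ?m \<le> H * ?m'" using cartan_sv_ge[OF c c' h g'(1) H, of "p - 1"] p by simp
    have "v s * ?m * N y \<le> H * ?m' * N y" using sv N_nonneg[OF y(1) d] by (rule mult_right_mono)
    also have "\<dots> \<le> H * N u" unfolding mult.assoc Nu using Ny H(2) by (rule mult_left_mono)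
    finally have "v s * N y \<le> H * N u / ?m" using pos by (simp add: field_simps)
    then have "(v (a $$ (p,p)) * H') * (v s * N y) \<le> (v (a $$ (p,p)) * H') * (H * N u / ?m)"
      using H'(2) by (intro mult_left_mono) auto
    then show ?thesis by (simp add: mult_ac)
  qed
  finally show "\<exists>w\<in>(*\<^sub>v) k ` coord_subspace d p. N w \<le> N u \<and>
      N (u - w) \<le> H * H' * (v (a $$ (p,p)) / v (a $$ (p-1,p-1))) * N u"
    using w 1 by blast
qed

end

section \<open>Convergence in Grassmannians\<close>

lemma (in vec_space) subspace_basis:
  assumes "subspace class_ring W V"
  shows "\<exists>B. finite B \<and> B \<subseteq> W \<and> lin_indpt B \<and> span B = W \<and> card B = vectorspace.dim class_ring (vs W)"
proof -
  interpret W: vectorspace class_ring "vs W" using subspace_is_vs[OF assms] .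
  have sub: "submodule class_ring W V" using assms by (simp add: subspace_def)
  have W: "W \<subseteq> carrier V" using sub by (simp add: submodule_def)
  have li: "W.lin_indpt S = lin_indpt S" "W.span S = span S" if "S \<subseteq> W" for S
    using span_li_not_depend[OF that sub] by auto
  have "\<exists>A. finite A \<and> maximal A (\<lambda>S. S \<subseteq> carrier (vs W) \<and> W.lin_indpt S)"
  proof (rule maximal_exists)
    fix A assume "A \<subseteq> carrier (vs W) \<and> W.lin_indpt A"
    then have "A \<subseteq> carrier V" "lin_indpt A" using li W by auto
    then show "finite A \<and> card A \<le> dim" using li_le_dim[OF fin_dim] by auto
  next
    have "lin_indpt {}" unfolding lin_dep_def by auto
    then show "{} \<subseteq> carrier (vs W) \<and> W.lin_indpt {}" using li[of "{}"] by auto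
  qed
  then obtain B where B: "finite B" "maximal B (\<lambda>S. S \<subseteq> carrier (vs W) \<and> W.lin_indpt S)" by auto
  then have ba: "W.basis B" using W.max_li_is_basis by blast
  then have "B \<subseteq> W" unfolding W.basis_def by auto
  then show ?thesis using ba W.dim_basis[OF B(1) ba] li[of B] B(1) unfolding W.basis_def by auto
qed

text \<open>A basis of the smaller space is independent in the larger one and has the right
  cardinality. Thanks to this, identifying two limits requires only one inclusion.\<close>

lemma Grass_subset_eq:
  assumes "W \<in> Grass n p" "W' \<in> Grass n p" "W \<subseteq> (W' :: 'k::field vec set)"
  shows "W = W'"
proof -
  interpret vec_space "TYPE('k)" n .
  have s: "subspace class_ring W V" "subspace class_ring W' V"
    and dim: "vectorspace.dim class_ring (vs W) = p" "vectorspace.dim class_ring (vs W') = p"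
    using assms(1,2) by (auto simp: Grass_def)
  obtain B where B: "finite B" "B \<subseteq> W" "lin_indpt B" "span B = W" "card B = p"
    using subspace_basis[OF s(1)] dim by auto
  obtain C where C: "finite C" "C \<subseteq> W'" "lin_indpt C" "span C = W'" "card C = p"
    using subspace_basis[OF s(2)] dim by auto
  interpret W': vectorspace class_ring "vs W'" using subspace_is_vs[OF s(2)] .
  have sub: "submodule class_ring W' V" using s by (simp add: subspace_def)
  have BW: "B \<subseteq> W'" using B assms(3) by auto
  have "W'.fin_dim" unfolding W'.fin_dim_def
    using C span_li_not_depend(1)[OF C(2) sub] by (intro exI[of _ C]) auto
  then have "W'.basis B"
    by (rule W'.dim_li_is_basis) (use B BW dim span_li_not_depend(2)[OF BW sub] in auto)
  then have "W'.span B = W'" unfolding W'.basis_def by simp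
  then show ?thesis using span_li_not_depend(1)[OF BW sub] B(4) by simp
qed

lemma rank_inj:
  assumes A: "(A :: 'k::field mat) \<in> carrier_mat n p"
    and inj: "\<And>x. x \<in> carrier_vec p \<Longrightarrow> A *\<^sub>v x = 0\<^sub>v n \<Longrightarrow> x = 0\<^sub>v p"
  shows "vec_space.rank n A = p"
proof -
  interpret vec_space "TYPE('k)" n .
  have d: "distinct (cols A)"
  proof (rule ccontr)
    assume "\<not> distinct (cols A)"
    then obtain i j where ij: "i < p" "j < p" "i \<noteq> j" "col A i = col A j"
      using A by (auto simp: distinct_conv_nth)
    let ?x = "unit_vec p i - unit_vec p j :: 'k vec"
    have "A *\<^sub>v ?x = A *\<^sub>v unit_vec p i - A *\<^sub>v unit_vec p j"
      by (rule mult_minus_distrib_mat_vec[OF A]) auto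
    moreover have "A *\<^sub>v unit_vec p m = col A m" if "m < p" for m
      using that A by (intro eq_vecI) auto
    ultimately have "A *\<^sub>v ?x = col A j - col A j" using ij by metis
    moreover have "col A j \<in> carrier_vec n" using A by auto
    ultimately have "A *\<^sub>v ?x = 0\<^sub>v n" by simp
    then have "?x = 0\<^sub>v p" using inj by auto
    then have "?x $ i = 0" using ij by simp
    then show False using ij by simp
  qed
  have "lin_indpt (set (cols A))"
  proof
    assume "lin_dep (set (cols A))"
    then obtain x where "x \<in> carrier_vec p" "x \<noteq> 0\<^sub>v p" "A *\<^sub>v x = 0\<^sub>v n" using lin_depE[OF A _ d] by metis
    then show False using inj by auto
  qed
  then show ?thesis using lin_indpt_full_rank[OF A d] by simp
qed

lemma col_space_Grass:
  assumes A: "(A :: 'k::field mat) \<in> carrier_mat n p"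
  shows "vec_space.col_space n A \<in> Grass n (vec_space.rank n A)"
proof -
  interpret vec_space "TYPE('k)" n .
  have c: "set (cols A) \<subseteq> carrier_vec n" using cols_dim[of A] carrier_matD(1)[OF A] by simp
  show ?thesis unfolding Grass_def rank_def col_space_def mem_Collect_eq using span_is_subspace[OF c] by simp
qed

lemma Grass_carrier: "W \<in> Grass n p \<Longrightarrow> (W :: 'k::field vec set) \<subseteq> carrier_vec n"
  by (auto simp: Grass_def subspace_def submodule_def module_vec_def)

text \<open>The first p columns of \<open>k\<close>. Through these frames convergence of isometries
  reaches the quotient topology on the Grassmannian.\<close>

definition frame :: "nat \<Rightarrow> nat \<Rightarrow> 'k mat \<Rightarrow> 'k mat" where
  "frame d p k = mat d p (\<lambda>ij. k $$ ij)"

lemma frame_carrier [simp]: "frame d p k \<in> carrier_mat d p"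
  by (simp add: frame_def)

lemma frame_mult:
  assumes "(k :: 'k::field mat) \<in> carrier_mat d d" "p \<le> d" "y \<in> carrier_vec p"
  shows "frame d p k *\<^sub>v y = k *\<^sub>v vec d (\<lambda>i. if i < p then y $ i else 0)"
proof (rule eq_vecI)
  fix i assume "i < dim_vec (k *\<^sub>v vec d (\<lambda>i. if i < p then y $ i else 0))"
  then have i: "i < d" using assms by auto
  have "(frame d p k *\<^sub>v y) $ i = (\<Sum>j<p. k $$ (i,j) * y $ j)"
    using assms i by (auto simp: scalar_prod_def frame_def atLeast0LessThan intro!: sum.cong)
  also have "\<dots> = (\<Sum>j<d. k $$ (i,j) * (if j < p then y $ j else 0))"
    using assms(2) by (intro sum.mono_neutral_cong_left) auto
  also have "\<dots> = (k *\<^sub>v vec d (\<lambda>i. if i < p then y $ i else 0)) $ i"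
    using assms i by (auto simp: scalar_prod_def atLeast0LessThan intro!: sum.cong)
  finally show "(frame d p k *\<^sub>v y) $ i = (k *\<^sub>v vec d (\<lambda>i. if i < p then y $ i else 0)) $ i" .
qed (use assms in \<open>auto simp: frame_def\<close>)

lemma frame_col_space:
  assumes "(k :: 'k::field mat) \<in> carrier_mat d d" "p \<le> d"
  shows "vec_space.col_space d (frame d p k) = (*\<^sub>v) k ` coord_subspace d p"
proof -
  have "y \<in> vec_space.col_space d (frame d p k) \<longleftrightarrow> (\<exists>x\<in>carrier_vec p. frame d p k *\<^sub>v x = y)" for y
    using vec_space.col_space_eq[OF frame_carrier, of d p k] mult_mat_vec_carrier[OF frame_carrier[of d p k]]
    by (auto simp: frame_def)
  moreover have "(\<exists>x\<in>carrier_vec p. frame d p k *\<^sub>v x = y) \<longleftrightarrow> y \<in> (*\<^sub>v) k ` coord_subspace d p" for y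
  proof
    assume "\<exists>x\<in>carrier_vec p. frame d p k *\<^sub>v x = y"
    then show "y \<in> (*\<^sub>v) k ` coord_subspace d p"
      using frame_mult[OF assms] by (force simp: coord_subspace_def)
  next
    assume "y \<in> (*\<^sub>v) k ` coord_subspace d p"
    then obtain x where x: "x \<in> coord_subspace d p" "y = k *\<^sub>v x" by auto
    have "vec d (\<lambda>i. if i < p then vec p (($) x) $ i else 0) = x"
      using x assms by (intro eq_vecI) (auto simp: coord_subspace_def)
    then show "\<exists>x\<in>carrier_vec p. frame d p k *\<^sub>v x = y"
      using frame_mult[OF assms, of "vec p (($) x)"] x by (intro bexI[of _ "vec p (($) x)"]) auto
  qed
  ultimately show ?thesis by blast
qed

lemma frame_rank:
  assumes "(k :: 'k::field mat) \<in> carrier (GL d)" "p \<le> d"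
  shows "vec_space.rank d (frame d p k) = p"
proof (rule rank_inj)
  fix x :: "'k vec" assume x: "x \<in> carrier_vec p" "frame d p k *\<^sub>v x = 0\<^sub>v d"
  have "k \<in> carrier_mat d d" using assms by simp
  then have "vec d (\<lambda>i. if i < p then x $ i else 0) = 0\<^sub>v d"
    using GL_inj[OF assms(1)] frame_mult[OF _ assms(2) x(1), of k] x(2) by simp
  then have "x $ i = 0" if "i < p" for i
  proof -
    have i: "i < d" using that assms(2) by simp
    have "vec d (\<lambda>i. if i < p then x $ i else 0) $ i = 0\<^sub>v d $ i"
      unfolding \<open>vec d (\<lambda>i. if i < p then x $ i else 0) = 0\<^sub>v d\<close> ..
    then show ?thesis using that i by simp
  qed
  then show "x = 0\<^sub>v p" using x(1) by (intro eq_vecI) auto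
qed simp

lemma image_coord_Grass:
  assumes "(k :: 'k::field mat) \<in> carrier (GL d)" "p \<le> d"
  shows "(*\<^sub>v) k ` coord_subspace d p \<in> Grass d p"
  using col_space_Grass[OF frame_carrier, of d p k] frame_rank[OF assms] frame_col_space[of k d p] assms by simp

context local_field_abs begin

section \<open>Topology of matrices, frames and Grassmannians\<close>

abbreviation "mat_dist n m \<equiv> (\<lambda>A B :: 'k mat. \<Sum>i<n. \<Sum>j<m. v (A $$ (i,j) - B $$ (i,j)))"

lemma mat_metric: "Metric_space (carrier_mat n m) (mat_dist n m)"
proof
  fix A B C :: "'k mat"
  show "0 \<le> (\<Sum>i<n. \<Sum>j<m. v (A $$ (i,j) - B $$ (i,j)))" by (auto intro!: sum_nonneg)
  show "(\<Sum>i<n. \<Sum>j<m. v (A $$ (i,j) - B $$ (i,j))) = (\<Sum>i<n. \<Sum>j<m. v (B $$ (i,j) - A $$ (i,j)))"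
    by (intro sum.cong refl v_diff_commute)
  show "(\<Sum>i<n. \<Sum>j<m. v (A $$ (i,j) - B $$ (i,j))) = 0 \<longleftrightarrow> A = B"
    if "A \<in> carrier_mat n m" "B \<in> carrier_mat n m"
  proof
    assume 0: "(\<Sum>i<n. \<Sum>j<m. v (A $$ (i,j) - B $$ (i,j))) = 0"
    have "A $$ (i,j) = B $$ (i,j)" if "i < n" "j < m" for i j
    proof -
      have "(\<Sum>j<m. v (A $$ (i,j) - B $$ (i,j))) = 0"
        using sum_nonneg_0[OF finite_lessThan _ 0, of i] that by (simp add: sum_nonneg)
      then have "v (A $$ (i,j) - B $$ (i,j)) = 0"
        using sum_nonneg_0[OF finite_lessThan, of m "\<lambda>j. v (A $$ (i,j) - B $$ (i,j))" j] that by simp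
      then show ?thesis by simp
    qed
    then show "A = B" using that by (intro eq_matI) auto
  qed simp
  have "v (A $$ ij - C $$ ij) \<le> v (A $$ ij - B $$ ij) + v (B $$ ij - C $$ ij)" for ij
    using v_triangle[of "A $$ ij - B $$ ij" "B $$ ij - C $$ ij"] by simp
  then show "(\<Sum>i<n. \<Sum>j<m. v (A $$ (i,j) - C $$ (i,j))) \<le>
      (\<Sum>i<n. \<Sum>j<m. v (A $$ (i,j) - B $$ (i,j))) + (\<Sum>i<n. \<Sum>j<m. v (B $$ (i,j) - C $$ (i,j)))"
    unfolding sum.distrib[symmetric] by (intro sum_mono) auto
qed

lemma mat_dist_mnorm:
  assumes "A \<in> carrier_mat n m" "B \<in> carrier_mat n m"
  shows "(\<Sum>i<n. \<Sum>j<m. v (A $$ (i,j) - B $$ (i,j))) = mnorm n m (A - B)"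
  unfolding mnorm_def using assms by (intro sum.cong) auto

lemma topspace_mat [simp]: "topspace (mat_topology v n m) = carrier_mat n m"
  unfolding mat_topology_def by (rule Metric_space.topspace_mtopology[OF mat_metric])

lemma openin_mat_topology:
  "openin (mat_topology v n m) U \<longleftrightarrow>
    U \<subseteq> carrier_mat n m \<and> (\<forall>A\<in>U. \<exists>r>0. \<forall>B\<in>carrier_mat n m. mnorm n m (A - B) < r \<longrightarrow> B \<in> U)"
  unfolding mat_topology_def Metric_space.openin_mtopology[OF mat_metric]
proof (rule conj_cong[OF refl])
  assume U: "U \<subseteq> carrier_mat n m"
  have eq: "(Metric_space.mball (carrier_mat n m) (mat_dist n m) A r \<subseteq> U)
    \<longleftrightarrow> (\<forall>B\<in>carrier_mat n m. mnorm n m (A - B) < r \<longrightarrow> B \<in> U)" if "A \<in> U" for A r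
  proof -
    have A: "A \<in> carrier_mat n m" using that U by blast
    have m: "B \<in> Metric_space.mball (carrier_mat n m) (mat_dist n m) A r \<longleftrightarrow>
        B \<in> carrier_mat n m \<and> mnorm n m (A - B) < r" for B
      unfolding Metric_space.in_mball[OF mat_metric] using A
      by (cases "B \<in> carrier_mat n m") (simp_all only: mat_dist_mnorm[OF A] simp_thms)
    have "Metric_space.mball (carrier_mat n m) (mat_dist n m) A r
        = {B \<in> carrier_mat n m. mnorm n m (A - B) < r}" by (rule Set.set_eqI) (simp only: m mem_Collect_eq)
    then show ?thesis by (simp only: subset_iff mem_Collect_eq Ball_def) blast
  qed
  show "(\<forall>A. A \<in> U \<longrightarrow> (\<exists>r>0. Metric_space.mball (carrier_mat n m) (mat_dist n m) A r \<subseteq> U))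
     = (\<forall>A\<in>U. \<exists>r>0. \<forall>B\<in>carrier_mat n m. mnorm n m (A - B) < r \<longrightarrow> B \<in> U)"
    unfolding Ball_def[of U] by (intro all_cong1 imp_cong refl ex_cong1 conj_cong eq)
qed

lemma limitin_mat_topology:
  assumes "\<And>t. A t \<in> carrier_mat n m" "L \<in> carrier_mat n m" "(\<lambda>t. mnorm n m (A t - L)) \<longlonglongrightarrow> 0"
  shows "limitin (mat_topology v n m) A L sequentially"
  unfolding mat_topology_def Metric_space.limitin_metric[OF mat_metric]
proof (intro conjI allI impI assms)
  fix \<epsilon> :: real assume "0 < \<epsilon>"
  from order_tendstoD(2)[OF assms(3) this]
  show "\<forall>\<^sub>F t in sequentially. A t \<in> carrier_mat n m \<and> (\<Sum>i<n. \<Sum>j<m. v (A t $$ (i,j) - L $$ (i,j))) < \<epsilon>"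
    unfolding mat_dist_mnorm[OF assms(1,2)] using assms(1) by (auto elim: eventually_mono)
qed

abbreviation "frame_space n p \<equiv> subtopology (mat_topology v n p) {A \<in> carrier_mat n p. vec_space.rank n A = p}"

lemma topspace_frame_space [simp]: "topspace (frame_space n p) = {A \<in> carrier_mat n p. vec_space.rank n A = p}"
  by auto

lemma openin_grass:
  "openin (grass_topology v n p) U \<longleftrightarrow> U \<subseteq> Grass n p \<and>
     openin (frame_space n p) {A \<in> carrier_mat n p. vec_space.rank n A = p \<and> vec_space.col_space n A \<in> U}"
  unfolding grass_topology_def openin_quotient_topology topspace_frame_space by (simp add: conj_assoc)

lemma topspace_grass [simp]: "topspace (grass_topology v n p) = Grass n p"
proof -
  have e: "{A \<in> carrier_mat n p. vec_space.rank n A = p \<and> vec_space.col_space n A \<in> Grass n p}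
      = topspace (frame_space n p)"
    unfolding topspace_frame_space using col_space_Grass[of _ n p] by (intro Collect_cong) auto
  have "openin (grass_topology v n p) (Grass n p)"
    unfolding openin_grass e by (simp only: openin_topspace order_refl simp_thms)
  moreover have "topspace (grass_topology v n p) \<subseteq> Grass n p"
    using openin_topspace[of "grass_topology v n p"] openin_grass[of n p "topspace (grass_topology v n p)"] by simp
  ultimately show ?thesis using openin_subset subset_antisym by metis
qed

lemma continuous_col_space: "continuous_map (frame_space n p) (grass_topology v n p) (vec_space.col_space n)"
  unfolding continuous_map_def
proof (intro conjI allI impI)
  show "vec_space.col_space n \<in> topspace (frame_space n p) \<rightarrow> topspace (grass_topology v n p)"
  proof
    fix A :: "'k mat" assume "A \<in> topspace (frame_space n p)"
    then have "A \<in> carrier_mat n p" "vec_space.rank n A = p" unfolding topspace_frame_space by auto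
    then show "vec_space.col_space n A \<in> topspace (grass_topology v n p)"
      unfolding topspace_grass using col_space_Grass[of A n p] by simp
  qed
  show "openin (frame_space n p) {x \<in> topspace (frame_space n p). vec_space.col_space n x \<in> U}"
    if "openin (grass_topology v n p) U" for U
    using that unfolding openin_grass topspace_frame_space by (simp add: conj_assoc)
qed

abbreviation "span_of d p k \<equiv> (*\<^sub>v) k ` coord_subspace d p"

lemma isom_mult_carrier: "k \<in> isoms d \<Longrightarrow> x \<in> carrier_vec d \<Longrightarrow> k *\<^sub>v x \<in> carrier_vec d"
  using isom_carrier mult_mat_vec_carrier by blast

lemma isom_span_Grass: "k \<in> isoms d \<Longrightarrow> p \<le> d \<Longrightarrow> span_of d p k \<in> Grass d p"
  using image_coord_Grass isom_GL by blast

lemma limitin_span_of: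
  assumes k: "\<And>t. k t \<in> isoms d" "l \<in> isoms d" "(\<lambda>t. mnorm d d (k t - l)) \<longlonglongrightarrow> 0" and p: "p \<le> d"
  shows "limitin (grass_topology v d p) (\<lambda>t. span_of d p (k t)) (span_of d p l) sequentially"
proof -
  have c: "k t \<in> carrier_mat d d" "l \<in> carrier_mat d d" for t using k isom_carrier by auto
  have le: "mnorm d p (frame d p (k t) - frame d p l) \<le> mnorm d d (k t - l)" for t
  proof -
    have "mnorm d p (frame d p (k t) - frame d p l) = (\<Sum>i<d. \<Sum>j<p. v ((k t - l) $$ (i,j)))"
      unfolding mnorm_def by (intro sum.cong refl) (use p c in \<open>auto simp: frame_def\<close>)
    also have "\<dots> \<le> mnorm d d (k t - l)"
      unfolding mnorm_def by (intro sum_mono sum_mono2) (use p in auto)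
    finally show ?thesis .
  qed
  have "(\<lambda>t. mnorm d p (frame d p (k t) - frame d p l)) \<longlonglongrightarrow> 0"
    by (rule tendsto_sandwich[OF _ _ tendsto_const k(3)]) (use le mnorm_nonneg in auto)
  then have "limitin (mat_topology v d p) (\<lambda>t. frame d p (k t)) (frame d p l) sequentially"
    by (intro limitin_mat_topology) auto
  then have "limitin (frame_space d p) (\<lambda>t. frame d p (k t)) (frame d p l) sequentially"
    unfolding limitin_subtopology using frame_rank[OF isom_GL] k p by auto
  from continuous_map_limit[OF continuous_col_space this]
  show ?thesis using frame_col_space[OF c(1) p] frame_col_space[OF c(2) p] by (simp add: comp_def)
qed

text \<open>Convergence in the Grassmannian, phrased through cluster points of the isometries so that
  compactness applies directly.\<close>
definition span_conv :: "nat \<Rightarrow> nat \<Rightarrow> (nat \<Rightarrow> 'k mat) \<Rightarrow> 'k vec set \<Rightarrow> bool" where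
  "span_conv d p k W \<longleftrightarrow> (\<forall>s l. strict_mono (s :: nat \<Rightarrow> nat) \<longrightarrow> l \<in> isoms d \<longrightarrow>
     (\<lambda>t. mnorm d d (k (s t) - l)) \<longlonglongrightarrow> 0 \<longrightarrow> span_of d p l = W)"

lemma span_conv_cluster:
  assumes "span_conv d p k W" "\<And>t. k t \<in> isoms d" "0 < d"
  obtains l s where "l \<in> isoms d" "strict_mono (s :: nat \<Rightarrow> nat)" "(\<lambda>t. mnorm d d (k (s t) - l)) \<longlonglongrightarrow> 0"
    "span_of d p l = W"
  using isom_compact[of k d] assms unfolding span_conv_def by metis

text \<open>If a neighbourhood of \<open>W\<close> were missed infinitely often, compactness would
  give a convergent subsequence of the missing isometries. Its limit also spans \<open>W\<close>,
  and the spans converge to it by \<open>limitin_span_of\<close>.\<close>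

lemma span_conv_limitin:
  assumes c: "span_conv d p k W" and k: "\<And>t. k t \<in> isoms d" and p: "0 < d" "p \<le> d"
  shows "limitin (grass_topology v d p) (\<lambda>t. span_of d p (k t)) W sequentially"
  unfolding limitin_def
proof (intro conjI allI impI)
  show "W \<in> topspace (grass_topology v d p)"
    using span_conv_cluster[OF c k p(1)] isom_span_Grass[OF _ p(2)] by (metis topspace_grass)
  fix U assume U: "openin (grass_topology v d p) U \<and> W \<in> U"
  show "\<forall>\<^sub>F t in sequentially. span_of d p (k t) \<in> U"
  proof (rule ccontr)
    assume "\<not> (\<forall>\<^sub>F t in sequentially. span_of d p (k t) \<in> U)"
    then obtain r where r: "strict_mono (r :: nat \<Rightarrow> nat)" "\<And>n. span_of d p (k (r n)) \<notin> U"
      using not_eventually_sequentiallyD by blast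
    obtain l s where s: "l \<in> isoms d" "strict_mono (s :: nat \<Rightarrow> nat)" "(\<lambda>t. mnorm d d (k (r (s t)) - l)) \<longlonglongrightarrow> 0"
      using isom_compact[of "\<lambda>t. k (r t)" d] k p by metis
    have "strict_mono (r \<circ> s)" using r s by (simp add: strict_mono_o)
    then have "span_of d p l = W" 
      using c[unfolded span_conv_def, rule_format, of "r \<circ> s" l] s by (simp add: comp_def)
    then have "limitin (grass_topology v d p) (\<lambda>t. span_of d p (k (r (s t)))) W sequentially"
      using limitin_span_of[OF k s(1,3) p(2)] by simp
    then have "\<forall>\<^sub>F t in sequentially. span_of d p (k (r (s t))) \<in> U" using U unfolding limitin_def by auto
    then show False using r(2) by auto
  qed
qed

text \<open>On frames the condition says that some coefficient vector \<open>x\<close> satisfies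
  \<open>N (A *\<^sub>v x - w) < e\<close>, and the same \<open>x\<close> works for all frames close
  to \<open>A\<close>. These open sets are what separates limits in
  \<open>span_conv_unique\<close>.\<close>

lemma near_open:
  assumes w: "w \<in> carrier_vec d" and p: "0 < d" "0 < p"
  shows "openin (grass_topology v d p) {V \<in> Grass d p. \<exists>u\<in>V. N (u - w) < e}"
  unfolding openin_grass
proof
  define T where "T = {A \<in> carrier_mat d p. \<exists>x\<in>carrier_vec p. N (A *\<^sub>v x - w) < e}"
  have "openin (mat_topology v d p) T" unfolding openin_mat_topology
  proof (intro conjI ballI)
    fix A assume "A \<in> T"
    then obtain x where A: "A \<in> carrier_mat d p" "x \<in> carrier_vec p" "N (A *\<^sub>v x - w) < e" by (auto simp: T_def)
    \<comment> \<open>Perturbing \<open>A\<close> by less than \<open>r\<close> moves its value at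
      \<open>x\<close> by less than the available slack; the summand 1 covers the case
      \<open>x = 0\<close>.\<close>
    define r where "r = (e - N (A *\<^sub>v x - w)) / (N x + 1)"
    have Nx: "0 \<le> N x" using N_nonneg[OF A(2) p(2)] .
    then have "0 < r" using A by (simp add: r_def)
    moreover have "B \<in> T" if B: "B \<in> carrier_mat d p" "mnorm d p (A - B) < r" for B
    proof -
      have c: "A *\<^sub>v x \<in> carrier_vec d" "B *\<^sub>v x \<in> carrier_vec d" using A B by auto
      have "N (B *\<^sub>v x - w) \<le> N (B *\<^sub>v x - A *\<^sub>v x) + N (A *\<^sub>v x - w)"
        using N_diff_triangle[OF c(2,1) w p(1)] .
      also have "N (B *\<^sub>v x - A *\<^sub>v x) \<le> mnorm d p (A - B) * N x"
        using mult_vec_diff[OF A(1) B(1) A(2) p] N_diff_commute[OF c p(1)] by simp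
      also have "\<dots> \<le> r * N x" using B Nx by (intro mult_right_mono) auto
      also have "r * N x < r * (N x + 1)" using \<open>0 < r\<close> by simp
      also have "\<dots> = e - N (A *\<^sub>v x - w)" using Nx by (simp add: r_def)
      finally have "N (B *\<^sub>v x - w) < e" by simp
      then show ?thesis using B A by (auto simp: T_def)
    qed
    ultimately show "\<exists>r>0. \<forall>B\<in>carrier_mat d p. mnorm d p (A - B) < r \<longrightarrow> B \<in> T" by blast
  qed (auto simp: T_def)
  moreover have "{A \<in> carrier_mat d p. vec_space.rank d A = p \<and>
      vec_space.col_space d A \<in> {V \<in> Grass d p. \<exists>u\<in>V. N (u - w) < e}} =
      T \<inter> {A \<in> carrier_mat d p. vec_space.rank d A = p}"
  proof -
    have "(\<exists>u\<in>vec_space.col_space d A. N (u - w) < e) \<longleftrightarrow> A \<in> T" if "A \<in> carrier_mat d p" for A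
    proof
      assume "\<exists>u\<in>vec_space.col_space d A. N (u - w) < e"
      then show "A \<in> T" using vec_space.col_space_eq[OF that] that by (auto simp: T_def)
    next
      assume "A \<in> T"
      then obtain x where x: "x \<in> carrier_vec p" "N (A *\<^sub>v x - w) < e" by (auto simp: T_def)
      then have "A *\<^sub>v x \<in> vec_space.col_space d A"
        using vec_space.col_space_eq[OF that] that mult_mat_vec_carrier[OF that] by auto
      then show "\<exists>u\<in>vec_space.col_space d A. N (u - w) < e" using x by blast
    qed
    then show ?thesis using col_space_Grass[of _ d p] by blast
  qed
  ultimately show "openin (frame_space d p) {A \<in> carrier_mat d p. vec_space.rank d A = p \<and>
      vec_space.col_space d A \<in> {V \<in> Grass d p. \<exists>u\<in>V. N (u - w) < e}}"
    unfolding openin_subtopology by blast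
qed auto

lemma limitin_grass_near:
  assumes "limitin (grass_topology v d p) U W sequentially" "w \<in> W" "0 < e" "0 < d" "0 < p"
  shows "\<forall>\<^sub>F t in sequentially. \<exists>u\<in>U t. N (u - w) < e"
proof -
  have W: "W \<in> Grass d p" using assms(1) unfolding limitin_def by auto
  then have w: "w \<in> carrier_vec d" using Grass_carrier assms by blast
  have "w - w = 0\<^sub>v d" using w by auto
  then have "W \<in> {V \<in> Grass d p. \<exists>u\<in>V. N (u - w) < e}" using W assms by (auto intro!: bexI[of _ w])
  then have "\<forall>\<^sub>F t in sequentially. U t \<in> {V \<in> Grass d p. \<exists>u\<in>V. N (u - w) < e}"
    using assms(1) near_open[OF w assms(4,5)] unfolding limitin_def by blast
  then show ?thesis by (rule eventually_mono) auto
qed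

text \<open>After applying the inverse isometry, a nonzero coordinate of \<open>w\<close> beyond the
  first p would bound the distance from \<open>w\<close> to the subspace from below.\<close>

lemma span_of_closed:
  assumes l: "l \<in> isoms d" and d: "0 < d" and w: "w \<in> carrier_vec d"
    and near: "\<And>e. 0 < e \<Longrightarrow> \<exists>x\<in>coord_subspace d p. N (l *\<^sub>v x - w) < e"
  shows "w \<in> span_of d p l"
proof -
  obtain l' where l': "l' \<in> isoms d" "l * l' = 1\<^sub>m d" "l' * l = 1\<^sub>m d" using isom_inverse[OF l] by metis
  note c = isom_carrier[OF l] isom_carrier[OF l'(1)]
  define y where "y = l' *\<^sub>v w"
  have y: "y \<in> carrier_vec d" "l *\<^sub>v y = w" unfolding y_def using inverse_mult_vec[OF l'(2) c w] c w by auto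
  have "y $ i = 0" if i: "i < d" "p \<le> i" for i
  proof (rule ccontr)
    assume "y $ i \<noteq> 0"
    then obtain x where x: "x \<in> coord_subspace d p" "N (l *\<^sub>v x - w) < v (y $ i)" using near[of "v (y $ i)"] by auto
    have xc: "x \<in> carrier_vec d" "x $ i = 0" using x i by (auto simp: coord_subspace_def)
    have "v (y $ i) = v ((x - y) $ i)" using xc y i by simp
    also have "\<dots> \<le> N (x - y)" using N_coord_le[of "x - y" d i] xc y i by auto
    also have "\<dots> = N (l *\<^sub>v (x - y))" using isom_norm[OF l, of "x - y"] xc y by auto
    also have "l *\<^sub>v (x - y) = l *\<^sub>v x - w" using mult_minus_distrib_mat_vec[OF c(1) xc(1) y(1)] y(2) by simp
    finally show False using x(2) by simp
  qed
  then have "y \<in> coord_subspace d p" using y by (auto simp: coord_subspace_def)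
  then show ?thesis using y(2) by force
qed

text \<open>Justifies the \<open>THE\<close> in \<open>limit_map\<close>. Every vector of
  \<open>W'\<close> is approximated by vectors of the converging spans, hence by vectors of the span
  of a cluster point, which is \<open>W\<close>. Equality follows since the dimensions
  agree.\<close>

lemma span_conv_unique:
  assumes c: "span_conv d p k W" and k: "\<And>t. k t \<in> isoms d" and p: "0 < d" "0 < p" "p \<le> d"
    and lim: "limitin (grass_topology v d p) (\<lambda>t. span_of d p (k t)) W' sequentially"
  shows "W' = W"
proof -
  obtain l s where s: "l \<in> isoms d" "strict_mono (s :: nat \<Rightarrow> nat)" "(\<lambda>t. mnorm d d (k (s t) - l)) \<longlonglongrightarrow> 0"
    "span_of d p l = W" using span_conv_cluster[OF c k p(1)] by metis
  have W': "W' \<in> Grass d p" using lim unfolding limitin_def by auto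
  have "W' \<subseteq> W"
  proof
    fix w assume w: "w \<in> W'"
    then have wc: "w \<in> carrier_vec d" using W' Grass_carrier by blast
    have "w \<in> span_of d p l"
    proof (rule span_of_closed[OF s(1) p(1) wc])
      fix e :: real assume e: "0 < e"
      \<comment> \<open>The bound by 1 yields \<open>N x \<le> N w + 1\<close>. The two errors then
        sum to at most e' times \<open>N w + 2\<close>, which leaves room below
        \<open>e\<close>.\<close>
      define e' where "e' = min 1 (e / (N w + 3))"
      have Nw: "0 \<le> N w" using N_nonneg[OF wc p(1)] .
      then have "0 < e'" "e' \<le> 1" "e' \<le> e / (N w + 3)" using e by (auto simp: e'_def)
      then have e': "0 < e'" "e' \<le> 1" "e' * (N w + 3) \<le> e" using Nw by (simp_all add: pos_le_divide_eq)
      have "\<forall>\<^sub>F t in sequentially. \<exists>u\<in>span_of d p (k (s t)). N (u - w) < e'"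
        using eventually_subseq[OF s(2) limitin_grass_near[OF lim w e'(1) p(1,2)]] .
      moreover have "\<forall>\<^sub>F t in sequentially. mnorm d d (k (s t) - l) < e'"
        using order_tendstoD(2)[OF s(3) e'(1)] .
      ultimately obtain t where "\<exists>u\<in>span_of d p (k (s t)). N (u - w) < e'" and t: "mnorm d d (k (s t) - l) < e'"
        using eventually_happens'[OF sequentially_bot eventually_conj] by blast
      then obtain x where x: "x \<in> coord_subspace d p" "N (k (s t) *\<^sub>v x - w) < e'" by auto
      have xc: "x \<in> carrier_vec d" using x coord_subspace_carrier by blast
      have c: "k (s t) *\<^sub>v x \<in> carrier_vec d" "l *\<^sub>v x \<in> carrier_vec d"
        using isom_mult_carrier[OF k xc] isom_mult_carrier[OF s(1) xc] by auto
      have Nx: "0 \<le> N x" "N x \<le> N w + 1"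
        using N_nonneg[OF xc p(1)] N_diff_le[OF c(1) wc p(1)] isom_norm[OF k xc, of "s t"] x(2) e' by auto
      have "N (l *\<^sub>v x - w) \<le> N (l *\<^sub>v x - k (s t) *\<^sub>v x) + N (k (s t) *\<^sub>v x - w)"
        by (rule N_diff_triangle[OF c(2,1) wc p(1)])
      also have "N (l *\<^sub>v x - k (s t) *\<^sub>v x) \<le> mnorm d d (k (s t) - l) * N x"
        using mult_vec_diff[OF isom_carrier[OF k] isom_carrier[OF s(1)] xc p(1,1), of "s t"] N_diff_commute[OF c p(1)] by simp
      also have "\<dots> \<le> e' * (N w + 1)" using t e' Nx by (intro mult_mono) auto
      finally have "N (l *\<^sub>v x - w) < e' * (N w + 1) + e'" using x(2) by simp
      also have "\<dots> \<le> e' * (N w + 3)" using e' by (simp add: algebra_simps)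
      finally show "\<exists>x\<in>coord_subspace d p. N (l *\<^sub>v x - w) < e" using x e' by force
    qed
    then show "w \<in> W" using s(4) by simp
  qed
  then show ?thesis using Grass_subset_eq[OF W'] isom_span_Grass[OF s(1) p(3)] s(4) by blast
qed

text \<open>Three errors are added: from \<open>k'\<close> to \<open>k t\<close>, from there to
  \<open>l t\<close> by \<open>near\<close>, and on to \<open>l'\<close>. Only one inclusion
  results, which suffices because both spans have dimension p; so the asymmetry of
  \<open>near\<close> does no harm.\<close>

lemma near_limit_eq:
  assumes k: "\<And>t. k t \<in> isoms d" "k' \<in> isoms d" "(\<lambda>t. mnorm d d (k t - k')) \<longlonglongrightarrow> 0"
    and l: "\<And>t. l t \<in> isoms d" "l' \<in> isoms d" "(\<lambda>t. mnorm d d (l t - l')) \<longlonglongrightarrow> 0"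
    and near: "\<And>t. near (e t) (span_of d p (k t)) (span_of d p (l t))" and e: "e \<longlonglongrightarrow> 0" and p: "0 < d" "p \<le> d"
  shows "span_of d p k' = span_of d p l'"
proof -
  have "span_of d p k' \<subseteq> span_of d p l'"
  proof
    fix w assume "w \<in> span_of d p k'"
    then obtain x where x: "x \<in> coord_subspace d p" "w = k' *\<^sub>v x" by auto
    have xc: "x \<in> carrier_vec d" using x coord_subspace_carrier by blast
    have wc: "w \<in> carrier_vec d" using x xc isom_carrier[OF k(2)] by auto
    show "w \<in> span_of d p l'"
    proof (rule span_of_closed[OF l(2) p(1) wc])
      fix \<epsilon> :: real assume \<epsilon>: "0 < \<epsilon>"
      have Nx: "0 \<le> N x" using N_nonneg[OF xc p(1)] .
      have "(\<lambda>t. (mnorm d d (l t - l') + e t + mnorm d d (k t - k')) * N x) \<longlonglongrightarrow> (0 + 0 + 0) * N x"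
        by (intro tendsto_intros k(3) l(3) e)
      then have "(\<lambda>t. (mnorm d d (l t - l') + e t + mnorm d d (k t - k')) * N x) \<longlonglongrightarrow> 0" by simp
      from order_tendstoD(2)[OF this \<epsilon>] obtain t where
        t: "(mnorm d d (l t - l') + e t + mnorm d d (k t - k')) * N x < \<epsilon>"
        using eventually_happens'[OF sequentially_bot] by blast
      have kx: "k t *\<^sub>v x \<in> carrier_vec d" "N (k t *\<^sub>v x) = N x" using isom_mult_carrier[OF k(1) xc] isom_norm[OF k(1) xc] by auto
      obtain y where y: "y \<in> coord_subspace d p" "N (l t *\<^sub>v y) \<le> N x" "N (k t *\<^sub>v x - l t *\<^sub>v y) \<le> e t * N x"
        using near[of t] x(1) kx unfolding near_def by fastforce
      have yc: "y \<in> carrier_vec d" using y coord_subspace_carrier by blast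
      have ly: "l t *\<^sub>v y \<in> carrier_vec d" "l' *\<^sub>v y \<in> carrier_vec d" "N y \<le> N x"
        using isom_mult_carrier[OF l(1) yc] isom_mult_carrier[OF l(2) yc] isom_norm[OF l(1) yc, of t] y(2) by auto
      have "N (l' *\<^sub>v y - w) \<le> N (l' *\<^sub>v y - l t *\<^sub>v y) + N (l t *\<^sub>v y - w)"
        by (rule N_diff_triangle[OF ly(2,1) wc p(1)])
      also have "N (l t *\<^sub>v y - w) \<le> N (l t *\<^sub>v y - k t *\<^sub>v x) + N (k t *\<^sub>v x - w)"
        by (rule N_diff_triangle[OF ly(1) kx(1) wc p(1)])
      also have "N (l' *\<^sub>v y - l t *\<^sub>v y) \<le> mnorm d d (l t - l') * N x"
        using mult_vec_diff[OF isom_carrier[OF l(1)] isom_carrier[OF l(2)] yc p(1,1), of t] N_diff_commute[OF ly(2,1) p(1)]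
          mult_left_mono[OF ly(3) mnorm_nonneg[of d d "l t - l'"]] by simp
      also have "N (l t *\<^sub>v y - k t *\<^sub>v x) \<le> e t * N x" using y(3) N_diff_commute[OF ly(1) kx(1) p(1)] by simp
      also have "N (k t *\<^sub>v x - w) \<le> mnorm d d (k t - k') * N x"
        unfolding x(2) by (rule mult_vec_diff[OF isom_carrier[OF k(1)] isom_carrier[OF k(2)] xc p(1,1)])
      finally have "N (l' *\<^sub>v y - w) < \<epsilon>" using t by (simp add: algebra_simps)
      then show "\<exists>x\<in>coord_subspace d p. N (l' *\<^sub>v x - w) < \<epsilon>" using y by auto
    qed
  qed
  then show ?thesis using Grass_subset_eq isom_span_Grass[OF k(2) p(2)] isom_span_Grass[OF l(2) p(2)] by blast
qed

text \<open>Along a subsequence on which \<open>k\<close> converges, \<open>l\<close> need not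
  converge. Compactness provides a further subsequence on which it does, and the limit of
  \<open>k\<close> is unchanged.\<close>

lemma span_conv_transfer:
  assumes l: "\<And>t. l t \<in> isoms d" and d: "0 < d"
    and eq: "\<And>s k' l'. strict_mono (s :: nat \<Rightarrow> nat) \<Longrightarrow> k' \<in> isoms d \<Longrightarrow> l' \<in> isoms d \<Longrightarrow>
      (\<lambda>t. mnorm d d (k (s t) - k')) \<longlonglongrightarrow> 0 \<Longrightarrow> (\<lambda>t. mnorm d d (l (s t) - l')) \<longlonglongrightarrow> 0 \<Longrightarrow>
      span_of d p k' = span_of d p l'"
    and c: "span_conv d p l W"
  shows "span_conv d p k W"
  unfolding span_conv_def
proof (intro allI impI)
  fix s :: "nat \<Rightarrow> nat" and k' assume s: "strict_mono s" "k' \<in> isoms d" "(\<lambda>t. mnorm d d (k (s t) - k')) \<longlonglongrightarrow> 0"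
  obtain l' r where r: "l' \<in> isoms d" "strict_mono (r :: nat \<Rightarrow> nat)" "(\<lambda>t. mnorm d d (l (s (r t)) - l')) \<longlonglongrightarrow> 0"
    using isom_compact[of "\<lambda>t. l (s t)" d] l d by metis
  have sr: "strict_mono (s \<circ> r)" using s r by (simp add: strict_mono_o)
  have "span_of d p l' = W" using c sr r unfolding span_conv_def comp_def by blast
  moreover have "(\<lambda>t. mnorm d d (k ((s \<circ> r) t) - k')) \<longlonglongrightarrow> 0"
    using LIMSEQ_subseq_LIMSEQ[OF s(3) r(2)] by (simp add: comp_def)
  ultimately show "span_of d p k' = W" using eq[OF sr s(2) r(1)] r(3) by (simp add: comp_def)
qed

lemma span_conv_near:
  assumes k: "\<And>t. k t \<in> isoms d" and l: "\<And>t. l t \<in> isoms d"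
    and near: "\<And>t. near (e t) (span_of d p (k t)) (span_of d p (l t))" and e: "e \<longlonglongrightarrow> 0" and p: "0 < d" "p \<le> d"
  shows "span_conv d p k W \<longleftrightarrow> span_conv d p l W"
proof -
  have eq: "span_of d p k' = span_of d p l'"
    if "strict_mono (s :: nat \<Rightarrow> nat)" "k' \<in> isoms d" "l' \<in> isoms d"
      "(\<lambda>t. mnorm d d (k (s t) - k')) \<longlonglongrightarrow> 0" "(\<lambda>t. mnorm d d (l (s t) - l')) \<longlonglongrightarrow> 0" for s k' l'
    using near_limit_eq[OF k that(2,4) l that(3,5) near _ p] LIMSEQ_subseq_LIMSEQ[OF e that(1)] by (simp add: comp_def)
  show ?thesis
  proof
    assume c: "span_conv d p l W"
    show "span_conv d p k W" by (rule span_conv_transfer[OF l p(1) _ c]) (rule eq)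
  next
    assume c: "span_conv d p k W"
    show "span_conv d p l W" by (rule span_conv_transfer[OF k p(1) _ c]) (rule eq[symmetric])
  qed
qed

lemma span_conv_const:
  assumes k: "k \<in> isoms d" and d: "0 < d"
  shows "span_conv d p (\<lambda>_. k) (span_of d p k)"
  unfolding span_conv_def
proof (intro allI impI)
  fix s :: "nat \<Rightarrow> nat" and l assume l: "l \<in> isoms d" "(\<lambda>t. mnorm d d (k - l)) \<longlonglongrightarrow> 0"
  then have "mnorm d d (k - l) = 0" by (simp add: LIMSEQ_const_iff)
  then have "k = l" using Metric_space.zero[OF mat_metric, of k d d l] isom_carrier[OF k] isom_carrier[OF l(1)]
    by (simp add: mat_dist_mnorm)
  then show "span_of d p l = span_of d p k" by simp
qed

text \<open>Any cluster point \<open>l\<close> can serve as the limit. The factor 2 comes from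
  choosing an isometry of the subsequence within \<open>e n\<close> of \<open>l\<close>, in addition
  to the Cauchy error \<open>e n\<close>. Comparison with the constant sequence \<open>l\<close>
  then shows that all cluster points have the same span.\<close>

lemma cauchy_span_conv:
  assumes k: "\<And>t. k t \<in> isoms d" and near: "\<And>m n. n \<le> m \<Longrightarrow> near (e n) (span_of d p (k m)) (span_of d p (k n))"
    and e: "e \<longlonglongrightarrow> 0" "\<And>n. 0 < e n" and p: "0 < d" "p \<le> d"
  obtains l where "l \<in> isoms d" "span_conv d p k (span_of d p l)"
    "\<And>n. near (2 * e n) (span_of d p l) (span_of d p (k n))"
proof -
  obtain l s where l: "l \<in> isoms d" "strict_mono (s :: nat \<Rightarrow> nat)" "(\<lambda>t. mnorm d d (k (s t) - l)) \<longlonglongrightarrow> 0"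
    using isom_compact[of k d] k p by metis
  have n: "near (2 * e n) (span_of d p l) (span_of d p (k n))" for n
    unfolding near_def
  proof
    fix u assume "u \<in> span_of d p l"
    then obtain x where x: "x \<in> coord_subspace d p" "u = l *\<^sub>v x" by auto
    have xc: "x \<in> carrier_vec d" using x coord_subspace_carrier by blast
    have "\<forall>\<^sub>F t in sequentially. mnorm d d (k (s t) - l) < e n \<and> n \<le> t"
      using order_tendstoD(2)[OF l(3) e(2)[of n]] eventually_ge_at_top by (rule eventually_conj)
    then obtain t where t: "mnorm d d (k (s t) - l) < e n" "n \<le> t"
      using eventually_happens'[OF sequentially_bot] by blast
    have "n \<le> s t" using t(2) seq_suble[OF l(2), of t] by linarith
    then obtain w where w: "w \<in> span_of d p (k n)" "N w \<le> N (k (s t) *\<^sub>v x)" "N (k (s t) *\<^sub>v x - w) \<le> e n * N (k (s t) *\<^sub>v x)"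
      using near[of n "s t"] x(1) unfolding near_def by blast
    have c: "k (s t) *\<^sub>v x \<in> carrier_vec d" "u \<in> carrier_vec d" "w \<in> carrier_vec d"
      using isom_mult_carrier[OF k xc] isom_mult_carrier[OF l(1) xc] x(2) w(1)
        subsetD[OF isom_image_carrier[OF isom_carrier[OF k]]] by metis+
    have Nu: "N u = N x" "N (k (s t) *\<^sub>v x) = N x" using isom_norm[OF l(1) xc] isom_norm[OF k xc] x(2) by auto
    have "N (u - w) \<le> N (u - k (s t) *\<^sub>v x) + N (k (s t) *\<^sub>v x - w)"
      by (rule N_diff_triangle[OF c(2,1,3) p(1)])
    also have "N (u - k (s t) *\<^sub>v x) \<le> mnorm d d (k (s t) - l) * N x"
      using mult_vec_diff[OF isom_carrier[OF k] isom_carrier[OF l(1)] xc p(1,1), of "s t"] N_diff_commute[OF c(2,1) p(1)] x(2) by simp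
    also have "\<dots> \<le> e n * N x" using t(1) N_nonneg[OF xc p(1)] by (intro mult_right_mono) auto
    finally have "N (u - w) \<le> 2 * e n * N u" using w(3) Nu by simp
    then show "\<exists>w\<in>span_of d p (k n). N w \<le> N u \<and> N (u - w) \<le> 2 * e n * N u" using w Nu by auto
  qed
  have "(\<lambda>n. 2 * e n) \<longlonglongrightarrow> 0" using tendsto_mult_left[OF e(1), of 2] by simp
  then have "span_conv d p (\<lambda>_. l) (span_of d p l) \<longleftrightarrow> span_conv d p k (span_of d p l)"
    by (intro span_conv_near[of "\<lambda>_. l", OF _ k n _ p]) (use l in auto)
  then show ?thesis using that l(1) n span_conv_const[OF l(1) p(1)] by blast
qed

end

section \<open>Projection of lines\<close>

lemma rank_column:
  assumes C: "(C :: 'k::field mat) \<in> carrier_mat n 1"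
  shows "vec_space.rank n C = 1 \<longleftrightarrow> (\<exists>i<n. C $$ (i,0) \<noteq> 0)"
proof
  assume "\<exists>i<n. C $$ (i,0) \<noteq> 0"
  then obtain i where i: "i < n" "C $$ (i,0) \<noteq> 0" by auto
  show "vec_space.rank n C = 1"
  proof (rule rank_inj[OF C])
    fix x :: "'k vec" assume x: "x \<in> carrier_vec 1" "C *\<^sub>v x = 0\<^sub>v n"
    have "(C *\<^sub>v x) $ i = C $$ (i,0) * x $ 0" using C x(1) i by (simp add: scalar_prod_def)
    then have "x $ 0 = 0" using x(2) i by simp
    then show "x = 0\<^sub>v 1" using x(1) by (intro eq_vecI) auto
  qed
next
  assume r: "vec_space.rank n C = 1"
  interpret vec_space "TYPE('k)" n .
  show "\<exists>i<n. C $$ (i,0) \<noteq> 0"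
  proof (rule ccontr)
    assume "\<not> ?thesis"
    then have z: "C *\<^sub>v unit_vec 1 0 = 0\<^sub>v n" using C by (intro eq_vecI) auto
    have d: "distinct (cols C)" using C by (simp add: cols_def)
    have "unit_vec 1 0 \<noteq> (0\<^sub>v 1 :: 'k vec)"
    proof
      assume "unit_vec 1 0 = (0\<^sub>v 1 :: 'k vec)"
      then have "unit_vec 1 0 $ 0 = (0\<^sub>v 1 :: 'k vec) $ 0" by (rule arg_cong)
      then show False by simp
    qed
    then show False using lin_depI[OF C unit_vec_carrier _ z d] full_rank_lin_indpt[OF C r d] by blast
  qed
qed

lemma column_mult_zero:
  assumes C: "(C :: 'k::field mat) \<in> carrier_mat n 1"
  shows "(\<exists>x\<in>carrier_vec 1. C *\<^sub>v x \<noteq> 0\<^sub>v n) \<longleftrightarrow> (\<exists>i<n. C $$ (i,0) \<noteq> 0)"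
proof
  assume "\<exists>x\<in>carrier_vec 1. C *\<^sub>v x \<noteq> 0\<^sub>v n"
  then obtain x where x: "x \<in> carrier_vec 1" "C *\<^sub>v x \<noteq> 0\<^sub>v n" by auto
  show "\<exists>i<n. C $$ (i,0) \<noteq> 0"
  proof (rule ccontr)
    assume "\<not> ?thesis"
    then have "C *\<^sub>v x = 0\<^sub>v n" using C x(1) by (intro eq_vecI) (auto simp: scalar_prod_def)
    then show False using x(2) by simp
  qed
next
  assume "\<exists>i<n. C $$ (i,0) \<noteq> 0"
  then obtain i where i: "i < n" "C $$ (i,0) \<noteq> 0" by auto
  then have "(C *\<^sub>v unit_vec 1 0) $ i \<noteq> 0" using C by simp
  then have "C *\<^sub>v unit_vec 1 0 \<noteq> 0\<^sub>v n" using i by auto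
  then show "\<exists>x\<in>carrier_vec 1. C *\<^sub>v x \<noteq> 0\<^sub>v n" by (intro bexI[of _ "unit_vec 1 0"]) auto
qed

lemma col_space_iff:
  assumes "(A :: 'k::field mat) \<in> carrier_mat n p"
  shows "vec_space.col_space n A = (*\<^sub>v) A ` carrier_vec p"
proof -
  have "vec_space.col_space n A = {y \<in> carrier_vec n. \<exists>x\<in>carrier_vec p. A *\<^sub>v x = y}"
    using vec_space.col_space_eq[OF assms] assms by simp
  also have "\<dots> = (*\<^sub>v) A ` carrier_vec p" using mult_mat_vec_carrier[OF assms] by auto
  finally show ?thesis .
qed

lemma col_space_mult:
  assumes "(B :: 'k::field mat) \<in> carrier_mat r n" "A \<in> carrier_mat n p"
  shows "vec_space.col_space r (B * A) = (*\<^sub>v) B ` vec_space.col_space n A"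
  unfolding col_space_iff[OF assms(2)] col_space_iff[OF mult_carrier_mat[OF assms]] image_image
  by (intro image_cong refl assoc_mult_mat_vec[OF assms])

context local_field_abs begin

lemma mnorm_mult_le:
  assumes "B \<in> carrier_mat r n" "X \<in> carrier_mat n 1"
  shows "mnorm r 1 (B * X) \<le> mnorm r n B * mnorm n 1 X"
proof -
  have "mnorm r 1 (B * X) = (\<Sum>i<r. v ((B * X) $$ (i,0)))" by (simp add: mnorm_def)
  also have "\<dots> \<le> (\<Sum>i<r. \<Sum>q<n. v (B $$ (i,q)) * mnorm n 1 X)"
  proof (rule sum_mono)
    fix i assume "i \<in> {..<r}"
    then have "(B * X) $$ (i,0) = (\<Sum>q<n. B $$ (i,q) * X $$ (q,0))"
      using mult_mat_coord[OF assms, of i 0] by simp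
    also have "v \<dots> \<le> (\<Sum>q<n. v (B $$ (i,q) * X $$ (q,0)))" by (rule v_sum)
    also have "\<dots> \<le> (\<Sum>q<n. v (B $$ (i,q)) * mnorm n 1 X)"
    proof (rule sum_mono)
      fix q assume "q \<in> {..<n}"
      then have "v (X $$ (q,0)) \<le> mnorm n 1 X" unfolding mnorm_def by (auto intro!: member_le_sum)
      then show "v (B $$ (i,q) * X $$ (q,0)) \<le> v (B $$ (i,q)) * mnorm n 1 X"
        unfolding v_mult by (rule mult_left_mono) simp
    qed
    finally show "v ((B * X) $$ (i,0)) \<le> (\<Sum>q<n. v (B $$ (i,q)) * mnorm n 1 X)" .
  qed
  also have "\<dots> = mnorm r n B * mnorm n 1 X" by (simp add: mnorm_def sum_distrib_right)
  finally show ?thesis .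
qed

text \<open>A nonzero entry stays nonzero under small perturbations. Hence a set of one-column
  frames that is open among frames is open among all columns, where linear maps are easier to
  handle.\<close>

lemma open_rank_one_columns: "openin (mat_topology v n 1) {C \<in> carrier_mat n 1. vec_space.rank n C = 1}"
  unfolding openin_mat_topology
proof (intro conjI ballI)
  fix C :: "'k mat" assume "C \<in> {C \<in> carrier_mat n 1. vec_space.rank n C = 1}"
  then have C: "C \<in> carrier_mat n 1" "\<exists>i<n. C $$ (i,0) \<noteq> 0" using rank_column[of C n] by auto
  then obtain i where i: "i < n" "C $$ (i,0) \<noteq> 0" by auto
  show "\<exists>r>0. \<forall>B\<in>carrier_mat n 1. mnorm n 1 (C - B) < r \<longrightarrow> B \<in> {C \<in> carrier_mat n 1. vec_space.rank n C = 1}"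
  proof (intro exI[of _ "v (C $$ (i,0))"] conjI ballI impI)
    fix B assume B: "B \<in> carrier_mat n 1" "mnorm n 1 (C - B) < v (C $$ (i,0))"
    have "B $$ (i,0) \<noteq> 0"
    proof
      assume "B $$ (i,0) = 0"
      then have "v (C $$ (i,0)) = v ((C - B) $$ (i,0))" using B C i by simp
      also have "\<dots> \<le> (\<Sum>i<n. v ((C - B) $$ (i,0)))" using i by (intro member_le_sum[of i]) auto
      also have "\<dots> = mnorm n 1 (C - B)" by (simp add: mnorm_def)
      finally show False using B by simp
    qed
    then show "B \<in> {C \<in> carrier_mat n 1. vec_space.rank n C = 1}" using rank_column[OF B(1)] B i by auto
  qed (use i in simp)
qed auto

text \<open>Continuity of the projection from the lines outside the kernel of \<open>B\<close> to
  the projective space of the target, together with openness of its domain. On frames the projection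
  is left multiplication by \<open>B\<close>, which is Lipschitz for \<open>mnorm\<close>; the lines
  outside the kernel are those whose projected frame still has rank 1.\<close>

lemma open_projection:
  assumes B: "B \<in> carrier_mat r d" and Q: "openin (grass_topology v r 1) Q"
  shows "openin (grass_topology v d 1) {L \<in> Grass d 1. (\<exists>u\<in>L. B *\<^sub>v u \<noteq> 0\<^sub>v r) \<and> (*\<^sub>v) B ` L \<in> Q}"
  unfolding openin_grass
proof
  define T where "T = {C \<in> carrier_mat r 1. vec_space.rank r C = 1 \<and> vec_space.col_space r C \<in> Q}"
  have "openin (frame_space r 1) T" using Q unfolding openin_grass T_def by simp
  then have T: "openin (mat_topology v r 1) T"
    using openin_trans_full open_rank_one_columns by blast
  define T' where "T' = {A \<in> carrier_mat d 1. B * A \<in> T}"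
  have "openin (mat_topology v d 1) T'" unfolding openin_mat_topology
  proof (intro conjI ballI)
    fix A assume "A \<in> T'"
    then have A: "A \<in> carrier_mat d 1" "B * A \<in> T" by (auto simp: T'_def)
    obtain e where e: "e > 0" "\<And>C. C \<in> carrier_mat r 1 \<Longrightarrow> mnorm r 1 (B * A - C) < e \<Longrightarrow> C \<in> T"
      using T A(2) unfolding openin_mat_topology by meson
    have K: "0 < mnorm r d B + 1" using mnorm_nonneg[of r d B] by simp
    show "\<exists>s>0. \<forall>A'\<in>carrier_mat d 1. mnorm d 1 (A - A') < s \<longrightarrow> A' \<in> T'"
    proof (intro exI[of _ "e / (mnorm r d B + 1)"] conjI ballI impI)
      fix A' assume A': "A' \<in> carrier_mat d 1" "mnorm d 1 (A - A') < e / (mnorm r d B + 1)"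
      have "B * A - B * A' = B * (A - A')" using mult_minus_distrib_mat[OF B A(1) A'(1)] by simp
      then have "mnorm r 1 (B * A - B * A') \<le> mnorm r d B * mnorm d 1 (A - A')"
        using mnorm_mult_le[OF B, of "A - A'"] A(1) A'(1) minus_carrier_mat[OF A'(1), of A] by simp
      also have "\<dots> \<le> (mnorm r d B + 1) * mnorm d 1 (A - A')"
        using mnorm_nonneg[of d 1] by (intro mult_right_mono) auto
      also have "\<dots> < e" using A'(2) K by (simp add: pos_less_divide_eq mult.commute)
      finally have "B * A' \<in> T" using e(2) mult_carrier_mat[OF B A'(1)] by blast
      then show "A' \<in> T'" using A' by (simp add: T'_def)
    qed (use e K in auto)
  qed (auto simp: T'_def)
  moreover have "{A \<in> carrier_mat d 1. vec_space.rank d A = 1 \<and> vec_space.col_space d A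
       \<in> {L \<in> Grass d 1. (\<exists>u\<in>L. B *\<^sub>v u \<noteq> 0\<^sub>v r) \<and> (*\<^sub>v) B ` L \<in> Q}}
     = T' \<inter> {A \<in> carrier_mat d 1. vec_space.rank d A = 1}"
  proof -
    have "vec_space.col_space d A \<in> {L \<in> Grass d 1. (\<exists>u\<in>L. B *\<^sub>v u \<noteq> 0\<^sub>v r) \<and> (*\<^sub>v) B ` L \<in> Q} \<longleftrightarrow> A \<in> T'"
      if A: "A \<in> carrier_mat d 1" "vec_space.rank d A = 1" for A
    proof -
      have BA: "B * A \<in> carrier_mat r 1" using B A by auto
      have "(\<exists>u\<in>vec_space.col_space d A. B *\<^sub>v u \<noteq> 0\<^sub>v r) \<longleftrightarrow> (\<exists>x\<in>carrier_vec 1. (B * A) *\<^sub>v x \<noteq> 0\<^sub>v r)"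
        unfolding col_space_iff[OF A(1)] bex_simps(7) using assoc_mult_mat_vec[OF B A(1)] by (metis (no_types, lifting))
      also have "\<dots> \<longleftrightarrow> vec_space.rank r (B * A) = 1" unfolding column_mult_zero[OF BA] rank_column[OF BA] ..
      finally have 1: "(\<exists>u\<in>vec_space.col_space d A. B *\<^sub>v u \<noteq> 0\<^sub>v r) \<longleftrightarrow> vec_space.rank r (B * A) = 1" .
      have 2: "A \<in> T' \<longleftrightarrow> vec_space.rank r (B * A) = 1 \<and> (*\<^sub>v) B ` vec_space.col_space d A \<in> Q"
        unfolding col_space_mult[OF B A(1), symmetric] T'_def T_def mem_Collect_eq using A BA by blast
      have 3: "vec_space.col_space d A \<in> Grass d 1" using col_space_Grass[OF A(1)] unfolding A(2) .
      show ?thesis unfolding mem_Collect_eq 1 2 using 3 by blast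
    qed
    then show ?thesis by blast
  qed
  ultimately show "openin (frame_space d 1) {A \<in> carrier_mat d 1. vec_space.rank d A = 1 \<and> vec_space.col_space d A
       \<in> {L \<in> Grass d 1. (\<exists>u\<in>L. B *\<^sub>v u \<noteq> 0\<^sub>v r) \<and> (*\<^sub>v) B ` L \<in> Q}}"
    unfolding openin_subtopology by blast
qed auto

text \<open>The last d - q rows of the inverse of \<open>k\<close> realize the quotient by the
  subspace as a concrete coordinate space.\<close>

lemma span_of_kernel:
  assumes k: "k \<in> isoms d" and q: "q \<le> d"
  obtains B where "B \<in> carrier_mat (d - q) d"
    "\<And>w. w \<in> carrier_vec d \<Longrightarrow> B *\<^sub>v w = 0\<^sub>v (d - q) \<longleftrightarrow> w \<in> span_of d q k"
proof -
  obtain k' where k': "k' \<in> isoms d" "k * k' = 1\<^sub>m d" "k' * k = 1\<^sub>m d" using isom_inverse[OF k] by metis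
  note c = isom_carrier[OF k] isom_carrier[OF k'(1)]
  define B where "B = mat (d - q) d (\<lambda>(i,j). k' $$ (q + i, j))"
  have B: "B \<in> carrier_mat (d - q) d" by (simp add: B_def)
  have Bw: "(B *\<^sub>v w) $ i = (k' *\<^sub>v w) $ (q + i)" if "w \<in> carrier_vec d" "i < d - q" for w i
    using mult_vec_coord[OF B that] mult_vec_coord[OF c(2) that(1), of "q + i"] that(2)
    by (simp del: index_mult_mat_vec) (simp add: B_def)
  have "B *\<^sub>v w = 0\<^sub>v (d - q) \<longleftrightarrow> w \<in> span_of d q k" if w: "w \<in> carrier_vec d" for w
  proof
    assume 0: "B *\<^sub>v w = 0\<^sub>v (d - q)"
    have "(k' *\<^sub>v w) $ i = 0" if "i < d" "q \<le> i" for i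
    proof -
      have e: "i - q < d - q" "q + (i - q) = i" using that by auto
      have "(B *\<^sub>v w) $ (i - q) = 0" unfolding 0 using e by simp
      then show ?thesis using Bw[OF w e(1)] unfolding e(2) by metis
    qed
    then have "k' *\<^sub>v w \<in> coord_subspace d q" using isom_mult_carrier[OF k'(1) w] unfolding coord_subspace_def by blast
    then show "w \<in> span_of d q k" using inverse_mult_vec[OF k'(2) c w] by (metis imageI)
  next
    assume "w \<in> span_of d q k"
    then obtain x where x: "x \<in> coord_subspace d q" "w = k *\<^sub>v x" by auto
    have xc: "x \<in> carrier_vec d" using x coord_subspace_carrier by blast
    have kw: "k' *\<^sub>v w = x" unfolding x(2) using inverse_mult_vec[OF k'(3) c(2,1) xc] .
    show "B *\<^sub>v w = 0\<^sub>v (d - q)"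
    proof (rule eq_vecI)
      fix i assume "i < dim_vec (0\<^sub>v (d - q) :: 'k vec)"
      then have i: "i < d - q" by simp
      then have "x $ (q + i) = 0" using x(1) by (auto simp: coord_subspace_def)
      then show "(B *\<^sub>v w) $ i = 0\<^sub>v (d - q) $ i" unfolding Bw[OF w i] kw using i by simp
    qed (use B in auto)
  qed
  then show ?thesis using that B by blast
qed

lemma span_of_line:
  assumes l: "l \<in> isoms d" and d: "0 < d"
  obtains u where "u \<in> carrier_vec d" "u \<noteq> 0\<^sub>v d" "span_of d 1 l = {c \<cdot>\<^sub>v u | c. True}"
proof -
  define u where "u = l *\<^sub>v unit_vec d 0"
  have u: "u \<in> carrier_vec d" unfolding u_def using isom_mult_carrier[OF l] by simp
  have "N u = 1" unfolding u_def using isom_norm[OF l, of "unit_vec d 0"] N_unit_vec[OF d] by simp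
  then have "u \<noteq> 0\<^sub>v d" using d by auto
  have lc: "l *\<^sub>v (c \<cdot>\<^sub>v unit_vec d 0) = c \<cdot>\<^sub>v u" for c
    unfolding u_def by (rule mult_mat_vec[OF isom_carrier[OF l]]) simp
  have "coord_subspace d 1 = {c \<cdot>\<^sub>v unit_vec d 0 | c :: 'k. True}"
  proof
    show "coord_subspace d 1 \<subseteq> {c \<cdot>\<^sub>v unit_vec d 0 | c :: 'k. True}"
    proof
      fix x :: "'k vec" assume x: "x \<in> coord_subspace d 1"
      then have "x = x $ 0 \<cdot>\<^sub>v unit_vec d 0"
        by (intro eq_vecI) (auto simp: coord_subspace_def)
      then show "x \<in> {c \<cdot>\<^sub>v unit_vec d 0 | c :: 'k. True}" by blast
    qed
  qed (auto simp: coord_subspace_def)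
  then have "span_of d 1 l = {l *\<^sub>v (c \<cdot>\<^sub>v unit_vec d 0) | c. True}" by (simp only:) blast
  then have "span_of d 1 l = {c \<cdot>\<^sub>v u | c. True}" unfolding lc .
  then show ?thesis using that u \<open>u \<noteq> 0\<^sub>v d\<close> by blast
qed

end

section \<open>Representations of groups with a word metric\<close>

lemma PGL_coset:
  assumes "X \<in> carrier (PGL d)"
  obtains A where "A \<in> carrier (GL d)" "X = {c \<cdot>\<^sub>m A | c. c \<noteq> (0::'k::field)}"
proof -
  obtain A where A: "A \<in> carrier (GL d)" "X = scalar_mats d #>\<^bsub>GL d\<^esub> A"
    using assms by (auto simp: PGL_def FactGroup_def RCOSETS_def)
  have Ac: "A \<in> carrier_mat d d" using A(1) by simp
  have s: "c \<cdot>\<^sub>m 1\<^sub>m d * A = c \<cdot>\<^sub>m A" for c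
    using mult_smult_assoc_mat[OF one_carrier_mat Ac, of c] left_mult_one_mat[OF Ac] by simp
  have "X = {B * A | B. B \<in> scalar_mats d}"
    unfolding A(2) r_coset_def by (auto simp: GL_def)
  also have "\<dots> = {c \<cdot>\<^sub>m A | c. c \<noteq> 0}"
    unfolding scalar_mats_def using s by (auto, metis+)
  finally show ?thesis using that A(1) by blast
qed

lemma PGL_rep:
  assumes "X \<in> carrier (PGL d)"
  shows "pgl_rep X \<in> X" "pgl_rep X \<in> carrier (GL d)" "X = {c \<cdot>\<^sub>m pgl_rep X | c. c \<noteq> (0::'k::field)}"
proof -
  obtain A where A: "A \<in> carrier (GL d)" "X = {c \<cdot>\<^sub>m A | c. c \<noteq> 0}" using PGL_coset[OF assms] .
  have "1 \<cdot>\<^sub>m A \<in> X" by (subst A(2), intro CollectI exI[of _ 1]) simp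
  then show *: "pgl_rep X \<in> X" unfolding pgl_rep_def by (rule someI)
  have "\<exists>c. pgl_rep X = c \<cdot>\<^sub>m A \<and> c \<noteq> 0" using * A(2) by blast
  then obtain c where c: "c \<noteq> 0" "pgl_rep X = c \<cdot>\<^sub>m A" by blast
  have Ac: "A \<in> carrier_mat d d" using A(1) by simp
  show "pgl_rep X \<in> carrier (GL d)"
  proof (rule inj_imp_GL)
    show "pgl_rep X \<in> carrier_mat d d" using c Ac by simp
    fix x assume x: "x \<in> carrier_vec d" "pgl_rep X *\<^sub>v x = 0\<^sub>v d"
    have "A *\<^sub>v (c \<cdot>\<^sub>v x) = pgl_rep X *\<^sub>v x"
      unfolding c(2) mult_mat_vec[OF Ac x(1)] using Ac x(1)
      by (intro eq_vecI) (auto simp: scalar_prod_def sum_distrib_left mult.assoc)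
    then have "c \<cdot>\<^sub>v x = 0\<^sub>v d" using GL_inj[OF A(1), of "c \<cdot>\<^sub>v x"] x by simp
    then have "(c \<cdot>\<^sub>v x) $ i = 0" if "i < d" for i using that by simp
    then show "x = 0\<^sub>v d" using x(1) c(1) by (intro eq_vecI) auto
  qed
  have s: "a \<cdot>\<^sub>m A = (a / c) \<cdot>\<^sub>m pgl_rep X" "b \<cdot>\<^sub>m pgl_rep X = (b * c) \<cdot>\<^sub>m A" for a b
    unfolding c(2) using c(1) by (auto intro!: eq_matI)
  show "X = {c \<cdot>\<^sub>m pgl_rep X | c. c \<noteq> 0}"
  proof (intro equalityI subsetI)
    fix B assume "B \<in> X"
    then obtain a where "a \<noteq> 0" "B = a \<cdot>\<^sub>m A" unfolding A(2) by auto
    then show "B \<in> {c \<cdot>\<^sub>m pgl_rep X | c. c \<noteq> 0}" using s(1)[of a] c(1) by (intro CollectI exI[of _ "a / c"]) auto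
  next
    fix B assume "B \<in> {c \<cdot>\<^sub>m pgl_rep X | c. c \<noteq> 0}"
    then obtain b where "b \<noteq> 0" "B = b \<cdot>\<^sub>m pgl_rep X" by auto
    then have "B = (b * c) \<cdot>\<^sub>m A" "b * c \<noteq> 0" using s(2)[of b] c(1) by auto
    then show "B \<in> X" using A(2) by blast
  qed
qed

text \<open>Chosen representatives multiply only up to a scalar. This is why the comparison lemmas
  for singular values carry a factor \<open>s\<close>.\<close>

lemma PGL_mult_rep:
  assumes "X \<in> carrier (PGL d)" "Y \<in> carrier (PGL d)" "X \<otimes>\<^bsub>PGL d\<^esub> Y \<in> carrier (PGL d)"
  obtains c where "c \<noteq> (0::'k::field)" "pgl_rep (X \<otimes>\<^bsub>PGL d\<^esub> Y) = c \<cdot>\<^sub>m (pgl_rep X * pgl_rep Y)"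
proof -
  have "X \<otimes>\<^bsub>PGL d\<^esub> Y = {a * b | a b. a \<in> X \<and> b \<in> Y}"
    by (auto simp: PGL_def FactGroup_def set_mult_def GL_def)
  then obtain a b where ab: "a \<in> X" "b \<in> Y" "pgl_rep (X \<otimes>\<^bsub>PGL d\<^esub> Y) = a * b"
    using PGL_rep(1)[OF assms(3)] by auto
  obtain s where s: "s \<noteq> 0" "a = s \<cdot>\<^sub>m pgl_rep X" using ab(1) PGL_rep(3)[OF assms(1)] by blast
  obtain t where t: "t \<noteq> 0" "b = t \<cdot>\<^sub>m pgl_rep Y" using ab(2) PGL_rep(3)[OF assms(2)] by blast
  have c: "pgl_rep X \<in> carrier_mat d d" "pgl_rep Y \<in> carrier_mat d d" using PGL_rep(2) assms by auto
  have "a * b = s \<cdot>\<^sub>m (pgl_rep X * (t \<cdot>\<^sub>m pgl_rep Y))"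
    unfolding s t using mult_smult_assoc_mat[OF c(1), of "t \<cdot>\<^sub>m pgl_rep Y" d s] c by simp
  also have "pgl_rep X * (t \<cdot>\<^sub>m pgl_rep Y) = t \<cdot>\<^sub>m (pgl_rep X * pgl_rep Y)"
    by (rule mult_smult_distrib[OF c])
  also have "s \<cdot>\<^sub>m (t \<cdot>\<^sub>m (pgl_rep X * pgl_rep Y)) = (s * t) \<cdot>\<^sub>m (pgl_rep X * pgl_rep Y)"
    by (rule eq_matI) auto
  finally show ?thesis using that[of "s * t"] s t ab(3) by simp
qed

section \<open>Word length and geodesic rays\<close>

locale word_metric = group \<Gamma> for \<Gamma> :: "('g, 'm) monoid_scheme" (structure) +
  fixes S :: "'g set"
  assumes finite_S: "finite S" and gen_S: "symmetric_generating_set \<Gamma> S"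
begin

abbreviation "wl \<equiv> word_length \<Gamma> S"
abbreviation "wd \<equiv> word_dist \<Gamma> S"
abbreviation "ev ws \<equiv> foldr (\<lambda>x y. x \<otimes> y) ws \<one>"

lemma S_carrier: "S \<subseteq> carrier \<Gamma>" and S_inv: "s \<in> S \<Longrightarrow> inv s \<in> S" and S_gen: "generate \<Gamma> S = carrier \<Gamma>"
  using gen_S by (auto simp: symmetric_generating_set_def)

lemma ev_closed: "set ws \<subseteq> S \<Longrightarrow> ev ws \<in> carrier \<Gamma>"
  using S_carrier by (induction ws) auto

lemma ev_append: "set us \<subseteq> S \<Longrightarrow> set ws \<subseteq> S \<Longrightarrow> ev (us @ ws) = ev us \<otimes> ev ws"
proof (induction us)
  case Nil
  then show ?case using ev_closed[of ws] by simp
next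
  case (Cons u us)
  have "u \<in> carrier \<Gamma>" "ev us \<in> carrier \<Gamma>" "ev ws \<in> carrier \<Gamma>" using Cons.prems S_carrier ev_closed by auto
  then show ?case using Cons by (simp add: m_assoc)
qed

lemma ev_surj:
  assumes "g \<in> carrier \<Gamma>"
  shows "\<exists>ws. set ws \<subseteq> S \<and> ev ws = g"
proof -
  have "g \<in> generate \<Gamma> S" using assms S_gen by simp
  then show ?thesis
  proof induction
    case one
    then show ?case by (intro exI[of _ "[]"]) simp
  next
    case (incl h)
    then show ?case using S_carrier by (intro exI[of _ "[h]"]) auto
  next
    case (inv h)
    then show ?case using S_carrier S_inv by (intro exI[of _ "[inv h]"]) auto
  next
    case (eng h1 h2)
    then obtain us ws where "set us \<subseteq> S" "ev us = h1" "set ws \<subseteq> S" "ev ws = h2" by auto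
    then show ?case using ev_append[of us ws] by (intro exI[of _ "us @ ws"]) auto
  qed
qed

lemma wl_le: "set ws \<subseteq> S \<Longrightarrow> wl (ev ws) \<le> length ws"
  unfolding word_length_def by (rule Least_le) auto

lemma wl_word:
  assumes "g \<in> carrier \<Gamma>"
  obtains ws where "set ws \<subseteq> S" "ev ws = g" "length ws = wl g"
proof -
  have "\<exists>n ws. length ws = n \<and> set ws \<subseteq> S \<and> ev ws = g" using ev_surj[OF assms] by auto
  then have "\<exists>ws. length ws = wl g \<and> set ws \<subseteq> S \<and> ev ws = g"
    unfolding word_length_def by (rule LeastI_ex)
  then show ?thesis using that by auto
qed

lemma wl_mult: "g \<in> carrier \<Gamma> \<Longrightarrow> h \<in> carrier \<Gamma> \<Longrightarrow> wl (g \<otimes> h) \<le> wl g + wl h"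
proof -
  assume g: "g \<in> carrier \<Gamma>" and h: "h \<in> carrier \<Gamma>"
  obtain us where us: "set us \<subseteq> S" "ev us = g" "length us = wl g" using wl_word[OF g] .
  obtain ws where ws: "set ws \<subseteq> S" "ev ws = h" "length ws = wl h" using wl_word[OF h] .
  show "wl (g \<otimes> h) \<le> wl g + wl h"
    using wl_le[of "us @ ws"] ev_append[OF us(1) ws(1)] us ws by simp
qed

lemma ev_inv: "set ws \<subseteq> S \<Longrightarrow> \<exists>us. set us \<subseteq> S \<and> ev us = inv (ev ws) \<and> length us = length ws"
proof (induction ws)
  case (Cons w ws)
  then obtain us where us: "set us \<subseteq> S" "ev us = inv (ev ws)" "length us = length ws" by auto
  have w: "w \<in> carrier \<Gamma>" "ev ws \<in> carrier \<Gamma>" "inv w \<in> S" using Cons.prems S_carrier ev_closed S_inv by auto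
  have "ev (us @ [inv w]) = inv (ev (w # ws))"
    using ev_append[of us "[inv w]"] us w by (simp add: inv_mult_group)
  then show ?case using us w by (intro exI[of _ "us @ [inv w]"]) auto
qed simp

lemma wl_inv: "g \<in> carrier \<Gamma> \<Longrightarrow> wl (inv g) \<le> wl g"
  using wl_word[of g] ev_inv wl_le by metis

lemma wl_inv_eq: "g \<in> carrier \<Gamma> \<Longrightarrow> wl (inv g) = wl g"
  using wl_inv[of g] wl_inv[of "inv g"] by simp

lemma wl_one [simp]: "wl \<one> = 0"
  using wl_le[of "[]"] by simp

lemma finite_wl_ball: "finite {g \<in> carrier \<Gamma>. wl g \<le> L}"
proof -
  have "{g \<in> carrier \<Gamma>. wl g \<le> L} \<subseteq> ev ` {ws. set ws \<subseteq> S \<and> length ws \<le> L}"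
  proof
    fix g assume g: "g \<in> {g \<in> carrier \<Gamma>. wl g \<le> L}"
    then have gc: "g \<in> carrier \<Gamma>" "wl g \<le> L" by auto
    obtain ws where "set ws \<subseteq> S" "ev ws = g" "length ws = wl g" using wl_word[OF gc(1)] .
    then show "g \<in> ev ` {ws. set ws \<subseteq> S \<and> length ws \<le> L}" using gc by (intro image_eqI[of _ _ ws]) auto
  qed
  then show ?thesis by (rule finite_subset[OF _ finite_imageI[OF finite_lists_length_le[OF finite_S]]])
qed

lemma wd_commute: "g \<in> carrier \<Gamma> \<Longrightarrow> h \<in> carrier \<Gamma> \<Longrightarrow> wd g h = wd h g"
  unfolding word_dist_def using wl_inv_eq[of "inv g \<otimes> h"] by (simp add: inv_mult_group)

lemma ray_carrier: "\<gamma> \<in> geodesic_rays \<Gamma> S \<Longrightarrow> \<gamma> n \<in> carrier \<Gamma>"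
  by (auto simp: geodesic_rays_def)

lemma ray_dist: "\<gamma> \<in> geodesic_rays \<Gamma> S \<Longrightarrow> m \<le> n \<Longrightarrow> wl (inv (\<gamma> m) \<otimes> \<gamma> n) = n - m"
  by (auto simp: geodesic_rays_def word_dist_def)

text \<open>Rays need not start at the identity. Word length along a ray grows linearly up to the
  length of its starting point, which later enters the constants as a factor
  \<open>1 / q ^ wl (\<gamma> 0)\<close>.\<close>

lemma ray_length: "\<gamma> \<in> geodesic_rays \<Gamma> S \<Longrightarrow> n \<le> wl (\<gamma> 0) + wl (\<gamma> n)"
  using ray_dist[of \<gamma> 0 n] wl_mult[of "inv (\<gamma> 0)" "\<gamma> n"] ray_carrier[of \<gamma>] by (simp add: wl_inv_eq)

lemma asymptotic_refl: "\<gamma> \<in> geodesic_rays \<Gamma> S \<Longrightarrow> (\<gamma>, \<gamma>) \<in> asymptotic \<Gamma> S"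
  using ray_dist[of \<gamma> n n for n] by (auto simp: asymptotic_def word_dist_def intro!: exI[of _ 0])

end

section \<open>Cartan data along a representation\<close>

locale anosov_setting = local_field_abs v + word_metric \<Gamma> S
  for v :: "'k::field \<Rightarrow> real" and \<Gamma> :: "('g, 'm) monoid_scheme" (structure) and S +
  fixes d :: nat and \<rho> :: "'g \<Rightarrow> 'k mat set"
  assumes hom: "\<rho> \<in> hom \<Gamma> (PGL d)" and d_pos: "0 < d"
begin

definition "R g = pgl_rep (\<rho> g)"
definition "K g = fst (chosen_cartan v d (R g))"
definition "ratio p g = pgl_sv_ratio v d (p + 1) p (\<rho> g)"

lemma \<rho>_carrier: "g \<in> carrier \<Gamma> \<Longrightarrow> \<rho> g \<in> carrier (PGL d)"
  using hom by (auto simp: hom_def)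

lemma R_GL: "g \<in> carrier \<Gamma> \<Longrightarrow> R g \<in> carrier (GL d)"
  unfolding R_def by (rule PGL_rep(2)[OF \<rho>_carrier])

lemma R_mult:
  assumes "g \<in> carrier \<Gamma>" "h \<in> carrier \<Gamma>"
  obtains c where "c \<noteq> 0" "R (g \<otimes> h) = c \<cdot>\<^sub>m (R g * R h)"
proof -
  have "\<rho> (g \<otimes> h) = \<rho> g \<otimes>\<^bsub>PGL d\<^esub> \<rho> h" using hom assms by (auto simp: hom_def)
  then show ?thesis
    using PGL_mult_rep[OF \<rho>_carrier[OF assms(1)] \<rho>_carrier[OF assms(2)]] that \<rho>_carrier[of "g \<otimes> h"] assms
    unfolding R_def by (metis m_closed)
qed

lemma R_inv:
  assumes g: "g \<in> carrier \<Gamma>"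
  obtains s where "s \<noteq> 0" "R (inv g) * R g = s \<cdot>\<^sub>m 1\<^sub>m d"
proof -
  have c: "R h \<in> carrier_mat d d" if "h \<in> carrier \<Gamma>" for h using R_GL[OF that] by simp
  \<comment> \<open>The representative of the identity is idempotent up to a scalar and invertible,
    hence itself a scalar matrix.\<close>
  obtain a where a: "a \<noteq> 0" "R \<one> = a \<cdot>\<^sub>m (R \<one> * R \<one>)" using R_mult[of \<one> \<one>] by auto
  obtain B where B: "B \<in> carrier (GL d)" "B * R \<one> = 1\<^sub>m d" using GL_inverse[OF R_GL[OF one_closed]] by metis
  have Bc: "B \<in> carrier_mat d d" using B(1) by simp
  have "1\<^sub>m d = B * (a \<cdot>\<^sub>m (R \<one> * R \<one>))" using B(2) a(2) by simp
  also have "\<dots> = a \<cdot>\<^sub>m (B * (R \<one> * R \<one>))"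
    by (rule mult_smult_distrib[OF Bc mult_carrier_mat[OF c c]]) auto
  also have "B * (R \<one> * R \<one>) = B * R \<one> * R \<one>" by (rule assoc_mult_mat[OF Bc c c, symmetric]) auto
  also have "\<dots> = R \<one>" unfolding B(2) using left_mult_one_mat[OF c[OF one_closed]] .
  finally have 1: "1\<^sub>m d = a \<cdot>\<^sub>m R \<one>" .
  obtain b where b: "b \<noteq> 0" "R (inv g \<otimes> g) = b \<cdot>\<^sub>m (R (inv g) * R g)" using R_mult[of "inv g" g] g by auto
  have "R \<one> = b \<cdot>\<^sub>m (R (inv g) * R g)" using b(2) l_inv[OF g] by simp
  then have "1\<^sub>m d = (a * b) \<cdot>\<^sub>m (R (inv g) * R g)" unfolding 1 by (intro eq_matI) auto
  then obtain e where e: "e \<noteq> 0" "1\<^sub>m d = e \<cdot>\<^sub>m (R (inv g) * R g)" using a(1) b(1) by (metis mult_eq_0_iff)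
  have "inverse e \<cdot>\<^sub>m 1\<^sub>m d = inverse e \<cdot>\<^sub>m (e \<cdot>\<^sub>m (R (inv g) * R g))" using e(2) by (rule arg_cong)
  also have "\<dots> = R (inv g) * R g" by (rule eq_matI) (use e(1) in \<open>auto simp: mult.assoc[symmetric]\<close>)
  finally have "R (inv g) * R g = inverse e \<cdot>\<^sub>m 1\<^sub>m d" ..
  then show ?thesis using that[of "inverse e"] e(1) by simp
qed

lemma chosen_cartan:
  assumes "g \<in> carrier \<Gamma>"
  obtains a l where "cartan_decomposition v d (R g) (K g, a, l)"
    "\<And>p. ratio p g = v (a $$ (p, p)) / v (a $$ (p - 1, p - 1))"
    "\<And>p. p \<le> d \<Longrightarrow> pgl_U v d p (\<rho> g) = span_of d p (K g)"
proof -
  have c: "cartan_decomposition v d (R g) (chosen_cartan v d (R g))"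
    unfolding chosen_cartan_def by (rule someI_ex[OF cartan_exists[OF d_pos R_GL[OF assms]]])
  obtain a l where al: "chosen_cartan v d (R g) = (K g, a, l)" unfolding K_def by (metis prod.collapse)
  show ?thesis
  proof (rule that)
    show "cartan_decomposition v d (R g) (K g, a, l)" using c unfolding al .
    show "ratio p g = v (a $$ (p, p)) / v (a $$ (p - 1, p - 1))" for p
      unfolding ratio_def pgl_sv_ratio_def singular_value_def R_def[symmetric] al by simp
    show "pgl_U v d p (\<rho> g) = span_of d p (K g)" if "p \<le> d" for p
      unfolding pgl_U_def cartan_subspace_def R_def[symmetric] al using span_unit_vecs[OF that, where 'k = 'k] by simp
  qed
qed

lemma K_isom: "g \<in> carrier \<Gamma> \<Longrightarrow> K g \<in> isoms d"
  using chosen_cartan cartan_D(1) by metis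

lemma U_eq: "g \<in> carrier \<Gamma> \<Longrightarrow> p \<le> d \<Longrightarrow> pgl_U v d p (\<rho> g) = span_of d p (K g)"
  using chosen_cartan by metis

lemma ratio_nonneg: "g \<in> carrier \<Gamma> \<Longrightarrow> 0 \<le> ratio p g"
  using chosen_cartan[of g] by (metis divide_nonneg_nonneg v_nonneg)

text \<open>The gap of \<open>g\<close> at d - p is the gap of its inverse at p. By this the Anosov
  condition at r also produces the limit map with index d - r.\<close>

lemma ratio_inv:
  assumes g: "g \<in> carrier \<Gamma>" and p: "0 < p" "p < d"
  shows "ratio (d - p) g = ratio p (inv g)"
proof -
  obtain a l where al: "cartan_decomposition v d (R g) (K g, a, l)" 
    "ratio (d - p) g = v (a $$ (d - p, d - p)) / v (a $$ (d - p - 1, d - p - 1))"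
    using chosen_cartan[OF g] by metis
  obtain a' l' where al': "cartan_decomposition v d (R (inv g)) (K (inv g), a', l')" 
    "ratio p (inv g) = v (a' $$ (p, p)) / v (a' $$ (p - 1, p - 1))"
    using chosen_cartan[OF inv_closed[OF g]] by metis
  obtain s where s: "s \<noteq> 0" "R (inv g) * R g = s \<cdot>\<^sub>m 1\<^sub>m d" using R_inv[OF g] .
  have e: "d - 1 - p = d - p - 1" "d - 1 - (p - 1) = d - p" using p by auto
  have 1: "v (a' $$ (p,p)) * v (a $$ (d - p - 1, d - p - 1)) = v s"
    using cartan_sv_inverse[OF al(1) al'(1) s(2) p(2)] unfolding e .
  have 2: "v (a' $$ (p-1,p-1)) * v (a $$ (d - p, d - p)) = v s"
    using cartan_sv_inverse[OF al(1) al'(1) s(2), of "p - 1"] p unfolding e by simp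
  have nz: "v (a $$ (d - p - 1, d - p - 1)) \<noteq> 0" "v (a' $$ (p-1,p-1)) \<noteq> 0"
    using cartan_D(10)[OF al(1), of "d - p - 1"] cartan_D(10)[OF al'(1), of "p - 1"] p by auto
  show ?thesis unfolding al(2) al'(2) frac_eq_eq[OF nz] using 1 2 by (simp add: mult.commute)
qed

text \<open>The constant multiplies bounds for \<open>R h\<close> and for its inverse, as in
  \<open>cartan_near\<close>. It depends on \<open>h\<close> but not on \<open>g\<close>.\<close>

lemma step_near:
  assumes h: "h \<in> carrier \<Gamma>" and p: "0 < p" "p < d"
  obtains C where "0 < C" "\<And>g. g \<in> carrier \<Gamma> \<Longrightarrow> near (C * ratio p g) (span_of d p (K (g \<otimes> h))) (span_of d p (K g))"
proof -
  have Rh: "R h \<in> carrier_mat d d" using R_GL[OF h] by simp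
  obtain H' where H': "0 < H'" "\<And>x. x \<in> carrier_vec d \<Longrightarrow> N (R h *\<^sub>v x) \<le> H' * N x"
    using op_bound[OF Rh d_pos] by metis
  obtain B where B: "B \<in> carrier (GL d)" "B * R h = 1\<^sub>m d" using GL_inverse[OF R_GL[OF h]] by metis
  have Bc: "B \<in> carrier_mat d d" using B(1) by simp
  obtain H where H: "0 < H" "\<And>x. x \<in> carrier_vec d \<Longrightarrow> N (B *\<^sub>v x) \<le> H * N x"
    using op_bound[OF Bc d_pos] by metis
  have HB: "N x \<le> H * N (R h *\<^sub>v x)" if "x \<in> carrier_vec d" for x
    using H(2)[OF mult_mat_vec_carrier[OF Rh that]] unfolding inverse_mult_vec[OF B(2) Bc Rh that] .
  show ?thesis
  proof (rule that)
    show "0 < H * H'" using H H' by simp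
    fix g assume g: "g \<in> carrier \<Gamma>"
    obtain a l where al: "cartan_decomposition v d (R g) (K g, a, l)" 
      "ratio p g = v (a $$ (p, p)) / v (a $$ (p - 1, p - 1))" using chosen_cartan[OF g] by metis
    obtain a' l' where al': "cartan_decomposition v d (R (g \<otimes> h)) (K (g \<otimes> h), a', l')"
      using chosen_cartan[OF m_closed[OF g h]] by metis
    obtain c where c: "c \<noteq> 0" "R (g \<otimes> h) = c \<cdot>\<^sub>m (R g * R h)" using R_mult[OF g h] .
    show "near (H * H' * ratio p g) (span_of d p (K (g \<otimes> h))) (span_of d p (K g))"
      unfolding al(2) using cartan_near[OF al(1) al' Rh c(2,1) HB _ H'(2) _ p] H(1) H'(1) by simp
  qed
qed

lemma ball_near:
  assumes p: "0 < p" "p < d"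
  obtains C where "0 < C" "\<And>g h. g \<in> carrier \<Gamma> \<Longrightarrow> h \<in> carrier \<Gamma> \<Longrightarrow> wl h \<le> L \<Longrightarrow>
    near (C * ratio p g) (span_of d p (K (g \<otimes> h))) (span_of d p (K g))"
proof -
  let ?B = "{h \<in> carrier \<Gamma>. wl h \<le> L}"
  have "\<forall>h\<in>?B. \<exists>C>0. \<forall>g\<in>carrier \<Gamma>. near (C * ratio p g) (span_of d p (K (g \<otimes> h))) (span_of d p (K g))"
  proof
    fix h assume "h \<in> ?B"
    then have h: "h \<in> carrier \<Gamma>" by simp
    obtain C where "0 < C" "\<And>g. g \<in> carrier \<Gamma> \<Longrightarrow> near (C * ratio p g) (span_of d p (K (g \<otimes> h))) (span_of d p (K g))"
      using step_near[OF h p] by blast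
    then show "\<exists>C>0. \<forall>g\<in>carrier \<Gamma>. near (C * ratio p g) (span_of d p (K (g \<otimes> h))) (span_of d p (K g))" by blast
  qed
  from bchoice[OF this] obtain C where "\<forall>h\<in>?B. C h > 0 \<and>
      (\<forall>g\<in>carrier \<Gamma>. near (C h * ratio p g) (span_of d p (K (g \<otimes> h))) (span_of d p (K g)))" ..
  then have C: "\<And>h. h \<in> ?B \<Longrightarrow> C h > 0" 
    "\<And>h g. h \<in> ?B \<Longrightarrow> g \<in> carrier \<Gamma> \<Longrightarrow> near (C h * ratio p g) (span_of d p (K (g \<otimes> h))) (span_of d p (K g))"
    by blast+
  \<comment> \<open>The ball in the group is finite, so the sum of its positive constants dominates
    each of them; adding 1 secures positivity.\<close>
  have s: "0 \<le> sum C ?B" using C(1) by (intro sum_nonneg) (auto intro: less_imp_le)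
  show ?thesis
  proof (rule that)
    show "0 < sum C ?B + 1" using s by simp
    fix g h assume g: "g \<in> carrier \<Gamma>" and h: "h \<in> carrier \<Gamma>" "wl h \<le> L"
    have "C h \<le> sum C ?B" using C(1) h finite_wl_ball by (intro member_le_sum) (auto intro: less_imp_le)
    then have "C h * ratio p g \<le> (sum C ?B + 1) * ratio p g" using ratio_nonneg[OF g] by (intro mult_right_mono) auto
    then show "near ((sum C ?B + 1) * ratio p g) (span_of d p (K (g \<otimes> h))) (span_of d p (K g))"
      by - (rule near_mono[OF C(2)[OF _ g] _ isom_image_carrier[OF isom_carrier[OF K_isom[OF m_closed[OF g h(1)]]]] d_pos]; use h in simp)
  qed
qed

end

section \<open>Limit maps\<close>

lemma LIMSEQ_realpow_mult: "0 \<le> q \<Longrightarrow> q < 1 \<Longrightarrow> (\<lambda>n. c * q ^ n) \<longlonglongrightarrow> (0::real)"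
  using tendsto_mult_left[OF LIMSEQ_realpow_zero[of q], of c] by simp

text \<open>The exponential bound is recorded as a geometric one, with q = exp(-\<mu>), so that
  errors along rays form geometric series. The constants are parameters because passing to the dual
  index keeps them.\<close>

locale anosov_index = anosov_setting v \<Gamma> S d \<rho>
  for v :: "'k::field \<Rightarrow> real" and \<Gamma> :: "('g, 'm) monoid_scheme" (structure) and S d \<rho> +
  fixes p :: nat and c q :: real
  assumes p_pos: "0 < p" and p_less: "p < d" and c_pos: "0 < c" and q: "0 < q" "q < 1"
    and ratio_le: "\<And>g. g \<in> carrier \<Gamma> \<Longrightarrow> ratio p g \<le> c * q ^ wl g"
begin

abbreviation "U g \<equiv> span_of d p (K g)"

lemma U_carrier: "g \<in> carrier \<Gamma> \<Longrightarrow> U g \<subseteq> carrier_vec d"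
  using isom_image_carrier isom_carrier K_isom by blast

lemma ray_ratio_le:
  assumes "\<gamma> \<in> geodesic_rays \<Gamma> S"
  shows "ratio p (\<gamma> n) \<le> (c / q ^ wl (\<gamma> 0)) * q ^ n"
proof -
  have "q ^ (wl (\<gamma> 0) + wl (\<gamma> n)) \<le> q ^ n" using q ray_length[OF assms] by (intro power_decreasing) auto
  then have "q ^ wl (\<gamma> n) \<le> q ^ n / q ^ wl (\<gamma> 0)" using q by (simp add: power_add field_simps)
  then have "c * q ^ wl (\<gamma> n) \<le> c * (q ^ n / q ^ wl (\<gamma> 0))" using c_pos by (intro mult_left_mono) auto
  then show ?thesis using ratio_le[OF ray_carrier[OF assms], of n] by simp
qed

lemma ray_near:
  obtains D where "0 < D" "\<And>\<gamma> m n. \<gamma> \<in> geodesic_rays \<Gamma> S \<Longrightarrow> n \<le> m \<Longrightarrow>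
    near (D / q ^ wl (\<gamma> 0) * q ^ n) (U (\<gamma> m)) (U (\<gamma> n))"
proof -
  obtain C where C: "0 < C" "\<And>g h. g \<in> carrier \<Gamma> \<Longrightarrow> h \<in> carrier \<Gamma> \<Longrightarrow> wl h \<le> 1 \<Longrightarrow>
    near (C * ratio p g) (U (g \<otimes> h)) (U g)" using ball_near[OF p_pos p_less, of 1] by metis
  \<comment> \<open>The geometric series with ratio \<open>q\<close> contributes the factor 1 / (1 -
    q). \<open>D\<close> is the same for all rays.\<close>
  define D where "D = C * c / (1 - q)"
  have D: "0 < D" using C c_pos q by (simp add: D_def)
  have "near (D / q ^ wl (\<gamma> 0) * q ^ n) (U (\<gamma> m)) (U (\<gamma> n))" if ray: "\<gamma> \<in> geodesic_rays \<Gamma> S" and "n \<le> m" for \<gamma> m n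
  proof -
    let ?E = "C * c / q ^ wl (\<gamma> 0)"
    have E: "0 < ?E" using C c_pos q by simp
    note car = ray_carrier[OF ray]
    have step: "near (?E * q ^ i) (U (\<gamma> (Suc i))) (U (\<gamma> i))" for i
    proof -
      let ?h = "inv (\<gamma> i) \<otimes> \<gamma> (Suc i)"
      have h: "?h \<in> carrier \<Gamma>" "wl ?h \<le> 1" "\<gamma> i \<otimes> ?h = \<gamma> (Suc i)"
        using car[of i] car[of "Suc i"] ray_dist[OF ray, of i "Suc i"] by (auto simp: m_assoc[symmetric])
      have "C * ratio p (\<gamma> i) \<le> C * ((c / q ^ wl (\<gamma> 0)) * q ^ i)"
        using ray_ratio_le[OF ray, of i] C(1) by (intro mult_left_mono) auto
      then have le: "C * ratio p (\<gamma> i) \<le> ?E * q ^ i" by simp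
      have "near (C * ratio p (\<gamma> i)) (U (\<gamma> (Suc i))) (U (\<gamma> i))" using C(2)[OF car[of i] h(1,2)] unfolding h(3) .
      then show ?thesis by (rule near_mono[OF _ le U_carrier[OF car] d_pos])
    qed
    \<comment> \<open>The partial sum of the powers of \<open>q\<close> from n to m - 1. Keeping it
      exact lets the induction close; only afterwards is it bounded by the full tail.\<close>
    have "near (?E * ((q ^ n - q ^ m) / (1 - q))) (U (\<gamma> m)) (U (\<gamma> n))"
      using \<open>n \<le> m\<close>
    proof (induction m rule: dec_induct)
      case base
      have "N (u - u) \<le> 0" if "u \<in> U (\<gamma> n)" for u
      proof -
        have "u \<in> carrier_vec d" using that U_carrier[OF car] by blast
        then have "u - u = 0\<^sub>v d" by auto
        then show ?thesis using d_pos by simp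
      qed
      then show ?case unfolding near_def by auto
    next
      case (step m)
      have nn: "0 \<le> ?E * ((q ^ n - q ^ m) / (1 - q))"
        using C(1) c_pos q step.hyps power_decreasing[of n m q] by (intro mult_nonneg_nonneg divide_nonneg_nonneg) auto
      have "near (?E * q ^ m + ?E * ((q ^ n - q ^ m) / (1 - q))) (U (\<gamma> (Suc m))) (U (\<gamma> n))"
        by (rule near_trans[OF \<open>\<And>i. near (?E * q ^ i) (U (\<gamma> (Suc i))) (U (\<gamma> i))\<close>[of m] step.IH U_carrier[OF car] U_carrier[OF car] U_carrier[OF car] d_pos nn])
      moreover have "q ^ m + (q ^ n - q ^ m) / (1 - q) = (q ^ n - q ^ Suc m) / (1 - q)"
        using q by (simp add: field_simps)
      then have "?E * q ^ m + ?E * ((q ^ n - q ^ m) / (1 - q)) = ?E * ((q ^ n - q ^ Suc m) / (1 - q))"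
        by (simp only: distrib_left[symmetric])
      ultimately show ?case by simp
    qed
    moreover have "?E * ((q ^ n - q ^ m) / (1 - q)) \<le> ?E * (q ^ n / (1 - q))"
      using E q by (intro mult_left_mono divide_right_mono) auto
    moreover have "?E * (q ^ n / (1 - q)) = D / q ^ wl (\<gamma> 0) * q ^ n" by (simp add: D_def)
    ultimately show ?thesis using near_mono[OF _ _ U_carrier[OF car] d_pos] by metis
  qed
  then show ?thesis using that D by blast
qed

lemma ray_limit:
  obtains D where "0 < D" "\<And>\<gamma>. \<gamma> \<in> geodesic_rays \<Gamma> S \<Longrightarrow> \<exists>l\<in>isoms d.
    span_conv d p (\<lambda>n. K (\<gamma> n)) (span_of d p l) \<and>
    (\<forall>n. near (2 * (D / q ^ wl (\<gamma> 0) * q ^ n)) (span_of d p l) (U (\<gamma> n)))"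
proof -
  obtain D where D: "0 < D" "\<And>\<gamma> m n. \<gamma> \<in> geodesic_rays \<Gamma> S \<Longrightarrow> n \<le> m \<Longrightarrow>
    near (D / q ^ wl (\<gamma> 0) * q ^ n) (U (\<gamma> m)) (U (\<gamma> n))" using ray_near by metis
  have "\<exists>l\<in>isoms d. span_conv d p (\<lambda>n. K (\<gamma> n)) (span_of d p l) \<and>
    (\<forall>n. near (2 * (D / q ^ wl (\<gamma> 0) * q ^ n)) (span_of d p l) (U (\<gamma> n)))"
    if ray: "\<gamma> \<in> geodesic_rays \<Gamma> S" for \<gamma>
  proof -
    have pos: "0 < D / q ^ wl (\<gamma> 0) * q ^ n" for n using D(1) q by simp
    have lim: "(\<lambda>n. D / q ^ wl (\<gamma> 0) * q ^ n) \<longlonglongrightarrow> 0" using q by (intro LIMSEQ_realpow_mult) auto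
    obtain l where "l \<in> isoms d" "span_conv d p (\<lambda>n. K (\<gamma> n)) (span_of d p l)"
      "\<And>n. near (2 * (D / q ^ wl (\<gamma> 0) * q ^ n)) (span_of d p l) (U (\<gamma> n))"
      using cauchy_span_conv[of "\<lambda>n. K (\<gamma> n)" d "\<lambda>n. D / q ^ wl (\<gamma> 0) * q ^ n" p, OF K_isom[OF ray_carrier[OF ray]] D(2)[OF ray] lim pos d_pos]
        p_less by auto
    then show ?thesis by blast
  qed
  then show ?thesis using that D(1) by blast
qed

text \<open>At each time the two rays differ by right multiplication with an element of bounded
  length, so \<open>ball_near\<close> makes their dominant subspaces exponentially close.\<close>

lemma asymptotic_span_conv:
  assumes as: "(\<alpha>, \<gamma>) \<in> asymptotic \<Gamma> S" and W: "span_conv d p (\<lambda>n. K (\<alpha> n)) W"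
  shows "span_conv d p (\<lambda>n. K (\<gamma> n)) W"
proof -
  have rays: "\<alpha> \<in> geodesic_rays \<Gamma> S" "\<gamma> \<in> geodesic_rays \<Gamma> S" using as by (auto simp: asymptotic_def)
  obtain L where L: "\<And>n. wd (\<alpha> n) (\<gamma> n) \<le> L" using as by (auto simp: asymptotic_def)
  note ca = ray_carrier[OF rays(1)] and cg = ray_carrier[OF rays(2)]
  obtain C where C: "0 < C" "\<And>g h. g \<in> carrier \<Gamma> \<Longrightarrow> h \<in> carrier \<Gamma> \<Longrightarrow> wl h \<le> L \<Longrightarrow>
    near (C * ratio p g) (U (g \<otimes> h)) (U g)" using ball_near[OF p_pos p_less, of L] by metis
  have "near (C * (c / q ^ wl (\<gamma> 0)) * q ^ n) (U (\<alpha> n)) (U (\<gamma> n))" for n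
  proof -
    let ?h = "inv (\<gamma> n) \<otimes> \<alpha> n"
    have h: "?h \<in> carrier \<Gamma>" "\<gamma> n \<otimes> ?h = \<alpha> n" using ca[of n] cg[of n] by (auto simp: m_assoc[symmetric])
    have wlh: "wl ?h \<le> L" using L[of n] wd_commute[OF ca[of n] cg[of n]] by (simp add: word_dist_def)
    have n: "near (C * ratio p (\<gamma> n)) (U (\<alpha> n)) (U (\<gamma> n))" using C(2)[OF cg[of n] h(1) wlh] unfolding h(2) .
    have "C * ratio p (\<gamma> n) \<le> C * (c / q ^ wl (\<gamma> 0) * q ^ n)"
      using ray_ratio_le[OF rays(2), of n] C(1) by (intro mult_left_mono) auto
    then have "C * ratio p (\<gamma> n) \<le> C * (c / q ^ wl (\<gamma> 0)) * q ^ n" by (simp only: mult.assoc)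
    then show ?thesis by (rule near_mono[OF n _ U_carrier[OF ca] d_pos])
  qed
  moreover have "(\<lambda>n. C * (c / q ^ wl (\<gamma> 0)) * q ^ n) \<longlonglongrightarrow> 0" using q by (intro LIMSEQ_realpow_mult) auto
  ultimately have "span_conv d p (\<lambda>n. K (\<alpha> n)) W \<longleftrightarrow> span_conv d p (\<lambda>n. K (\<gamma> n)) W"
    using span_conv_near[of "\<lambda>n. K (\<alpha> n)" d "\<lambda>n. K (\<gamma> n)", OF K_isom[OF ca] K_isom[OF cg] _ _ d_pos] p_less by force
  then show ?thesis using W by blast
qed

text \<open>The \<open>THE\<close> ranges over limits common to all rays of the class: a limit along
  one ray is a limit along every asymptotic one, and uniqueness is already forced by
  \<open>\<alpha>\<close>.\<close>

lemma limit_map_eq: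
  assumes \<alpha>: "\<alpha> \<in> geodesic_rays \<Gamma> S" and W: "span_conv d p (\<lambda>n. K (\<alpha> n)) W"
  shows "limit_map v d p \<rho> (asymptotic \<Gamma> S `` {\<alpha>}) = W"
  unfolding limit_map_def
proof (rule the_equality)
  have U: "(\<lambda>n. pgl_U v d p (\<rho> (\<gamma> n))) = (\<lambda>n. U (\<gamma> n))" if "\<gamma> \<in> geodesic_rays \<Gamma> S" for \<gamma>
    using U_eq[OF ray_carrier[OF that]] p_less by simp
  show "\<forall>\<gamma>\<in>asymptotic \<Gamma> S `` {\<alpha>}. limitin (grass_topology v d p) (\<lambda>n. pgl_U v d p (\<rho> (\<gamma> n))) W sequentially"
  proof
    fix \<gamma> assume "\<gamma> \<in> asymptotic \<Gamma> S `` {\<alpha>}"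
    then have as: "(\<alpha>, \<gamma>) \<in> asymptotic \<Gamma> S" by simp
    then have ray: "\<gamma> \<in> geodesic_rays \<Gamma> S" by (auto simp: asymptotic_def)
    show "limitin (grass_topology v d p) (\<lambda>n. pgl_U v d p (\<rho> (\<gamma> n))) W sequentially"
      unfolding U[OF ray]
      by (rule span_conv_limitin[OF asymptotic_span_conv[OF as W] K_isom[OF ray_carrier[OF ray]] d_pos])
        (use p_less in simp)
  qed
  fix W' assume "\<forall>\<gamma>\<in>asymptotic \<Gamma> S `` {\<alpha>}. limitin (grass_topology v d p) (\<lambda>n. pgl_U v d p (\<rho> (\<gamma> n))) W' sequentially"
  then have "limitin (grass_topology v d p) (\<lambda>n. pgl_U v d p (\<rho> (\<alpha> n))) W' sequentially"
    using asymptotic_refl[OF \<alpha>] by blast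
  then have lim: "limitin (grass_topology v d p) (\<lambda>n. U (\<alpha> n)) W' sequentially" unfolding U[OF \<alpha>] .
  show "W' = W"
    by (rule span_conv_unique[OF W K_isom[OF ray_carrier[OF \<alpha>]] d_pos p_pos _ lim]) (use p_less in simp)
qed

lemma limit_map_span_conv:
  assumes "\<alpha> \<in> geodesic_rays \<Gamma> S"
  shows "span_conv d p (\<lambda>n. K (\<alpha> n)) (limit_map v d p \<rho> (asymptotic \<Gamma> S `` {\<alpha>}))"
proof -
  obtain D where "\<exists>l\<in>isoms d. span_conv d p (\<lambda>n. K (\<alpha> n)) (span_of d p l) \<and>
    (\<forall>n. near (2 * (D / q ^ wl (\<alpha> 0) * q ^ n)) (span_of d p l) (U (\<alpha> n)))"
    using ray_limit assms by metis
  then obtain l where "span_conv d p (\<lambda>n. K (\<alpha> n)) (span_of d p l)" by blast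
  then show ?thesis using limit_map_eq[OF assms] by simp
qed

lemma limit_map_isom:
  assumes "x \<in> gromov_boundary \<Gamma> S"
  obtains l where "l \<in> isoms d" "limit_map v d p \<rho> x = span_of d p l"
proof -
  obtain \<alpha> where \<alpha>: "\<alpha> \<in> geodesic_rays \<Gamma> S" "x = asymptotic \<Gamma> S `` {\<alpha>}"
    using assms by (auto simp: gromov_boundary_def quotient_def)
  obtain l s where "l \<in> isoms d" "span_of d p l = limit_map v d p \<rho> x"
    using span_conv_cluster[OF limit_map_span_conv[OF \<alpha>(1)] K_isom[OF ray_carrier[OF \<alpha>(1)]] d_pos] \<alpha>(2) by metis
  then show ?thesis using that by simp
qed

text \<open>In the quotient topology openness is tested on rays issued from the identity. There the
  starting point has word length 0, so the rate of convergence is the same for all rays under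
  consideration.\<close>

lemma continuous_limit_map:
  "continuous_map (boundary_topology \<Gamma> S) (grass_topology v d p) (limit_map v d p \<rho>)"
  unfolding continuous_map_def topspace_boundary_topology topspace_grass
proof (intro conjI allI impI)
  show "limit_map v d p \<rho> \<in> gromov_boundary \<Gamma> S \<rightarrow> Grass d p"
  proof
    fix x assume "x \<in> gromov_boundary \<Gamma> S"
    then obtain l where "l \<in> isoms d" "limit_map v d p \<rho> x = span_of d p l" using limit_map_isom by metis
    then show "limit_map v d p \<rho> x \<in> Grass d p" using isom_span_Grass[of l d p] p_less by simp
  qed
next
  fix Q :: "'k vec set set" assume Q: "openin (grass_topology v d p) Q"
  let ?\<xi> = "\<lambda>\<gamma>. limit_map v d p \<rho> (asymptotic \<Gamma> S `` {\<gamma>})"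
  let ?P = "product_topology (\<lambda>_::nat. discrete_topology (carrier \<Gamma>)) UNIV"
  let ?R = "{\<gamma> \<in> geodesic_rays \<Gamma> S. \<gamma> 0 = \<one>}"
  obtain D where D: "0 < D" "\<And>\<gamma>. \<gamma> \<in> geodesic_rays \<Gamma> S \<Longrightarrow> \<exists>l\<in>isoms d.
    span_conv d p (\<lambda>n. K (\<gamma> n)) (span_of d p l) \<and>
    (\<forall>n. near (2 * (D / q ^ wl (\<gamma> 0) * q ^ n)) (span_of d p l) (U (\<gamma> n)))"
    using ray_limit by blast
  have near: "\<exists>l\<in>isoms d. ?\<xi> \<gamma> = span_of d p l \<and> (\<forall>n. near (2 * D * q ^ n) (span_of d p l) (U (\<gamma> n)))"
    if \<gamma>: "\<gamma> \<in> ?R" for \<gamma>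
  proof -
    have ray: "\<gamma> \<in> geodesic_rays \<Gamma> S" "\<gamma> 0 = \<one>" using \<gamma> by auto
    obtain l where l: "l \<in> isoms d" "span_conv d p (\<lambda>n. K (\<gamma> n)) (span_of d p l)"
      "\<And>n. near (2 * (D / q ^ wl (\<gamma> 0) * q ^ n)) (span_of d p l) (U (\<gamma> n))" using D(2)[OF ray(1)] by blast
    have "near (2 * D * q ^ n) (span_of d p l) (U (\<gamma> n))" for n using l(3)[of n] ray(2) by (simp add: mult.assoc)
    then show ?thesis using l(1) limit_map_eq[OF ray(1) l(2)] by blast
  qed
  \<comment> \<open>Rays that agree up to time \<open>n\<close> have limits within \<open>2 D q\<^sup>n\<close> of the same subspace \<open>U (\<gamma> n)\<close>.\<close>
  have key: "\<exists>n. \<forall>\<gamma>'\<in>?R. (\<forall>i\<le>n. \<gamma>' i = \<gamma> i) \<longrightarrow> ?\<xi> \<gamma>' \<in> Q" if \<gamma>: "\<gamma> \<in> ?R" "?\<xi> \<gamma> \<in> Q" for \<gamma>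
  proof (rule ccontr)
    assume "\<not> ?thesis"
    then have "\<forall>n. \<exists>\<gamma>'. \<gamma>' \<in> ?R \<and> (\<forall>i\<le>n. \<gamma>' i = \<gamma> i) \<and> ?\<xi> \<gamma>' \<notin> Q" by blast
    from choice[OF this] obtain g where g: "\<And>n. g n \<in> ?R" "\<And>n. g n n = \<gamma> n" "\<And>n. ?\<xi> (g n) \<notin> Q" by auto
    have "\<forall>n. \<exists>l. l \<in> isoms d \<and> ?\<xi> (g n) = span_of d p l \<and> near (2 * D * q ^ n) (span_of d p l) (U (\<gamma> n))"
      using near[OF g(1)] g(2) by metis
    from choice[OF this] obtain l where l: "\<And>n. l n \<in> isoms d" "\<And>n. ?\<xi> (g n) = span_of d p (l n)"
      "\<And>n. near (2 * D * q ^ n) (span_of d p (l n)) (U (\<gamma> n))" by blast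
    have ray: "\<gamma> \<in> geodesic_rays \<Gamma> S" using \<gamma> by simp
    have lim: "(\<lambda>n. 2 * D * q ^ n) \<longlonglongrightarrow> 0" using q by (intro LIMSEQ_realpow_mult) auto
    \<comment> \<open>The limits of the rays \<open>g n\<close> and the subspaces
      \<open>U (\<gamma> n)\<close> become arbitrarily close, so the former inherit the limit of the
      latter.\<close>
    have "span_conv d p l (?\<xi> \<gamma>)"
      using span_conv_near[of l d "\<lambda>n. K (\<gamma> n)", OF l(1) K_isom[OF ray_carrier[OF ray]] l(3) lim d_pos] p_less
        limit_map_span_conv[OF ray] by simp
    then have "limitin (grass_topology v d p) (\<lambda>n. span_of d p (l n)) (?\<xi> \<gamma>) sequentially"
      using span_conv_limitin l(1) d_pos p_less by simp
    then have "\<forall>\<^sub>F n in sequentially. span_of d p (l n) \<in> Q" using Q \<gamma>(2) unfolding limitin_def by blast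
    then obtain n where "span_of d p (l n) \<in> Q" using eventually_happens'[OF sequentially_bot] by blast
    then show False using g(3)[of n] l(2)[of n] by simp
  qed
  have R: "?R \<subseteq> topspace ?P" using ray_carrier by (auto simp: topspace_product_topology)
  have "openin (subtopology ?P ?R) {\<gamma> \<in> ?R. ?\<xi> \<gamma> \<in> Q}"
  proof (subst openin_subopen, intro ballI)
    fix \<gamma> assume \<gamma>: "\<gamma> \<in> {\<gamma> \<in> ?R. ?\<xi> \<gamma> \<in> Q}"
    then obtain n where n: "\<forall>\<gamma>'\<in>?R. (\<forall>i\<le>n. \<gamma>' i = \<gamma> i) \<longrightarrow> ?\<xi> \<gamma>' \<in> Q" using key[of \<gamma>] by blast
    \<comment> \<open>A cylinder: the first n + 1 values are prescribed and all others are free,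
      which is a basic open set for pointwise convergence of maps into a discrete space.\<close>
    define X where "X i = (if i \<le> n then {\<gamma> i} else carrier \<Gamma>)" for i
    have "openin ?P (Pi\<^sub>E UNIV X)"
    proof (rule product_topology_basis)
      show "openin (discrete_topology (carrier \<Gamma>)) (X i)" for i
        using \<gamma> ray_carrier[of \<gamma>] by (auto simp: X_def)
      have "{i. X i \<noteq> topspace (discrete_topology (carrier \<Gamma>))} \<subseteq> {..n}" by (auto simp: X_def)
      then show "finite {i. X i \<noteq> topspace (discrete_topology (carrier \<Gamma>))}" by (rule finite_subset) simp
    qed
    then have "openin (subtopology ?P ?R) (Pi\<^sub>E UNIV X \<inter> ?R)" unfolding openin_subtopology by blast
    moreover have "\<gamma> \<in> Pi\<^sub>E UNIV X \<inter> ?R" using \<gamma> ray_carrier[of \<gamma>] by (auto simp: X_def)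
    moreover have "Pi\<^sub>E UNIV X \<inter> ?R \<subseteq> {\<gamma> \<in> ?R. ?\<xi> \<gamma> \<in> Q}"
    proof
      fix \<gamma>' assume \<gamma>': "\<gamma>' \<in> Pi\<^sub>E UNIV X \<inter> ?R"
      have "\<gamma>' i = \<gamma> i" if "i \<le> n" for i
      proof -
        have "\<gamma>' i \<in> X i" using \<gamma>' by (auto simp: PiE_def Pi_def)
        then show ?thesis using that by (simp add: X_def)
      qed
      then show "\<gamma>' \<in> {\<gamma> \<in> ?R. ?\<xi> \<gamma> \<in> Q}" using n \<gamma>' by blast
    qed
    ultimately show "\<exists>T. openin (subtopology ?P ?R) T \<and> \<gamma> \<in> T \<and> T \<subseteq> {\<gamma> \<in> ?R. ?\<xi> \<gamma> \<in> Q}" by blast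
  qed
  moreover have "{\<gamma> \<in> topspace (subtopology ?P ?R). asymptotic \<Gamma> S `` {\<gamma>} \<in> {x \<in> gromov_boundary \<Gamma> S. limit_map v d p \<rho> x \<in> Q}}
     = {\<gamma> \<in> ?R. ?\<xi> \<gamma> \<in> Q}"
  proof -
    have "asymptotic \<Gamma> S `` {\<gamma>} \<in> gromov_boundary \<Gamma> S" if "\<gamma> \<in> geodesic_rays \<Gamma> S" for \<gamma>
      using that by (auto simp: gromov_boundary_def quotient_def)
    then show ?thesis using R by (auto simp: topspace_subtopology)
  qed
  ultimately show "openin (boundary_topology \<Gamma> S) {x \<in> gromov_boundary \<Gamma> S. limit_map v d p \<rho> x \<in> Q}"
    unfolding boundary_topology_def openin_quotient_topology by auto
qed

end

context anosov_setting begin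

lemma anosov_indexI:
  assumes "anosov v d \<Gamma> S p \<rho>" "0 < p" "p < d"
  obtains c q where "anosov_index v \<Gamma> S d \<rho> p c q"
proof -
  obtain c \<mu> where *: "c > 0" "\<mu> > 0" "\<And>g. g \<in> carrier \<Gamma> \<Longrightarrow> ratio p g \<le> c * exp (- \<mu> * real (wl g))"
    using assms(1) unfolding anosov_def ratio_def by blast
  have "exp (- \<mu> * real n) = exp (- \<mu>) ^ n" for n by (metis exp_of_nat_mult mult.commute)
  then have "anosov_index v \<Gamma> S d \<rho> p c (exp (- \<mu>))"
    using * assms(2,3) by unfold_locales auto
  then show ?thesis using that by blast
qed

lemma anosov_index_dual:
  assumes "anosov_index v \<Gamma> S d \<rho> p c q"
  shows "anosov_index v \<Gamma> S d \<rho> (d - p) c q"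
proof -
  interpret anosov_index v \<Gamma> S d \<rho> p c q by fact
  have "ratio (d - p) g \<le> c * q ^ wl g" if "g \<in> carrier \<Gamma>" for g
    using ratio_inv[OF that p_pos p_less] ratio_le[OF inv_closed[OF that]] wl_inv_eq[OF that] by simp
  then show ?thesis using p_pos p_less c_pos q by unfold_locales auto
qed

end

text \<open>A single subsequence of the isometries \<open>K (\<alpha> n)\<close> serves both
  indices: the two limits are spanned by initial columns of the same limit isometry.\<close>

lemma limit_map_mono:
  assumes "anosov_index v \<Gamma> S d \<rho> p c q" "anosov_index v \<Gamma> S d \<rho> p' c' q'" "p \<le> p'" "x \<in> gromov_boundary \<Gamma> S"
  shows "limit_map v d p \<rho> x \<subseteq> limit_map v d p' \<rho> x"
proof -
  interpret A: anosov_index v \<Gamma> S d \<rho> p c q by fact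
  interpret B: anosov_index v \<Gamma> S d \<rho> p' c' q' by fact
  obtain \<alpha> where \<alpha>: "\<alpha> \<in> geodesic_rays \<Gamma> S" "x = asymptotic \<Gamma> S `` {\<alpha>}"
    using assms(4) by (auto simp: gromov_boundary_def quotient_def)
  obtain l s where l: "l \<in> norm_stabilizer v d" "strict_mono (s :: nat \<Rightarrow> nat)"
      "(\<lambda>t. A.mnorm d d (A.K (\<alpha> (s t)) - l)) \<longlonglongrightarrow> 0"
      "A.span_of d p l = limit_map v d p \<rho> x"
    using A.span_conv_cluster[OF A.limit_map_span_conv[OF \<alpha>(1)] A.K_isom[OF A.ray_carrier[OF \<alpha>(1)]] A.d_pos] \<alpha>(2) by metis
  have "A.span_of d p' l = limit_map v d p' \<rho> x"
    using B.limit_map_span_conv[OF \<alpha>(1)] l(1-3) \<alpha>(2) unfolding A.span_conv_def by blast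
  then show ?thesis using l(4) assms(3) by (force simp: coord_subspace_def)
qed

section \<open>Hyperconvex representations\<close>

lemma (in local_field_abs) projected_line_Grass:
  assumes l: "l \<in> isoms d" and d: "0 < d" and B: "B \<in> carrier_mat r d"
    and u: "u \<in> span_of d 1 l" "B *\<^sub>v u \<noteq> 0\<^sub>v r"
  shows "(*\<^sub>v) B ` span_of d 1 l \<in> Grass r 1"
proof -
  have lc: "l \<in> carrier_mat d d" using isom_carrier[OF l] .
  define A where "A = frame d 1 l"
  have A: "A \<in> carrier_mat d 1" "vec_space.col_space d A = span_of d 1 l"
    unfolding A_def using frame_col_space[OF lc, of 1] d by auto
  have BA: "B * A \<in> carrier_mat r 1" using B A by auto
  obtain x where x: "x \<in> carrier_vec 1" "u = A *\<^sub>v x" using u(1) unfolding A(2)[symmetric] col_space_iff[OF A(1)] by blast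
  have "(B * A) *\<^sub>v x \<noteq> 0\<^sub>v r" using u(2) unfolding x(2) assoc_mult_mat_vec[OF B A(1) x(1)] .
  then have "vec_space.rank r (B * A) = 1" using column_mult_zero[OF BA] rank_column[OF BA] x(1) by blast
  then show ?thesis using col_space_Grass[OF BA] unfolding col_space_mult[OF B A(1)] A(2) by simp
qed

theorem corollary6p6:
  fixes v :: "'k::field \<Rightarrow> real"
    and \<Gamma> :: "('g, 'm) monoid_scheme"
    and S :: "'g set"
    and d r :: nat
    and z :: "(nat \<Rightarrow> 'g) set"
  assumes "local_field v"
    and "word_hyperbolic \<Gamma> S"
    and "z \<in> gromov_boundary \<Gamma> S"
    and "r \<in> {2..d - 1}"
    and "\<not> (\<exists>f. continuous_map
                  (subtopology (boundary_topology \<Gamma> S) (gromov_boundary \<Gamma> S - {z}))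
                  (proj_space_topology v r) f
              \<and> inj_on f (gromov_boundary \<Gamma> S - {z}))"
  shows "\<not> (\<exists>\<rho> :: 'g \<Rightarrow> 'k mat set. \<rho> \<in> hom \<Gamma> (PGL d) \<and> hyperconvex_1_1 v d \<Gamma> S r \<rho>)"
proof
  let ?X = "gromov_boundary \<Gamma> S"
  assume "\<exists>\<rho> :: 'g \<Rightarrow> 'k mat set. \<rho> \<in> hom \<Gamma> (PGL d) \<and> hyperconvex_1_1 v d \<Gamma> S r \<rho>"
  then obtain \<rho> :: "'g \<Rightarrow> 'k mat set" where \<rho>: "\<rho> \<in> hom \<Gamma> (PGL d)"
    and hc: "hyperconvex_1_1 v d \<Gamma> S r \<rho>" by blast
  note hc' = hc[unfolded hyperconvex_1_1_def]
  note an = conjunct1[OF hc'] conjunct1[OF conjunct2[OF hc']]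
  note hyp = conjunct2[OF conjunct2[OF hc'], rule_format]
  have r: "2 \<le> r" "r < d" using assms(4) by auto
  interpret group \<Gamma> using assms(2) by (simp add: word_hyperbolic_def)
  interpret anosov_setting v \<Gamma> S d \<rho>
  proof
    show "local_field v" by fact
    show "finite S" "symmetric_generating_set \<Gamma> S" using assms(2) by (simp_all add: word_hyperbolic_def)
    show "\<rho> \<in> hom \<Gamma> (PGL d)" by fact
    show "0 < d" using r by simp
  qed
  obtain c1 q1 where I1: "anosov_index v \<Gamma> S d \<rho> 1 c1 q1" 
    by (rule anosov_indexI[OF an(1)]) (use r in auto)
  obtain cr qr where Ir: "anosov_index v \<Gamma> S d \<rho> r cr qr" 
    by (rule anosov_indexI[OF an(2)]) (use r in auto)
  have Id: "anosov_index v \<Gamma> S d \<rho> (d - r) cr qr" by (rule anosov_index_dual[OF Ir])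
  interpret I1: anosov_index v \<Gamma> S d \<rho> 1 c1 q1 by fact
  interpret Id: anosov_index v \<Gamma> S d \<rho> "d - r" cr qr by fact
  define \<xi> where "\<xi> = limit_map v d 1 \<rho>"
  define \<eta> where "\<eta> = limit_map v d (d - r) \<rho>"
  \<comment> \<open>As \<open>r < d\<close>, the index d - r is at least 1.\<close>
  have \<xi>\<eta>: "\<xi> x \<subseteq> \<eta> x" if "x \<in> ?X" for x
    unfolding \<xi>_def \<eta>_def by (rule limit_map_mono[OF I1 Id _ that]) (use r in simp)
  have line: "\<exists>u. u \<in> carrier_vec d \<and> u \<noteq> 0\<^sub>v d \<and> \<xi> x = {c \<cdot>\<^sub>v u | c. True}" if x: "x \<in> ?X" for x
  proof -
    obtain l where l: "l \<in> isoms d" "\<xi> x = span_of d 1 l" unfolding \<xi>_def by (rule I1.limit_map_isom[OF x])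
    obtain u where "u \<in> carrier_vec d" "u \<noteq> 0\<^sub>v d" "span_of d 1 l = {c \<cdot>\<^sub>v u | c. True}"
      using span_of_line[OF l(1) d_pos] .
    then show ?thesis unfolding l(2) by (intro exI conjI)
  qed
  have zero: "0\<^sub>v d \<in> \<xi> x" if x: "x \<in> ?X" for x
  proof -
    obtain u where u: "u \<in> carrier_vec d" "\<xi> x = {c \<cdot>\<^sub>v u | c. True}" using line[OF x] by blast
    have "0 \<cdot>\<^sub>v u = 0\<^sub>v d" using u(1) by auto
    then show ?thesis unfolding u(2) by (intro CollectI exI[of _ 0]) simp
  qed
  \<comment> \<open>Hyperconvexity with the zero vector chosen in the second line: the third point
    \<open>y\<close> is only needed to form an admissible triple.\<close>
  have transv: "u = 0\<^sub>v d"
    if "x \<in> ?X" "y \<in> ?X" "e \<in> ?X" "x \<noteq> y" "y \<noteq> e" "x \<noteq> e" "u \<in> \<xi> x" "u \<in> \<eta> e" "u \<in> carrier_vec d" for x y e u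
  proof -
    have "u = u + 0\<^sub>v d" using that(9) by simp
    then have "u \<in> {u + w | u w. u \<in> \<xi> x \<and> w \<in> \<xi> y}" using that(7) zero[OF that(2)] by blast
    then show ?thesis using hyp[OF that(1-6)] that(8) unfolding \<xi>_def \<eta>_def by blast
  qed
  have "\<exists>f. continuous_map (subtopology (boundary_topology \<Gamma> S) (?X - {z})) (proj_space_topology v r) f
              \<and> inj_on f (?X - {z})"
  proof (cases "\<exists>x y. x \<in> ?X - {z} \<and> y \<in> ?X - {z} \<and> x \<noteq> y")
    case False
    \<comment> \<open>At most one point remains besides \<open>z\<close>, so a constant map onto any
      line is injective.\<close>
    have "span_of r 1 (1\<^sub>m r :: 'k mat) \<in> Grass r 1" by (rule image_coord_Grass[OF one_GL]) (use r in simp)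
    then have "continuous_map (subtopology (boundary_topology \<Gamma> S) (?X - {z})) (proj_space_topology v r)
       (\<lambda>_. span_of r 1 (1\<^sub>m r :: 'k mat))"
      by (simp add: proj_space_topology_def)
    moreover have "inj_on (\<lambda>_. span_of r 1 (1\<^sub>m r :: 'k mat)) (?X - {z})" using False by (auto simp: inj_on_def)
    ultimately show ?thesis by blast
  next
    case True
    then have third: "\<exists>y\<in>?X - {z}. y \<noteq> x" for x by (metis (no_types))
    obtain k where k: "k \<in> isoms d" "\<eta> z = span_of d (d - r) k"
      unfolding \<eta>_def by (rule Id.limit_map_isom[OF assms(3)])
    have dr: "d - (d - r) = r" using r by simp
    \<comment> \<open>\<open>B\<close> represents the projection onto the quotient by
      \<open>\<eta> z\<close>, identified with the standard space of dimension d - (d - r) =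
      r.\<close>
    have "\<exists>B\<in>carrier_mat r d. \<forall>w\<in>carrier_vec d. B *\<^sub>v w = 0\<^sub>v r \<longleftrightarrow> w \<in> \<eta> z"
      by (rule span_of_kernel[OF k(1) diff_le_self[of d r], unfolded dr k(2)[symmetric]]) blast
    then obtain B where B: "B \<in> carrier_mat r d"
      and ker: "\<And>w. w \<in> carrier_vec d \<Longrightarrow> B *\<^sub>v w = 0\<^sub>v r \<longleftrightarrow> w \<in> \<eta> z" by blast
    define f where "f x = (*\<^sub>v) B ` \<xi> x" for x
    have nz: "B *\<^sub>v u \<noteq> 0\<^sub>v r" if x: "x \<in> ?X - {z}" and u: "u \<in> \<xi> x" "u \<in> carrier_vec d" "u \<noteq> 0\<^sub>v d" for x u
    proof
      assume "B *\<^sub>v u = 0\<^sub>v r"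
      then have uz: "u \<in> \<eta> z" using ker u(2) by blast
      obtain y where "y \<in> ?X - {z}" "y \<noteq> x" using third by blast
      then have "u = 0\<^sub>v d" using transv[of x y z u] x u uz assms(3) by blast
      then show False using u(3) by simp
    qed
    \<comment> \<open>The point \<open>z\<close> fails the condition because its line lies in
      \<open>\<eta> z\<close>; every other point satisfies it by transversality with a third point
      taken from \<open>third\<close>.\<close>
    have ex_nz: "(\<exists>u\<in>\<xi> x. B *\<^sub>v u \<noteq> 0\<^sub>v r) \<longleftrightarrow> x \<noteq> z" if x: "x \<in> ?X" for x
    proof
      obtain u where u: "u \<in> carrier_vec d" "u \<noteq> 0\<^sub>v d" "\<xi> x = {c \<cdot>\<^sub>v u | c. True}" using line[OF x] by blast
      have "1 \<cdot>\<^sub>v u \<in> \<xi> x" unfolding u(3) by blast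
      then have "u \<in> \<xi> x" using u(1) by simp
      then show "\<exists>u\<in>\<xi> x. B *\<^sub>v u \<noteq> 0\<^sub>v r" if "x \<noteq> z" using nz[of x u] u x that by blast
      assume "\<exists>u\<in>\<xi> x. B *\<^sub>v u \<noteq> 0\<^sub>v r"
      then obtain w where w: "w \<in> \<xi> x" "B *\<^sub>v w \<noteq> 0\<^sub>v r" by blast
      have "w \<in> carrier_vec d" using w(1) u(1) unfolding u(3) by auto
      then have "w \<notin> \<eta> z" using ker w(2) by blast
      then show "x \<noteq> z" using \<xi>\<eta>[OF assms(3)] w(1) by blast
    qed
    have "continuous_map (subtopology (boundary_topology \<Gamma> S) (?X - {z})) (proj_space_topology v r) f"
      unfolding continuous_map_def proj_space_topology_def topspace_grass
    proof (intro conjI allI impI)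
      show "f \<in> topspace (subtopology (boundary_topology \<Gamma> S) (?X - {z})) \<rightarrow> Grass r 1"
      proof
        fix x assume "x \<in> topspace (subtopology (boundary_topology \<Gamma> S) (?X - {z}))"
        then have x: "x \<in> ?X" "x \<noteq> z" by auto
        obtain l where l: "l \<in> isoms d" "\<xi> x = span_of d 1 l" unfolding \<xi>_def by (rule I1.limit_map_isom[OF x(1)])
        obtain u where "u \<in> \<xi> x" "B *\<^sub>v u \<noteq> 0\<^sub>v r" using ex_nz[OF x(1)] x(2) by blast
        then show "f x \<in> Grass r 1" unfolding f_def l(2) by (intro projected_line_Grass[OF l(1) d_pos B])
      qed
      fix Q assume Q: "openin (grass_topology v r 1) Q"
      have "openin (boundary_topology \<Gamma> S) {x \<in> topspace (boundary_topology \<Gamma> S).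
          \<xi> x \<in> {L \<in> Grass d 1. (\<exists>u\<in>L. B *\<^sub>v u \<noteq> 0\<^sub>v r) \<and> (*\<^sub>v) B ` L \<in> Q}}"
        using openin_continuous_map_preimage[OF I1.continuous_limit_map open_projection[OF B Q]] unfolding \<xi>_def .
      \<comment> \<open>By \<open>ex_nz\<close> the open domain of the projection already excludes
        \<open>z\<close>.\<close>
      moreover have "{x \<in> topspace (boundary_topology \<Gamma> S).
          \<xi> x \<in> {L \<in> Grass d 1. (\<exists>u\<in>L. B *\<^sub>v u \<noteq> 0\<^sub>v r) \<and> (*\<^sub>v) B ` L \<in> Q}} \<inter> (?X - {z})
          = {x \<in> topspace (subtopology (boundary_topology \<Gamma> S) (?X - {z})). f x \<in> Q}"
      proof -
        have "\<xi> x \<in> {L \<in> Grass d 1. (\<exists>u\<in>L. B *\<^sub>v u \<noteq> 0\<^sub>v r) \<and> (*\<^sub>v) B ` L \<in> Q} \<longleftrightarrow> x \<noteq> z \<and> f x \<in> Q"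
          if x: "x \<in> ?X" for x
        proof -
          obtain l where l: "l \<in> isoms d" "\<xi> x = span_of d 1 l" unfolding \<xi>_def by (rule I1.limit_map_isom[OF x])
          have "\<xi> x \<in> Grass d 1" unfolding l(2) by (rule isom_span_Grass[OF l(1)]) (use r in simp)
          then show ?thesis unfolding mem_Collect_eq ex_nz[OF x] f_def by blast
        qed
        then show ?thesis unfolding topspace_subtopology topspace_boundary_topology by blast
      qed
      ultimately show "openin (subtopology (boundary_topology \<Gamma> S) (?X - {z}))
          {x \<in> topspace (subtopology (boundary_topology \<Gamma> S) (?X - {z})). f x \<in> Q}"
        unfolding openin_subtopology by blast
    qed
    moreover have "inj_on f (?X - {z})"
    proof (rule inj_onI, rule ccontr)
      fix x y assume x: "x \<in> ?X - {z}" and y: "y \<in> ?X - {z}" and eq: "f x = f y" and ne: "x \<noteq> y"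
      obtain u where u: "u \<in> carrier_vec d" "u \<noteq> 0\<^sub>v d" "\<xi> x = {c \<cdot>\<^sub>v u | c. True}" using line[of x] x by blast
      obtain w where w: "w \<in> carrier_vec d" "w \<noteq> 0\<^sub>v d" "\<xi> y = {c \<cdot>\<^sub>v w | c. True}" using line[of y] y by blast
      have "1 \<cdot>\<^sub>v u \<in> \<xi> x" unfolding u(3) by blast
      then have ux: "u \<in> \<xi> x" using u(1) by simp
      then have "B *\<^sub>v u \<in> f x" unfolding f_def by (rule imageI)
      then have "B *\<^sub>v u \<in> f y" unfolding eq .
      \<comment> \<open>Equal projections of the two lines give a combination of \<open>u\<close>
        and \<open>w\<close> in the kernel \<open>\<eta> z\<close>, to which hyperconvexity of the
        triple x, y, z applies.\<close>
      then obtain c where c: "B *\<^sub>v u = B *\<^sub>v (c \<cdot>\<^sub>v w)" unfolding f_def w(3) by blast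
      have cw: "c \<cdot>\<^sub>v w \<in> carrier_vec d" "c \<cdot>\<^sub>v w \<in> \<xi> y" using w by auto
      have "B *\<^sub>v (u - c \<cdot>\<^sub>v w) = B *\<^sub>v u - B *\<^sub>v (c \<cdot>\<^sub>v w)" by (rule mult_minus_distrib_mat_vec[OF B u(1) cw(1)])
      also have "\<dots> = 0\<^sub>v r" unfolding c using mult_mat_vec_carrier[OF B cw(1)] by simp
      finally have "u - c \<cdot>\<^sub>v w \<in> \<eta> z" using ker[of "u - c \<cdot>\<^sub>v w"] u(1) cw(1) by simp
      moreover have "u - c \<cdot>\<^sub>v w = u + (- c) \<cdot>\<^sub>v w" using u(1) w(1) by (intro eq_vecI) auto
      then have "u - c \<cdot>\<^sub>v w \<in> {u + w | u w. u \<in> \<xi> x \<and> w \<in> \<xi> y}" using ux w(3) by blast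
      ultimately have "u - c \<cdot>\<^sub>v w = 0\<^sub>v d" using hyp[of x y z] x y ne assms(3) unfolding \<xi>_def \<eta>_def by blast
      then have 0: "(u - c \<cdot>\<^sub>v w) $ i = 0\<^sub>v d $ i" for i by (rule arg_cong)
      have "u = c \<cdot>\<^sub>v w"
      proof (rule eq_vecI)
        fix i assume "i < dim_vec (c \<cdot>\<^sub>v w)"
        then show "u $ i = (c \<cdot>\<^sub>v w) $ i" using 0[of i] u(1) w(1) by simp
      qed (use u(1) w(1) in simp)
      \<comment> \<open>The lines of \<open>x\<close> and \<open>y\<close> now share a nonzero
        vector. Since the line of \<open>y\<close> lies in \<open>\<eta> y\<close>, this contradicts
        transversality, with \<open>z\<close> as third point.\<close>
      then have "u \<in> \<eta> y" using cw(2) \<xi>\<eta>[of y] y by blast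
      then have "u = 0\<^sub>v d" using transv[of x z y u] x y ne ux u(1) assms(3) by blast
      then show False using u(2) by simp
    qed
    ultimately show ?thesis by blast
  qed
  then show False using assms(5) by blast
qed

end
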